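(* Let $L=\begin{pmatrix} A & B \\ C & D \end{pmatrix}$ be a generic block matrix with $n\times n$ complex blocks, and let $\tilde L=f(L)=(L^{-1})^t$, where $t$ denotes block transposition $\begin{pmatrix} A & B \\ C & D \end{pmatrix}^t=\begin{pmatrix} A & C \\ B & D \end{pmatrix}$. Let $\Gamma$: $P(u,v)=0$ be the vacuum curve of $L$, with vacuum and covacuum vectors $X(u,v)$, $Y(u,v)$. Then: (1) the vacuum curve $\tilde\Gamma$ of $\tilde L$ is given by $u^nv^nP(-u^{-1},-v^{-1})=0$; (2) the vacuum vector $\tilde X$ of $\tilde L$ at the point $(-u^{-1},-v^{-1})\in\tilde\Gamma$ coincides with the covacuum vector $Y(u,v)$ of $L$ at $(u,v)\in\Gamma$; (3) after identification of $\Gamma$ and $\tilde\Gamma$ by the isomorphism $(u,v)\leftrightarrow(-u^{-1},-v^{-1})$, the linear equivalence of divisors $D_{\tilde X}\sim D_Y\sim D_X+D_U-D_V$ holds; (4) the vacuum curve of $f(f(L))$ is $\Gamma$.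
   Context: The vacuum curve $\Gamma$ of $L$ is the curve (completed in $\mathbb{CP}^1\times\mathbb{CP}^1$) given by $P(u,v)=\det(uA+B-uvC-vD)=0$. Equivalently, it is the set of $(u,v)$ for which there are non-zero $X,Y\in\mathbb C^n$ with $L(U\otimes X)=V\otimes Y$, where $U=\binom u1$, $V=\binom v1$ (here $U\otimes X=\binom{uX}{X}$, $V\otimes Y=\binom{vY}{Y}$). For generic $L$ the curve $\Gamma$ is smooth of genus $(n-1)^2$ and $X,Y$ are determined up to scalar factors. $X=X(u,v)$ is called the vacuum vector and $Y=Y(u,v)$ the covacuum vector; they are normalized by the condition that the last coordinate be identically $1$, and become meromorphic vectors on $\Gamma$. $D_X,D_Y$ are their pole divisors; $D_U,D_V$ are the pole divisors of the functions $u$ and $v$ on $\Gamma$. $D_{\tilde X}$ is the pole divisor of the vacuum vector of $\tilde L$ on $\tilde\Gamma$. "Generic" means: outside a proper Zariski closed subset of the space of matrices $L$. *)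

theory Defs
  imports
    "HOL-Complex_Analysis.Complex_Analysis"
    "Jordan_Normal_Form.Determinant"
    "Jordan_Normal_Form.Gauss_Jordan_Elimination"
begin

unbundle no vec_syntax
hide_const (open) Determinants.det

inductive poly_fun :: "nat \<Rightarrow> (complex mat \<Rightarrow> complex) \<Rightarrow> bool" for m :: nat where
  const: "poly_fun m (\<lambda>_. c)"
| entry: "i < m \<Longrightarrow> j < m \<Longrightarrow> poly_fun m (\<lambda>M. M $$ (i, j))"
| add: "poly_fun m g \<Longrightarrow> poly_fun m h \<Longrightarrow> poly_fun m (\<lambda>M. g M + h M)"
| mult: "poly_fun m g \<Longrightarrow> poly_fun m h \<Longrightarrow> poly_fun m (\<lambda>M. g M * h M)"

definition zariski_closed :: "nat \<Rightarrow> complex mat set \<Rightarrow> bool" where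
  "zariski_closed m Z \<longleftrightarrow>
     (\<exists>S. (\<forall>g\<in>S. poly_fun m g) \<and> Z = {M \<in> carrier_mat m m. \<forall>g\<in>S. g M = 0})"

definition block_transpose :: "nat \<Rightarrow> complex mat \<Rightarrow> complex mat" where
  "block_transpose n M = (case split_block M n n of (A, B, C, D) \<Rightarrow> four_block_mat A C B D)"

text \<open>Meaningful only for invertible \<open>L\<close>; otherwise \<open>mat_inverse L = None\<close>.\<close>
definition f_map :: "nat \<Rightarrow> complex mat \<Rightarrow> complex mat" where
  "f_map n L = block_transpose n (the (mat_inverse L))"

datatype cp1 = Aff complex | Inf_pt

type_synonym cp1_sq = "cp1 \<times> cp1"

fun hom :: "cp1 \<Rightarrow> complex \<times> complex" where
  "hom (Aff z) = (z, 1)"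
| "hom Inf_pt = (1, 0)"

definition of_hom :: "complex \<times> complex \<Rightarrow> cp1" where
  "of_hom U = (if snd U = 0 then Inf_pt else Aff (fst U / snd U))"

text \<open>Homogeneous coordinates of the point with coordinate \<open>w\<close> in an affine chart centred at the
  given point: \<open>z = c + w\<close> around a finite point \<open>c\<close>, and \<open>z = 1 / w\<close> around infinity.\<close>
fun chart_hom :: "cp1 \<Rightarrow> complex \<Rightarrow> complex \<times> complex" where
  "chart_hom (Aff c) w = (c + w, 1)"
| "chart_hom Inf_pt w = (1, w)"

definition chart :: "cp1 \<Rightarrow> complex \<Rightarrow> cp1" where
  "chart p w = of_hom (chart_hom p w)"

text \<open>The affine coordinate; its value at infinity, where it has a pole, is irrelevant.\<close>
fun aff :: "cp1 \<Rightarrow> complex" where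
  "aff (Aff z) = z"
| "aff Inf_pt = 0"

fun neg_inv :: "cp1 \<Rightarrow> cp1" where
  "neg_inv (Aff z) = (if z = 0 then Inf_pt else Aff (- inverse z))"
| "neg_inv Inf_pt = Aff 0"

definition neg_inv2 :: "cp1_sq \<Rightarrow> cp1_sq" where
  "neg_inv2 = map_prod neg_inv neg_inv"

definition vacuum_poly :: "nat \<Rightarrow> complex mat \<Rightarrow> complex \<Rightarrow> complex \<Rightarrow> complex" where
  "vacuum_poly n L u v = (case split_block L n n of (A, B, C, D) \<Rightarrow>
     det (u \<cdot>\<^sub>m A + B - (u * v) \<cdot>\<^sub>m C - v \<cdot>\<^sub>m D))"

text \<open>The bihomogenization, of bidegree \<open>(n, n)\<close>, of \<open>vacuum_poly\<close>.\<close>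
definition vacuum_form ::
  "nat \<Rightarrow> complex mat \<Rightarrow> complex \<times> complex \<Rightarrow> complex \<times> complex \<Rightarrow> complex" where
  "vacuum_form n L = (\<lambda>(u0, u1) (v0, v1). case split_block L n n of (A, B, C, D) \<Rightarrow>
     det ((u0 * v1) \<cdot>\<^sub>m A + (u1 * v1) \<cdot>\<^sub>m B - (u0 * v0) \<cdot>\<^sub>m C - (u1 * v0) \<cdot>\<^sub>m D))"

definition vacuum_curve :: "nat \<Rightarrow> complex mat \<Rightarrow> cp1_sq set" where
  "vacuum_curve n L = {p. vacuum_form n L (hom (fst p)) (hom (snd p)) = 0}"

definition smooth_vacuum_curve :: "nat \<Rightarrow> complex mat \<Rightarrow> bool" where
  "smooth_vacuum_curve n L \<longleftrightarrow> (\<forall>p \<in> vacuum_curve n L.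
     deriv (\<lambda>s. vacuum_form n L (chart_hom (fst p) s) (hom (snd p))) 0 \<noteq> 0 \<or>
     deriv (\<lambda>t. vacuum_form n L (hom (fst p)) (chart_hom (snd p) t)) 0 \<noteq> 0)"

definition tensor2 :: "complex \<times> complex \<Rightarrow> complex vec \<Rightarrow> complex vec" where
  "tensor2 U X = (fst U \<cdot>\<^sub>v X) @\<^sub>v (snd U \<cdot>\<^sub>v X)"

definition vacuum_pair :: "nat \<Rightarrow> complex mat \<Rightarrow> cp1_sq \<Rightarrow> complex vec \<Rightarrow> complex vec \<Rightarrow> bool" where
  "vacuum_pair n L p X Y \<longleftrightarrow>
     X \<in> carrier_vec n \<and> Y \<in> carrier_vec n \<and> X \<noteq> 0\<^sub>v n \<and> Y \<noteq> 0\<^sub>v n \<and>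
     L *\<^sub>v tensor2 (hom (fst p)) X = tensor2 (hom (snd p)) Y"

definition is_vacuum :: "nat \<Rightarrow> complex mat \<Rightarrow> cp1_sq \<Rightarrow> complex vec \<Rightarrow> bool" where
  "is_vacuum n L p X \<longleftrightarrow> (\<exists>Y. vacuum_pair n L p X Y)"

definition is_covacuum :: "nat \<Rightarrow> complex mat \<Rightarrow> cp1_sq \<Rightarrow> complex vec \<Rightarrow> bool" where
  "is_covacuum n L p Y \<longleftrightarrow> (\<exists>X. vacuum_pair n L p X Y)"

text \<open>The vectors normalized by last coordinate \<open>1\<close>. They are separately normalized, so the two of
  them form a vacuum pair only up to a scalar factor. At a point where the last coordinate of the
  unnormalized vector vanishes (a pole of the normalized one) the value is irrelevant.\<close>
definition vacuum_vec :: "nat \<Rightarrow> complex mat \<Rightarrow> cp1_sq \<Rightarrow> complex vec" where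
  "vacuum_vec n L p = (THE X. is_vacuum n L p X \<and> X $ (n - 1) = 1)"

definition covacuum_vec :: "nat \<Rightarrow> complex mat \<Rightarrow> cp1_sq \<Rightarrow> complex vec" where
  "covacuum_vec n L p = (THE Y. is_covacuum n L p Y \<and> Y $ (n - 1) = 1)"

text \<open>A holomorphic immersion \<open>\<phi>\<close> of a neighbourhood of \<open>0\<close> into the curve with \<open>\<phi> 0 = p\<close>. If the
  curve is smooth at \<open>p\<close>, this is the inverse of a local holomorphic coordinate centred at \<open>p\<close>.\<close>
definition local_param :: "cp1_sq set \<Rightarrow> cp1_sq \<Rightarrow> (complex \<Rightarrow> cp1_sq) \<Rightarrow> bool" where
  "local_param \<Gamma> p \<phi> \<longleftrightarrow> (\<exists>a b. a analytic_on {0} \<and> b analytic_on {0} \<and> a 0 = 0 \<and> b 0 = 0 \<and>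
     (deriv a 0 \<noteq> 0 \<or> deriv b 0 \<noteq> 0) \<and>
     \<phi> = (\<lambda>t. (chart (fst p) (a t), chart (snd p) (b t))) \<and>
     (\<forall>\<^sub>F t in nhds 0. \<phi> t \<in> \<Gamma>))"

text \<open>On a smooth curve, orders of zeros and poles do not depend on this choice.\<close>
definition loc :: "cp1_sq set \<Rightarrow> cp1_sq \<Rightarrow> complex \<Rightarrow> cp1_sq" where
  "loc \<Gamma> p = (SOME \<phi>. local_param \<Gamma> p \<phi>)"

text \<open>As for \<open>meromorphic_on\<close>, functions are total, and their values at poles are irrelevant.\<close>
definition curve_meromorphic :: "cp1_sq set \<Rightarrow> (cp1_sq \<Rightarrow> complex) \<Rightarrow> bool" where
  "curve_meromorphic \<Gamma> g \<longleftrightarrow> (\<forall>p\<in>\<Gamma>. \<forall>\<phi>. local_param \<Gamma> p \<phi> \<longrightarrow> (g \<circ> \<phi>) meromorphic_on {0})"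

definition curve_meromorphic_vec :: "nat \<Rightarrow> cp1_sq set \<Rightarrow> (cp1_sq \<Rightarrow> complex vec) \<Rightarrow> bool" where
  "curve_meromorphic_vec n \<Gamma> X \<longleftrightarrow> (\<forall>i<n. curve_meromorphic \<Gamma> (\<lambda>p. X p $ i))"

definition pole_div :: "cp1_sq set \<Rightarrow> (cp1_sq \<Rightarrow> complex) \<Rightarrow> cp1_sq \<Rightarrow> int" where
  "pole_div \<Gamma> g p = (if is_pole (g \<circ> loc \<Gamma> p) 0 then - zorder (g \<circ> loc \<Gamma> p) 0 else 0)"

definition pole_div_vec :: "nat \<Rightarrow> cp1_sq set \<Rightarrow> (cp1_sq \<Rightarrow> complex vec) \<Rightarrow> cp1_sq \<Rightarrow> int" where
  "pole_div_vec n \<Gamma> X p = Max ((\<lambda>i. pole_div \<Gamma> (\<lambda>q. X q $ i) p) ` {..<n})"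

text \<open>Only the values of a divisor on the curve matter.\<close>
definition divisor :: "cp1_sq set \<Rightarrow> (cp1_sq \<Rightarrow> int) \<Rightarrow> bool" where
  "divisor \<Gamma> D \<longleftrightarrow> finite {p\<in>\<Gamma>. D p \<noteq> 0}"

text \<open>\<open>D - E\<close> is the divisor of a meromorphic function that vanishes identically near no point of
  the curve.\<close>
definition lin_equiv :: "cp1_sq set \<Rightarrow> (cp1_sq \<Rightarrow> int) \<Rightarrow> (cp1_sq \<Rightarrow> int) \<Rightarrow> bool" where
  "lin_equiv \<Gamma> D E \<longleftrightarrow> divisor \<Gamma> D \<and> divisor \<Gamma> E \<and>
     (\<exists>h. curve_meromorphic \<Gamma> h \<and>
        (\<forall>p\<in>\<Gamma>. (\<forall>\<^sub>F t in at 0. h (loc \<Gamma> p t) \<noteq> 0) \<and>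
               D p - E p = zorder (h \<circ> loc \<Gamma> p) 0))"

definition unique_vacuum_pairs :: "nat \<Rightarrow> complex mat \<Rightarrow> bool" where
  "unique_vacuum_pairs n L \<longleftrightarrow> (\<forall>p \<in> vacuum_curve n L. \<exists>X Y. vacuum_pair n L p X Y \<and>
     (\<forall>X' Y'. vacuum_pair n L p X' Y' \<longrightarrow> (\<exists>c. X' = c \<cdot>\<^sub>v X) \<and> (\<exists>c. Y' = c \<cdot>\<^sub>v Y)))"

text \<open>The facts under which the normalized vectors are meromorphic on the curve and their divisors
  make sense.\<close>
definition well_posed :: "nat \<Rightarrow> complex mat \<Rightarrow> bool" where
  "well_posed n L \<longleftrightarrow>
     smooth_vacuum_curve n L \<and> unique_vacuum_pairs n L \<and>
     finite {p \<in> vacuum_curve n L. \<not> (\<exists>X. is_vacuum n L p X \<and> X $ (n - 1) = 1)} \<and>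
     finite {p \<in> vacuum_curve n L. \<not> (\<exists>Y. is_covacuum n L p Y \<and> Y $ (n - 1) = 1)} \<and>
     curve_meromorphic_vec n (vacuum_curve n L) (vacuum_vec n L) \<and>
     curve_meromorphic_vec n (vacuum_curve n L) (covacuum_vec n L)"

end

theory Submission
  imports Defs "HOL-Library.Function_Algebras"
begin

text \<open>Genericity needs no explicit example. Each condition to be avoided (a singular point of the
  curve, corank at least two, a vanishing last coordinate of \<open>X\<close> or \<open>Y\<close> over \<open>u = \<infinity>\<close> or
  \<open>v = \<infinity>\<close>) describes a set of matrices that is parametrised polynomially by fewer parameters than
  there are matrix entries. Counting monomials shows that the entries are algebraically dependent on
  such a set, so that it lies in a proper Zariski closed set.

  For the remaining \<open>L\<close> the matrix \<open>u A + B - u v C - v D\<close> has corank one on the curve, and \<open>X\<close> and \<open>Y\<close>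
  are analytic along a local parameter, since they are given by a column of its adjugate. The identity
  between complementary minors of \<open>L\<close> and of its inverse, in the form
  \<open>L (U \<otimes> X) = V \<otimes> Y \<longleftrightarrow> L\<^sup>-\<^sup>1 (V \<otimes> Y) = U \<otimes> X\<close>, relates the curves of \<open>L\<close> and \<open>f L\<close> and
  exchanges vacuum and covacuum vectors.

  For the normalised vectors, \<open>L (U \<otimes> X) = \<lambda> (V \<otimes> Y)\<close> with a meromorphic function \<open>\<lambda>\<close>. If \<open>xn\<close>, \<open>yn\<close>,
  \<open>u1\<close>, \<open>v1\<close> are the denominators of \<open>X\<close>, \<open>Y\<close>, \<open>u\<close>, \<open>v\<close> along a local parameter, then
  \<open>\<lambda> = v1 yn / (u1 xn)\<close>, whose divisor is \<open>D\<^sub>Y + D\<^sub>V - D\<^sub>X - D\<^sub>U\<close>.\<close>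

text \<open>Read as a tensor with indices in C^2, C^n, C^2, C^n, \<open>L\<close> is a quadrilinear
  form, and a singular point of the curve at which the kernel is a line yields a singular point of
  the hypersurface of this form in P^1 x P^(n-1) x P^1 x P^(n-1). Such a point has 2 n parameters
  and satisfies 2 n + 1 equations linear in \<open>L\<close>; the other exclusions parametrised in
  this way also have more equations than parameters.

  The obstacle behind the conditions over infinity is that the last coordinate of \<open>X\<close>
  or \<open>Y\<close> might vanish along a whole component of the curve, where the normalised vector
  would not exist. Excluding such zeros over u = infinity and v = infinity suffices: the others form
  a compact subset of the affine curve, and infinitely many of them would contain an analytic disc
  through a point of maximal norm, against the maximum principle.

  Invertibility of \<open>f L\<close> is a condition of its own, since block transposition need not
  preserve invertibility. The conditions are imposed on \<open>L\<close> only; smoothness,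
  meromorphy and pole orders for \<open>f L\<close> are carried over from \<open>L\<close>.\<close>

no_notation fps_nth (infixl \<open>$\<close> 75)

section \<open>Polynomial functions and algebraic dependence\<close>

text \<open>By the Leibniz expansion a determinant is a sum of products of entries. The class
  \<open>Q\<close> is left open because the same argument serves polynomial functions, polynomials
  in one variable and differentiable functions.\<close>

lemma det_closed:
  fixes M :: "'a \<Rightarrow> complex mat"
  assumes const: "\<And>c. Q (\<lambda>_. c)"
    and add: "\<And>f g. Q f \<Longrightarrow> Q g \<Longrightarrow> Q (\<lambda>x. f x + g x)"
    and mult: "\<And>f g. Q f \<Longrightarrow> Q g \<Longrightarrow> Q (\<lambda>x. f x * g x)"
    and entry: "\<And>i j. i < k \<Longrightarrow> j < k \<Longrightarrow> Q (\<lambda>x. M x $$ (i, j))"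
    and carrier: "\<And>x. M x \<in> carrier_mat k k"
  shows "Q (\<lambda>x. det (M x))"
proof -
  have sum: "Q (\<lambda>x. \<Sum>a\<in>S. f a x)" if "finite S" "\<And>a. a \<in> S \<Longrightarrow> Q (f a)"
    for S :: "(nat \<Rightarrow> nat) set" and f
    using that by (induction S rule: finite_induct) (auto intro: const add)
  have prod: "Q (\<lambda>x. \<Prod>a\<in>S. f a x)" if "finite S" "\<And>a. a \<in> S \<Longrightarrow> Q (f a)"
    for S :: "nat set" and f
    using that by (induction S rule: finite_induct) (auto intro: const mult)
  have "Q (\<lambda>x. \<Sum>p\<in>{p. p permutes {0..<k}}. signof p * (\<Prod>i = 0..<k. M x $$ (i, p i)))"
  proof (rule sum, goal_cases)
    case (2 p)
    then have "p permutes {0..<k}" by simp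
    then show ?case
      using permutes_in_image[of p "{0..<k}"] by (intro mult const prod entry) simp_all
  qed (simp add: finite_permutations)
  moreover have "(\<lambda>x. det (M x)) =
      (\<lambda>x. \<Sum>p\<in>{p. p permutes {0..<k}}. signof p * (\<Prod>i = 0..<k. M x $$ (i, p i)))"
    using det_def'[OF carrier] by fastforce
  ultimately show ?thesis by simp
qed

text \<open>The generators are arbitrary functions, so that one notion covers polynomials in stored
  parameters, in two chart coordinates (\<open>poly2\<close>) and in four homogeneous coordinates
  (\<open>poly4\<close>).\<close>

inductive poly_in :: "('a \<Rightarrow> complex) set \<Rightarrow> ('a \<Rightarrow> complex) \<Rightarrow> bool" for B where
  const: "poly_in B (\<lambda>_. c)"
| base: "b \<in> B \<Longrightarrow> poly_in B b"
| add: "poly_in B f \<Longrightarrow> poly_in B g \<Longrightarrow> poly_in B (\<lambda>x. f x + g x)"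
| mult: "poly_in B f \<Longrightarrow> poly_in B g \<Longrightarrow> poly_in B (\<lambda>x. f x * g x)"

lemma poly_in_uminus: "poly_in B f \<Longrightarrow> poly_in B (\<lambda>x. - f x)"
  using poly_in.mult[OF poly_in.const[of B "-1"], of f] by simp

lemma poly_in_diff: "poly_in B f \<Longrightarrow> poly_in B g \<Longrightarrow> poly_in B (\<lambda>x. f x - g x)"
  using poly_in.add[OF _ poly_in_uminus, of B f g] by simp

lemma poly_in_sum:
  "(\<And>a. a \<in> S \<Longrightarrow> poly_in B (f a)) \<Longrightarrow> poly_in B (\<lambda>x. \<Sum>a\<in>S. f a x)"
  by (induction S rule: infinite_finite_induct) (auto intro: poly_in.const poly_in.add)

lemma poly_in_prod:
  "(\<And>a. a \<in> S \<Longrightarrow> poly_in B (f a)) \<Longrightarrow> poly_in B (\<lambda>x. \<Prod>a\<in>S. f a x)"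
  by (induction S rule: infinite_finite_induct) (auto intro: poly_in.const poly_in.mult)

lemma poly_in_power: "poly_in B f \<Longrightarrow> poly_in B (\<lambda>x. f x ^ d)"
  by (induction d) (auto intro: poly_in.const poly_in.mult)

lemma poly_in_mono: "poly_in B f \<Longrightarrow> B \<subseteq> B' \<Longrightarrow> poly_in B' f"
  by (induction rule: poly_in.induct) (auto intro: poly_in.intros)

lemma poly_in_subst:
  assumes "poly_in B g" "\<And>b. b \<in> B \<Longrightarrow> poly_in B' (\<lambda>x. b (\<Phi> x))"
  shows "poly_in B' (\<lambda>x. g (\<Phi> x))"
  using assms by (induction rule: poly_in.induct) (auto intro: poly_in.intros)

lemma poly_in_det:
  assumes "\<And>i j. i < k \<Longrightarrow> j < k \<Longrightarrow> poly_in B (\<lambda>x. M x $$ (i, j))"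
    and "\<And>x. M x \<in> carrier_mat k k"
  shows "poly_in B (\<lambda>x. det (M x))"
  using assms by (intro det_closed[where Q = "poly_in B" and k = k]) (auto intro: poly_in.intros)

definition vars :: "'i set \<Rightarrow> (('i \<Rightarrow> complex) \<Rightarrow> complex) set" where
  "vars J = (\<lambda>j x. x j) ` J"

lemma poly_in_var: "j \<in> J \<Longrightarrow> poly_in (vars J) (\<lambda>x. x j)"
  by (rule poly_in.base) (auto simp: vars_def)

lemma poly_in_vars_cong:
  assumes "poly_in (vars J) g" "\<And>j. j \<in> J \<Longrightarrow> x j = y j"
  shows "g x = g y"
  using assms by (induction rule: poly_in.induct) (auto simp: vars_def)

text \<open>Spans and linear dependence of functions, in which the monomials are counted.\<close>

interpretation fun_vs: vector_space "\<lambda>(c::complex) (f::'a \<Rightarrow> complex) x. c * f x"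
  by unfold_locales (auto simp: fun_eq_iff algebra_simps)

definition mono_fun :: "'i set \<Rightarrow> ('i \<Rightarrow> nat) \<Rightarrow> ('i \<Rightarrow> complex) \<Rightarrow> complex" where
  "mono_fun J m x = (\<Prod>j\<in>J. x j ^ m j)"

text \<open>The degree is bounded in each variable separately, which makes the number of monomials
  an exact power. Extensionality outside \<open>J\<close> keeps this set finite.\<close>

definition exps :: "'i set \<Rightarrow> nat \<Rightarrow> ('i \<Rightarrow> nat) set" where
  "exps J d = PiE J (\<lambda>_. {..d})"

abbreviation polys_le :: "'i set \<Rightarrow> nat \<Rightarrow> (('i \<Rightarrow> complex) \<Rightarrow> complex) set" where
  "polys_le J d \<equiv> fun_vs.span (mono_fun J ` exps J d)"

lemma finite_exps: "finite J \<Longrightarrow> finite (exps J d)"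
  by (auto simp: exps_def intro: finite_PiE)

lemma card_exps: "finite J \<Longrightarrow> card (exps J d) = (d + 1) ^ card J"
  by (simp add: exps_def card_PiE)

lemma mono_fun_restrict: "mono_fun J m = mono_fun J (restrict m J)"
  by (simp add: mono_fun_def fun_eq_iff)

lemma mono_fun_in: "(\<And>j. j \<in> J \<Longrightarrow> m j \<le> d) \<Longrightarrow> mono_fun J m \<in> polys_le J d"
  by (subst mono_fun_restrict, intro fun_vs.span_base imageI) (auto simp: exps_def)

lemma polys_le_mono: "d \<le> d' \<Longrightarrow> polys_le J d \<subseteq> polys_le J d'"
  by (intro fun_vs.span_mono image_mono) (auto simp: exps_def PiE_def Pi_def)

lemma polys_le_mult:
  assumes f: "f \<in> polys_le J d" and g: "g \<in> polys_le J d'"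
  shows "(\<lambda>x. f x * g x) \<in> polys_le J (d + d')"
proof -
  have mon: "(\<lambda>x. mono_fun J m x * g x) \<in> polys_le J (d + d')" if "m \<in> exps J d" for m
    using g
  proof (induction rule: fun_vs.span_induct_alt)
    case base
    then show ?case using fun_vs.span_zero by (simp add: zero_fun_def)
  next
    case (step c b g)
    from step(1) obtain m' where m': "m' \<in> exps J d'" "b = mono_fun J m'" by auto
    have "(\<lambda>x. mono_fun J m x * b x) = mono_fun J (\<lambda>j. m j + m' j)"
      by (auto simp: m' mono_fun_def fun_eq_iff power_add prod.distrib)
    also have "\<dots> \<in> polys_le J (d + d')"
      using that m' by (intro mono_fun_in) (auto simp: exps_def PiE_def Pi_def add_mono)
    finally have "(\<lambda>x. c * (mono_fun J m x * b x)) + (\<lambda>x. mono_fun J m x * g x) \<in> polys_le J (d + d')"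
      using step(2) by (intro fun_vs.span_add) (rule fun_vs.span_scale)
    moreover have "(\<lambda>x. mono_fun J m x * ((\<lambda>x. c * b x) + g) x)
        = (\<lambda>x. c * (mono_fun J m x * b x)) + (\<lambda>x. mono_fun J m x * g x)"
      by (auto simp: fun_eq_iff algebra_simps)
    ultimately show ?case by metis
  qed
  show ?thesis
    using f
  proof (induction rule: fun_vs.span_induct_alt)
    case base
    then show ?case using fun_vs.span_zero by (simp add: zero_fun_def)
  next
    case (step c b f)
    from step(1) obtain m' where m': "m' \<in> exps J d" "b = mono_fun J m'" by auto
    have "(\<lambda>x. c * (b x * g x)) + (\<lambda>x. f x * g x) \<in> polys_le J (d + d')"
      using step(2) mon[OF m'(1)] unfolding m'(2)
      by (intro fun_vs.span_add) (rule fun_vs.span_scale)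
    moreover have "(\<lambda>x. ((\<lambda>x. c * b x) + f) x * g x)
        = (\<lambda>x. c * (b x * g x)) + (\<lambda>x. f x * g x)"
      by (auto simp: fun_eq_iff algebra_simps)
    ultimately show ?case by metis
  qed
qed

lemma polys_le_const: "(\<lambda>_. c) \<in> polys_le J d"
proof -
  have "(\<lambda>x. c * mono_fun J (\<lambda>_. 0) x) \<in> polys_le J d"
    by (intro fun_vs.span_scale mono_fun_in) auto
  then show ?thesis by (simp add: mono_fun_def)
qed

lemma polys_le_prod:
  assumes "finite S" "\<And>a. a \<in> S \<Longrightarrow> f a \<in> polys_le J d"
  shows "(\<lambda>x. \<Prod>a\<in>S. f a x) \<in> polys_le J (card S * d)"
  using assms
proof (induction S rule: finite_induct)
  case empty
  then show ?case using polys_le_const[of 1 J 0] by simp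
next
  case (insert a S)
  then show ?case using polys_le_mult[of "f a" J d "\<lambda>x. \<Prod>a\<in>S. f a x" "card S * d"] by simp
qed

lemma polys_le_power:
  assumes "f \<in> polys_le J d"
  shows "(\<lambda>x. f x ^ k) \<in> polys_le J (k * d)"
  using polys_le_prod[of "{..<k}" "\<lambda>_. f"] assms by simp

lemma poly_in_polys_le:
  assumes "finite J" "poly_in (vars J) f"
  shows "\<exists>d. f \<in> polys_le J d"
  using assms(2)
proof (induction rule: poly_in.induct)
  case (const c)
  then show ?case using polys_le_const by blast
next
  case (base b)
  then obtain j where j: "j \<in> J" "b = (\<lambda>x. x j)" by (auto simp: vars_def)
  have "b = mono_fun J (\<lambda>i. if i = j then 1 else 0)"
    using j assms(1) by (auto simp: mono_fun_def fun_eq_iff if_distrib cong: if_cong)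
  also have "\<dots> \<in> polys_le J 1" by (intro mono_fun_in) auto
  finally show ?case by blast
next
  case (add f g)
  then obtain d d' where "f \<in> polys_le J d" "g \<in> polys_le J d'" by blast
  then have "f + g \<in> polys_le J (max d d')"
    using polys_le_mono[of d "max d d'" J] polys_le_mono[of d' "max d d'" J]
    by (intro fun_vs.span_add) auto
  then show ?case by (auto simp: plus_fun_def)
next
  case (mult f g)
  then show ?case using polys_le_mult by blast
qed

text \<open>A family instead of a set is required because different monomials may become equal after
  a substitution. In that case the coefficients 1 and -1 at two such indices already form a
  relation; otherwise the dimension bound for the image set applies.\<close>

lemma (in vector_space) dependent_family:
  assumes "finite E" "finite B" "F ` E \<subseteq> span B" "card B < card E"
  obtains c where "\<exists>e\<in>E. c e \<noteq> 0" "(\<Sum>e\<in>E. scale (c e) (F e)) = 0"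
proof (cases "inj_on F E")
  case True
  then have "dependent (F ` E)"
    using independent_span_bound[OF assms(2) _ assms(3)] assms(4) card_image[OF True] by auto
  then obtain u where u: "\<exists>v\<in>F ` E. u v \<noteq> 0" "(\<Sum>v\<in>F ` E. scale (u v) v) = 0"
    using dependent_finite[of "F ` E"] assms(1) by auto
  show ?thesis
    by (rule that[of "\<lambda>e. u (F e)"]) (use u True in \<open>auto simp: sum.reindex\<close>)
next
  case False
  then obtain e1 e2 where e: "e1 \<in> E" "e2 \<in> E" "e1 \<noteq> e2" "F e1 = F e2"
    by (auto simp: inj_on_def)
  let ?c = "\<lambda>e. if e = e1 then 1 :: 'a else if e = e2 then - 1 else 0"
  have "(\<Sum>e\<in>E. scale (?c e) (F e)) = (\<Sum>e\<in>{e1, e2}. scale (?c e) (F e))"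
    by (rule sum.mono_neutral_right) (use assms(1) e in auto)
  also have "\<dots> = 0" using e by simp
  finally have "(\<Sum>e\<in>E. scale (?c e) (F e)) = 0" .
  moreover have "\<exists>e\<in>E. ?c e \<noteq> 0" using e(1) by (intro bexI[of _ e1]) auto
  ultimately show ?thesis using that[of ?c] by blast
qed

text \<open>Sorting by powers of the new variable gives a polynomial in one variable whose
  coefficients are combinations in the old variables. By induction some coefficient is non-zero at a
  suitable \<open>x\<close>, and then the new variable can avoid the finitely many roots.\<close>

lemma mono_fun_independent:
  assumes "finite I" "\<exists>e\<in>exps I d. c e \<noteq> 0"
  shows "\<exists>x. (\<Sum>e\<in>exps I d. c e * mono_fun I e x) \<noteq> 0"
  using assms
proof (induction I arbitrary: c rule: finite_induct)
  case empty
  then show ?case by (auto simp: exps_def mono_fun_def)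
next
  case (insert i I)
  have bij: "bij_betw (\<lambda>(k, e). e(i := k)) ({..d} \<times> exps I d) (exps (insert i I) d)"
    unfolding exps_def PiE_insert_eq bij_betw_def
    using inj_combinator[OF insert(2), of "\<lambda>_. {..d}"] by auto
  from insert.prems obtain e where e: "e \<in> exps (insert i I) d" "c e \<noteq> 0" by blast
  from e(1) obtain k0 e0 where e0: "k0 \<le> d" "e0 \<in> exps I d" "c (e0(i := k0)) \<noteq> 0"
    using e(2) unfolding bij_betw_imp_surj_on[OF bij, symmetric] by auto
  obtain x where x: "(\<Sum>e\<in>exps I d. c (e(i := k0)) * mono_fun I e x) \<noteq> 0"
    using insert.IH[of "\<lambda>e. c (e(i := k0))"] e0 by blast
  define a where "a k = (\<Sum>e\<in>exps I d. c (e(i := k)) * mono_fun I e x)" for k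
  have "\<exists>t. (\<Sum>k\<le>d. a k * t ^ k) \<noteq> 0"
    using polyfun_eq_0[of a d] x e0(1) by (auto simp: a_def)
  then obtain t where t: "(\<Sum>k\<le>d. a k * t ^ k) \<noteq> 0" by blast
  have *: "mono_fun (insert i I) (e(i := k)) (x(i := t)) = mono_fun I e x * t ^ k" for e k
  proof -
    have "(\<Prod>j\<in>I. (x(i := t)) j ^ (e(i := k)) j) = (\<Prod>j\<in>I. x j ^ e j)"
      by (rule prod.cong) (use insert(2) in auto)
    then show ?thesis
      unfolding mono_fun_def using insert(1,2) by (subst prod.insert) (auto simp: mult.commute)
  qed
  have "(\<Sum>e\<in>exps (insert i I) d. c e * mono_fun (insert i I) e (x(i := t)))
      = (\<Sum>(k, e)\<in>{..d} \<times> exps I d. c (e(i := k)) * (mono_fun I e x * t ^ k))"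
    by (subst sum.reindex_bij_betw[OF bij, symmetric]) (auto simp: * intro!: sum.cong)
  also have "\<dots> = (\<Sum>k\<le>d. a k * t ^ k)"
    by (subst sum.cartesian_product[symmetric])
       (simp add: a_def sum_distrib_left sum_distrib_right mult.assoc)
  finally show ?case using t by metis
qed

text \<open>A map given by polynomials of degree at most \<open>k\<close> sends the \<open>(d + 1) ^ card I\<close> monomials of
  degree at most \<open>d\<close> in each of the variables \<open>I\<close> into a space of dimension
  \<open>(card I * d * k + 1) ^ card J\<close>, which is smaller when \<open>d\<close> is large.\<close>
lemma algebraic_dependence:
  assumes I: "finite I" and J: "finite J" "card J < card I"
    and \<Phi>: "\<And>i. i \<in> I \<Longrightarrow> poly_in (vars J) (\<Phi> i)"
  obtains g where "poly_in (vars I) g" "\<exists>x. g x \<noteq> 0" "\<And>x. g (\<lambda>i. \<Phi> i x) = 0"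
proof -
  obtain D where D: "\<And>i. i \<in> I \<Longrightarrow> \<Phi> i \<in> polys_le J (D i)"
    using poly_in_polys_le[OF J(1) \<Phi>] by metis
  define k where "k = Max (D ` I)"
  have k: "\<Phi> i \<in> polys_le J k" if "i \<in> I" for i
    using D[OF that] polys_le_mono[of "D i" k J] that I by (auto simp: k_def)
  \<comment> \<open>With this \<open>d\<close> the bound
    \<open>((card I * k + 1) * (d + 1)) ^ card J\<close> equals \<open>d * (d + 1) ^ card J\<close>,
    which is just below \<open>(d + 1) ^ (card J + 1)\<close>.\<close>
  define d where "d = (card I * k + 1) ^ card J"
  define F where "F e = (\<lambda>x. mono_fun I e (\<lambda>i. \<Phi> i x))" for e
  have F: "F e \<in> polys_le J (card I * (d * k))" if "e \<in> exps I d" for e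
    unfolding F_def mono_fun_def[of I]
  proof (rule polys_le_prod[OF I])
    fix i assume i: "i \<in> I"
    have "e i * k \<le> d * k" using that i by (auto simp: exps_def PiE_def Pi_def)
    then show "(\<lambda>x. \<Phi> i x ^ e i) \<in> polys_le J (d * k)"
      using polys_le_power[OF k[OF i], of "e i"] by (rule subsetD[OF polys_le_mono])
  qed
  have "card (mono_fun J ` exps J (card I * (d * k))) \<le> (card I * (d * k) + 1) ^ card J"
    using card_image_le[OF finite_exps[OF J(1)]] card_exps[OF J(1)] by metis
  also have "\<dots> \<le> ((card I * k + 1) * (d + 1)) ^ card J"
    by (intro power_mono) (auto simp: algebra_simps)
  also have "\<dots> = d * (d + 1) ^ card J" by (simp only: power_mult_distrib d_def)
  also have "\<dots> < (d + 1) ^ (card J + 1)" by simp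
  also have "\<dots> \<le> (d + 1) ^ card I" using J(2) by (intro power_increasing) auto
  finally have cd: "card (mono_fun J ` exps J (card I * (d * k))) < card (exps I d)"
    using card_exps[OF I] by simp
  have sub: "F ` exps I d \<subseteq> polys_le J (card I * (d * k))"
    using F by (rule image_subsetI)
  obtain c where c: "\<exists>e\<in>exps I d. c e \<noteq> 0" "(\<Sum>e\<in>exps I d. (\<lambda>x. c e * F e x)) = 0"
    by (rule fun_vs.dependent_family[OF finite_exps[OF I] finite_imageI[OF finite_exps[OF J(1)]] sub cd])
  have sum_app: "(\<Sum>e\<in>S. f e) x = (\<Sum>e\<in>S. f e x)" for S and f :: "_ \<Rightarrow> _ \<Rightarrow> complex" and x
    by (induction S rule: infinite_finite_induct) auto
  show ?thesis
  proof (rule that[of "\<lambda>x. \<Sum>e\<in>exps I d. c e * mono_fun I e x"])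
    show "poly_in (vars I) (\<lambda>x. \<Sum>e\<in>exps I d. c e * mono_fun I e x)"
      unfolding mono_fun_def
      by (intro poly_in_sum poly_in.mult poly_in.const poly_in_prod poly_in_power poly_in_var) assumption
    show "\<exists>x. (\<Sum>e\<in>exps I d. c e * mono_fun I e x) \<noteq> 0"
      by (rule mono_fun_independent[OF I c(1)])
    show "(\<Sum>e\<in>exps I d. c e * mono_fun I e (\<lambda>i. \<Phi> i x)) = 0" for x
      using fun_cong[OF c(2), of x] by (simp add: sum_app F_def)
  qed
qed

text \<open>Solving the equations for the unknowns at the positions \<open>P\<close> leaves those positions free to
  store the parameters; since \<open>pv\<close> stores none, one variable fewer than \<open>card I\<close> occurs.\<close>
lemma thin_linear:
  assumes I: "finite I" and P: "P \<subseteq> I" and pv: "pv \<in> P"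
    and poly: "\<And>p q. p \<in> P \<Longrightarrow> q \<in> I \<Longrightarrow> poly_in (vars (P - {pv})) (c p q)"
    and diag: "\<And>p x. p \<in> P \<Longrightarrow> c p p x = 1"
    and zero: "\<And>p q x. p \<in> P - {pv} \<Longrightarrow> q \<in> P - {p} \<Longrightarrow> c p q x = 0"
  obtains g where "poly_in (vars I) g" "\<exists>l. g l \<noteq> 0"
    "\<And>l x. (\<And>p. p \<in> P \<Longrightarrow> (\<Sum>q\<in>I. c p q x * l q) = 0) \<Longrightarrow> g l = 0"
proof -
  let ?J = "I - {pv}"
  \<comment> \<open>For \<open>p\<close> in \<open>P - {pv}\<close> the equation contains no other
    unknown from \<open>P\<close>, so it gives the entry directly from the entries outside
    \<open>P\<close>, which are stored in their own places.\<close>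
  define \<Psi> where "\<Psi> p = (if p \<in> P then (\<lambda>x. - (\<Sum>q\<in>I - P. c p q x * x q)) else (\<lambda>x. x p))" for p
  \<comment> \<open>The equation at \<open>pv\<close> may contain all the other unknowns; they are
    eliminated by substituting \<open>\<Psi>\<close>.\<close>
  define \<Phi> where "\<Phi> p = (if p = pv then (\<lambda>x. - (\<Sum>q\<in>?J. c p q x * \<Psi> q x)) else \<Psi> p)" for p
  have c: "poly_in (vars ?J) (c p q)" if "p \<in> P" "q \<in> I" for p q
    using poly[OF that] P by (rule_tac poly_in_mono) (auto simp: vars_def)
  have \<Psi>: "poly_in (vars ?J) (\<Psi> p)" if "p \<in> ?J" for p
    using that pv unfolding \<Psi>_def
    by (auto intro!: poly_in_uminus poly_in_sum poly_in.mult c poly_in_var)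
  have \<Phi>: "poly_in (vars ?J) (\<Phi> p)" if "p \<in> I" for p
    using that pv unfolding \<Phi>_def
    by (auto intro!: poly_in_uminus poly_in_sum poly_in.mult c \<Psi>)
  have "card ?J < card I" using I P pv by (intro psubset_card_mono) auto
  then obtain g where g: "poly_in (vars I) g" "\<exists>x. g x \<noteq> 0" "\<And>x. g (\<lambda>i. \<Phi> i x) = 0"
    using algebraic_dependence[of I ?J \<Phi>] I \<Phi> finite_Diff by metis
  show ?thesis
  proof (rule that[OF g(1,2)])
    fix l x assume eq: "\<And>p. p \<in> P \<Longrightarrow> (\<Sum>q\<in>I. c p q x * l q) = 0"
    \<comment> \<open>The point of the parameter space lying over \<open>l\<close>: parameters at
      the positions \<open>P\<close>, entries of \<open>l\<close> elsewhere.\<close>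
    define y where "y p = (if p \<in> P then x p else l p)" for p
    have cy: "c p q y = c p q x" if "p \<in> P" "q \<in> I" for p q
      by (rule poly_in_vars_cong[OF poly[OF that]]) (auto simp: y_def)
    have \<Psi>l: "\<Psi> p y = l p" if p: "p \<in> ?J" for p
    proof (cases "p \<in> P")
      case True
      have "0 = c p p x * l p + (\<Sum>q\<in>I - {p}. c p q x * l q)"
        using eq[OF True] sum.remove[of I p "\<lambda>q. c p q x * l q"] I p by auto
      also have "(\<Sum>q\<in>I - {p}. c p q x * l q) = (\<Sum>q\<in>I - P. c p q x * l q)"
        by (rule sum.mono_neutral_right) (use I p True zero in auto)
      also have "\<dots> = (\<Sum>q\<in>I - P. c p q y * y q)"
        by (rule sum.cong) (use cy True in \<open>auto simp: y_def\<close>)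
      finally have "l p = - (\<Sum>q\<in>I - P. c p q y * y q)"
        using diag[OF True] by (simp add: eq_neg_iff_add_eq_0)
      then show ?thesis using True by (simp add: \<Psi>_def)
    qed (use p in \<open>auto simp: \<Psi>_def y_def\<close>)
    have "\<Phi> p y = l p" if p: "p \<in> I" for p
    proof (cases "p = pv")
      case True
      have "0 = c p p x * l p + (\<Sum>q\<in>I - {p}. c p q x * l q)"
        using eq[OF pv] sum.remove[of I p "\<lambda>q. c p q x * l q"] I p True by auto
      also have "(\<Sum>q\<in>I - {p}. c p q x * l q) = (\<Sum>q\<in>?J. c p q y * \<Psi> q y)"
        by (rule sum.cong) (use cy True pv \<Psi>l in auto)
      finally have "l p = - (\<Sum>q\<in>?J. c p q y * \<Psi> q y)"
        using diag[OF pv] True by (simp add: eq_neg_iff_add_eq_0)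
      then show ?thesis using True by (simp add: \<Phi>_def)
    qed (use p \<Psi>l in \<open>auto simp: \<Phi>_def\<close>)
    then have "g l = g (\<lambda>i. \<Phi> i y)" by (intro poly_in_vars_cong[OF g(1)]) auto
    then show "g l = 0" using g(3) by simp
  qed
qed

section \<open>Thin sets of matrices\<close>

lemma poly_fun_sum:
  "(\<And>a. a \<in> S \<Longrightarrow> poly_fun m (f a)) \<Longrightarrow> poly_fun m (\<lambda>x. \<Sum>a\<in>S. f a x)"
  by (induction S rule: infinite_finite_induct) (auto intro: poly_fun.intros)

lemma poly_fun_det:
  assumes "\<And>i j. i < k \<Longrightarrow> j < k \<Longrightarrow> poly_fun m (\<lambda>x. M x $$ (i, j))"
    and "\<And>x. M x \<in> carrier_mat k k"
  shows "poly_fun m (\<lambda>x. det (M x))"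
  using assms by (intro det_closed[where Q = "poly_fun m" and k = k]) (auto intro: poly_fun.intros)

lemma poly_fun_on_line:
  assumes "poly_fun m g" "A \<in> carrier_mat m m" "B \<in> carrier_mat m m"
  shows "\<exists>p. \<forall>t. g (A + t \<cdot>\<^sub>m B) = poly p t"
  using assms
proof (induction rule: poly_fun.induct)
  case (const c)
  then show ?case by (intro exI[of _ "[:c:]"]) auto
next
  case (entry i j)
  then show ?case by (intro exI[of _ "[:A $$ (i, j), B $$ (i, j):]"]) auto
next
  case (add g h)
  then show ?case by (metis poly_add)
next
  case (mult g h)
  then show ?case by (metis poly_mult)
qed

text \<open>Lying in a hypersurface: a single polynomial suffices, and finite unions are handled by
  multiplying the polynomials.\<close>

definition thin :: "nat \<Rightarrow> complex mat set \<Rightarrow> bool" where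
  "thin m S \<longleftrightarrow> (\<exists>g. poly_fun m g \<and> (\<exists>M\<in>carrier_mat m m. g M \<noteq> 0) \<and>
     (\<forall>M\<in>S \<inter> carrier_mat m m. g M = 0))"

lemma thin_subset: "thin m S \<Longrightarrow> S' \<subseteq> S \<Longrightarrow> thin m S'"
  unfolding thin_def by blast

lemma thin_empty: "thin m {}"
  unfolding thin_def by (intro exI[of _ "\<lambda>_. 1"]) (auto intro: poly_fun.const)

lemma thin_zeros: "poly_fun m g \<Longrightarrow> M \<in> carrier_mat m m \<Longrightarrow> g M \<noteq> 0 \<Longrightarrow> thin m {M. g M = 0}"
  unfolding thin_def by blast

text \<open>The point is that the product of two polynomials that are not identically zero is not
  identically zero. On the line joining a non-zero of each, both restrict to non-zero polynomials in
  one variable, with finitely many roots in total.\<close>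

lemma thin_Un:
  assumes "thin m S" "thin m S'"
  shows "thin m (S \<union> S')"
proof -
  obtain g A where g: "poly_fun m g" "A \<in> carrier_mat m m" "g A \<noteq> 0"
    "\<forall>M\<in>S \<inter> carrier_mat m m. g M = 0" using assms(1) unfolding thin_def by blast
  obtain h B where h: "poly_fun m h" "B \<in> carrier_mat m m" "h B \<noteq> 0"
    "\<forall>M\<in>S' \<inter> carrier_mat m m. h M = 0" using assms(2) unfolding thin_def by blast
  have C: "B - A \<in> carrier_mat m m" using g(2) by auto
  obtain p where p: "\<And>t. g (A + t \<cdot>\<^sub>m (B - A)) = poly p t"
    using poly_fun_on_line[OF g(1,2) C] by auto
  obtain q where q: "\<And>t. h (A + t \<cdot>\<^sub>m (B - A)) = poly q t"
    using poly_fun_on_line[OF h(1) g(2) C] by auto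
  have e: "A + 0 \<cdot>\<^sub>m (B - A) = A" "A + 1 \<cdot>\<^sub>m (B - A) = B"
    using g(2) h(2) by (auto intro!: eq_matI)
  have "p \<noteq> 0" "q \<noteq> 0" using p[of 0] q[of 1] e g(3) h(3) by auto
  then have "finite {t. poly (p * q) t = 0}" by (intro poly_roots_finite) auto
  then obtain t where "poly (p * q) t \<noteq> 0"
    using infinite_UNIV_char_0[where 'a = complex] by (metis (mono_tags, lifting) ex_new_if_finite mem_Collect_eq)
  then have "g (A + t \<cdot>\<^sub>m (B - A)) * h (A + t \<cdot>\<^sub>m (B - A)) \<noteq> 0" using p q by auto
  moreover have "A + t \<cdot>\<^sub>m (B - A) \<in> carrier_mat m m" using g(2) C by auto
  ultimately show ?thesis
    unfolding thin_def using g(1,4) h(1,4) by (intro exI[of _ "\<lambda>M. g M * h M"]) (auto intro: poly_fun.mult)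
qed

lemma thin_UN: "finite I \<Longrightarrow> (\<And>i. i \<in> I \<Longrightarrow> thin m (S i)) \<Longrightarrow> thin m (\<Union>i\<in>I. S i)"
  by (induction I rule: finite_induct) (auto intro: thin_empty thin_Un)

text \<open>Rows and columns are split into a block index and an index inside the block, which turns
  \<open>L\<close> into a tensor with four indices.\<close>

definition entry4 :: "nat \<Rightarrow> complex mat \<Rightarrow> nat \<times> nat \<times> nat \<times> nat \<Rightarrow> complex" where
  "entry4 n L = (\<lambda>(\<alpha>, k, \<beta>, l). L $$ (\<alpha> * n + k, \<beta> * n + l))"

definition idx4 :: "nat \<Rightarrow> (nat \<times> nat \<times> nat \<times> nat) set" where
  "idx4 n = {..<2} \<times> {..<n} \<times> {..<2} \<times> {..<n}"

lemma block_index: "\<alpha> < 2 \<Longrightarrow> k < n \<Longrightarrow> \<alpha> * n + k < n + (n::nat)"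
  by (cases \<alpha>) auto

lemma poly_fun_of_poly_in:
  assumes "poly_in (vars (idx4 n)) g"
  shows "poly_fun (n + n) (\<lambda>M. g (entry4 n M))"
  using assms
proof (induction rule: poly_in.induct)
  case (base b)
  then show ?case
    by (auto simp: vars_def idx4_def entry4_def intro!: poly_fun.entry block_index)
qed (auto intro: poly_fun.intros)

lemma thin_linear_mat:
  assumes P: "P \<subseteq> idx4 n" and pv: "pv \<in> P"
    and poly: "\<And>p q. p \<in> P \<Longrightarrow> q \<in> idx4 n \<Longrightarrow> poly_in (vars (P - {pv})) (c p q)"
    and diag: "\<And>p x. p \<in> P \<Longrightarrow> c p p x = 1"
    and zero: "\<And>p q x. p \<in> P - {pv} \<Longrightarrow> q \<in> P - {p} \<Longrightarrow> c p q x = 0"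
  shows "thin (n + n) {L. \<exists>x. \<forall>p\<in>P. (\<Sum>q\<in>idx4 n. c p q x * entry4 n L q) = 0}"
proof -
  have n: "n > 0" using P pv by (auto simp: idx4_def)
  obtain g l where g: "poly_in (vars (idx4 n)) g" "g l \<noteq> 0"
    "\<And>l x. (\<And>p. p \<in> P \<Longrightarrow> (\<Sum>q\<in>idx4 n. c p q x * l q) = 0) \<Longrightarrow> g l = 0"
    
    by (rule thin_linear[of "idx4 n" P pv c]) (use P pv poly diag zero in \<open>auto simp: idx4_def\<close>)
  let ?M = "mat (n + n) (n + n) (\<lambda>(r, s). l (r div n, r mod n, s div n, s mod n))"
  have "g (entry4 n ?M) = g l"
    by (rule poly_in_vars_cong[OF g(1)]) (use n in \<open>auto simp: entry4_def idx4_def block_index\<close>)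
  then have "g (entry4 n ?M) \<noteq> 0" using g(2) by simp
  then show ?thesis
    unfolding thin_def using poly_fun_of_poly_in[OF g(1)] g(3)
    by (intro exI[of _ "\<lambda>M. g (entry4 n M)"] conjI bexI[of _ ?M]) auto
qed

section \<open>The quadrilinear form of a matrix and dimension counts\<close>

definition unit_fun :: "nat \<Rightarrow> nat \<Rightarrow> complex" where
  "unit_fun k = (\<lambda>i. if i = k then 1 else 0)"

definition form4 :: "nat \<Rightarrow> complex mat \<Rightarrow> (nat \<Rightarrow> complex) \<Rightarrow> (nat \<Rightarrow> complex) \<Rightarrow>
    (nat \<Rightarrow> complex) \<Rightarrow> (nat \<Rightarrow> complex) \<Rightarrow> complex" where
  "form4 n L W w U X = (\<Sum>(\<alpha>, k, \<beta>, l)\<in>idx4 n. W \<alpha> * w k * U \<beta> * X l * entry4 n L (\<alpha>, k, \<beta>, l))"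

lemma form4_sum:
  "form4 n L W w U X =
     (\<Sum>\<alpha><2. \<Sum>k<n. \<Sum>\<beta><2. \<Sum>l<n. W \<alpha> * w k * U \<beta> * X l * L $$ (\<alpha> * n + k, \<beta> * n + l))"
  by (simp add: form4_def idx4_def entry4_def sum.cartesian_product split_def)

lemma thin_form4:
  assumes P: "P \<subseteq> idx4 n" and pv: "pv \<in> P"
    and poly: "\<And>p \<alpha>. p \<in> P \<Longrightarrow> \<alpha> < 2 \<Longrightarrow> poly_in (vars (P - {pv})) (\<lambda>x. W x p \<alpha>)"
      "\<And>p k. p \<in> P \<Longrightarrow> k < n \<Longrightarrow> poly_in (vars (P - {pv})) (\<lambda>x. w x p k)"
      "\<And>p \<beta>. p \<in> P \<Longrightarrow> \<beta> < 2 \<Longrightarrow> poly_in (vars (P - {pv})) (\<lambda>x. U x p \<beta>)"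
      "\<And>p l. p \<in> P \<Longrightarrow> l < n \<Longrightarrow> poly_in (vars (P - {pv})) (\<lambda>x. X x p l)"
    and diag: "\<And>\<alpha> k \<beta> l x. (\<alpha>, k, \<beta>, l) \<in> P \<Longrightarrow>
      W x (\<alpha>, k, \<beta>, l) \<alpha> * w x (\<alpha>, k, \<beta>, l) k * U x (\<alpha>, k, \<beta>, l) \<beta> * X x (\<alpha>, k, \<beta>, l) l = 1"
    and zero: "\<And>p \<alpha> k \<beta> l x. p \<in> P - {pv} \<Longrightarrow> (\<alpha>, k, \<beta>, l) \<in> P - {p} \<Longrightarrow>
      W x p \<alpha> * w x p k * U x p \<beta> * X x p l = 0"
  shows "thin (n + n) {L. \<exists>x. \<forall>p\<in>P. form4 n L (W x p) (w x p) (U x p) (X x p) = 0}"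
proof -
  define c where "c p = (\<lambda>(\<alpha>, k, \<beta>, l) x. W x p \<alpha> * w x p k * U x p \<beta> * X x p l)" for p
  have "thin (n + n) {L. \<exists>x. \<forall>p\<in>P. (\<Sum>q\<in>idx4 n. c p q x * entry4 n L q) = 0}"
  proof (rule thin_linear_mat[OF P pv])
    show "poly_in (vars (P - {pv})) (c p q)" if "p \<in> P" "q \<in> idx4 n" for p q
      using that by (cases q) (auto simp: c_def idx4_def intro!: poly_in.mult poly)
    show "c p p x = 1" if "p \<in> P" for p x
      using diag that by (cases p) (auto simp: c_def)
    show "c p q x = 0" if "p \<in> P - {pv}" "q \<in> P - {p}" for p q x
      using zero[OF that(1)] that(2) by (cases q) (auto simp: c_def)
  qed
  then show ?thesis by (simp add: form4_def c_def split_def)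
qed

lemma poly_in_if:
  "(b \<Longrightarrow> poly_in B f) \<Longrightarrow> (\<not> b \<Longrightarrow> poly_in B g) \<Longrightarrow> poly_in B (\<lambda>x. if b then f x else g x)"
  by (cases b) simp_all

lemma poly_in_unit_fun: "poly_in B (\<lambda>x. unit_fun k l)"
  by (rule poly_in.const)

lemma form4_cong:
  assumes "\<And>\<alpha>. \<alpha> < 2 \<Longrightarrow> W \<alpha> = W' \<alpha>" "\<And>k. k < n \<Longrightarrow> w k = w' k"
    "\<And>\<beta>. \<beta> < 2 \<Longrightarrow> U \<beta> = U' \<beta>" "\<And>l. l < n \<Longrightarrow> X l = X' l"
  shows "form4 n L W w U X = form4 n L W' w' U' X'"
  using assms by (auto simp: form4_sum intro!: sum.cong)

text \<open>All first partial derivatives of the quadrilinear form vanish at the point; by linearity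
  in each argument they are its values with one argument replaced by a unit vector.\<close>

definition sing_pt :: "nat \<Rightarrow> complex mat \<Rightarrow> (nat \<Rightarrow> complex) \<Rightarrow> (nat \<Rightarrow> complex) \<Rightarrow>
    (nat \<Rightarrow> complex) \<Rightarrow> (nat \<Rightarrow> complex) \<Rightarrow> bool" where
  "sing_pt n L W w U X \<longleftrightarrow>
     (\<forall>\<alpha><2. form4 n L (unit_fun \<alpha>) w U X = 0) \<and> (\<forall>k<n. form4 n L W (unit_fun k) U X = 0) \<and>
     (\<forall>\<beta><2. form4 n L W w (unit_fun \<beta>) X = 0) \<and> (\<forall>l<n. form4 n L W w U (unit_fun l) = 0)"

text \<open>In a chart where coordinate \<open>b\<close> is 1, the index \<open>b\<close> stands for
  keeping \<open>W\<close>, so that the equation there is the vanishing of the form itself; any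
  other index stands for the partial derivative in that direction.\<close>

definition slot :: "nat \<Rightarrow> (nat \<Rightarrow> complex) \<Rightarrow> nat \<Rightarrow> nat \<Rightarrow> complex" where
  "slot b W m \<alpha> = (if m = b then W \<alpha> else unit_fun m \<alpha>)"

lemma slot_same [simp]: "slot b W b = W"
  and slot_other [simp]: "m \<noteq> b \<Longrightarrow> slot b W m = unit_fun m"
  by (auto simp: slot_def fun_eq_iff)

lemma form4_eq_0:
  assumes "\<forall>\<alpha><2. form4 n L (unit_fun \<alpha>) w U X = 0"
  shows "form4 n L W w U X = 0"
proof -
  have "form4 n L (unit_fun \<alpha>) w U X =
      (\<Sum>k<n. \<Sum>\<beta><2. \<Sum>l<n. w k * U \<beta> * X l * L $$ (\<alpha> * n + k, \<beta> * n + l))" if "\<alpha> < 2" for \<alpha>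
    using less_2_cases[OF that] by (auto simp: form4_sum unit_fun_def numeral_2_eq_2)
  then have "form4 n L W w U X = (\<Sum>\<alpha><2. W \<alpha> * form4 n L (unit_fun \<alpha>) w U X)"
    by (simp add: form4_sum[of n L W] sum_distrib_left mult.assoc)
  then show ?thesis using assms by simp
qed

text \<open>The 2 n + 4 partial derivatives satisfy Euler relations, since each of the four groups
  recovers the form; 2 n + 1 equations remain. They are indexed by \<open>?P\<close>, the quadruples
  that differ from \<open>(b, j, a, i)\<close> in at most one place. The 2 n free coordinates of the
  normalised point are stored at the quadruples different from the base one.\<close>

lemma thin_sing_pt:
  assumes b: "b < 2" and j: "j < n" and a: "a < 2" and i: "i < n"
  shows "thin (n + n) {L. \<exists>W w U X. W b = 1 \<and> w j = 1 \<and> U a = 1 \<and> X i = 1 \<and> sing_pt n L W w U X}"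
proof -
  let ?P = "{(\<alpha>, k, \<beta>, l). (\<alpha>, k, \<beta>, l) \<in> idx4 n \<and>
    (k = j \<and> \<beta> = a \<and> l = i \<or> \<alpha> = b \<and> \<beta> = a \<and> l = i \<or> \<alpha> = b \<and> k = j \<and> l = i \<or> \<alpha> = b \<and> k = j \<and> \<beta> = a)}"
  let ?pv = "(b, j, a, i)"
  define W where "W x \<alpha> = (if \<alpha> = b then 1 else x (\<alpha>, j, a, i))"
    for x :: "nat \<times> nat \<times> nat \<times> nat \<Rightarrow> complex" and \<alpha>
  define w where "w x k = (if k = j then 1 else x (b, k, a, i))"
    for x :: "nat \<times> nat \<times> nat \<times> nat \<Rightarrow> complex" and k
  define U where "U x \<beta> = (if \<beta> = a then 1 else x (b, j, \<beta>, i))"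
    for x :: "nat \<times> nat \<times> nat \<times> nat \<Rightarrow> complex" and \<beta>
  define X where "X x l = (if l = i then 1 else x (b, j, a, l))"
    for x :: "nat \<times> nat \<times> nat \<times> nat \<Rightarrow> complex" and l
  have "thin (n + n) {L. \<exists>x. \<forall>p\<in>?P. form4 n L (slot b (W x) (fst p)) (slot j (w x) (fst (snd p)))
      (slot a (U x) (fst (snd (snd p)))) (slot i (X x) (snd (snd (snd p)))) = 0}"
  proof (rule thin_form4[where pv = ?pv and W = "\<lambda>x p. slot b (W x) (fst p)" and w = "\<lambda>x p. slot j (w x) (fst (snd p))"
        and U = "\<lambda>x p. slot a (U x) (fst (snd (snd p)))" and X = "\<lambda>x p. slot i (X x) (snd (snd (snd p)))"])
    show "?P \<subseteq> idx4 n" by auto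
    show "?pv \<in> ?P" using assms by (auto simp: idx4_def)
    show "poly_in (vars (?P - {?pv})) (\<lambda>x. slot b (W x) (fst p) \<alpha>)" if "\<alpha> < 2" for p \<alpha>
      by (cases "\<alpha> = b") (use assms that in \<open>auto simp: slot_def W_def idx4_def intro!: poly_in.const poly_in_var poly_in_unit_fun poly_in_if\<close>)
    show "poly_in (vars (?P - {?pv})) (\<lambda>x. slot j (w x) (fst (snd p)) k)" if "k < n" for p k
      by (cases "k = j") (use assms that in \<open>auto simp: slot_def w_def idx4_def intro!: poly_in.const poly_in_var poly_in_unit_fun poly_in_if\<close>)
    show "poly_in (vars (?P - {?pv})) (\<lambda>x. slot a (U x) (fst (snd (snd p))) \<beta>)" if "\<beta> < 2" for p \<beta>
      by (cases "\<beta> = a") (use assms that in \<open>auto simp: slot_def U_def idx4_def intro!: poly_in.const poly_in_var poly_in_unit_fun poly_in_if\<close>)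
    show "poly_in (vars (?P - {?pv})) (\<lambda>x. slot i (X x) (snd (snd (snd p))) l)" if "l < n" for p l
      by (cases "l = i") (use assms that in \<open>auto simp: slot_def X_def idx4_def intro!: poly_in.const poly_in_var poly_in_unit_fun poly_in_if\<close>)
    show "slot b (W x) (fst (\<alpha>, k, \<beta>, l)) \<alpha> * slot j (w x) (fst (snd (\<alpha>, k, \<beta>, l))) k *
        slot a (U x) (fst (snd (snd (\<alpha>, k, \<beta>, l)))) \<beta> * slot i (X x) (snd (snd (snd (\<alpha>, k, \<beta>, l)))) l = 1"
      for \<alpha> k \<beta> l x
      by (simp add: slot_def W_def w_def U_def X_def unit_fun_def)
    show "slot b (W x) (fst p) \<alpha> * slot j (w x) (fst (snd p)) k *
        slot a (U x) (fst (snd (snd p))) \<beta> * slot i (X x) (snd (snd (snd p))) l = 0"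
      if p: "p \<in> ?P - {?pv}" and q: "(\<alpha>, k, \<beta>, l) \<in> ?P - {p}" for p \<alpha> k \<beta> l x
    proof -
      obtain \<alpha>' k' \<beta>' l' where p': "p = (\<alpha>', k', \<beta>', l')" by (cases p) auto
      \<comment> \<open>The quadruple \<open>p\<close> leaves the base quadruple in exactly one
        place. A different \<open>q\<close> in \<open>?P\<close> cannot agree with \<open>p\<close>
        there, and the unit vector in that slot then makes the coefficient zero.\<close>
      have "\<alpha>' \<noteq> b \<and> \<alpha> \<noteq> \<alpha>' \<or> k' \<noteq> j \<and> k \<noteq> k' \<or> \<beta>' \<noteq> a \<and> \<beta> \<noteq> \<beta>' \<or> l' \<noteq> i \<and> l \<noteq> l'"
        using p q unfolding p' by auto
      moreover have "slot r Y m m' = 0" if "m \<noteq> r" "m' \<noteq> m" for r Y m m'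
        using that by (simp add: slot_def unit_fun_def)
      ultimately show ?thesis unfolding p' by auto
    qed
  qed
  then show ?thesis
  proof (rule thin_subset, safe)
    fix L W' w' U' X'
    assume *: "W' b = 1" "w' j = 1" "U' a = 1" "X' i = 1" "sing_pt n L W' w' U' X'"
    define x where "x = (\<lambda>(\<alpha>::nat, k::nat, \<beta>::nat, l::nat). if k = j \<and> \<beta> = a \<and> l = i then W' \<alpha>
      else if \<alpha> = b \<and> \<beta> = a \<and> l = i then w' k
      else if \<alpha> = b \<and> k = j \<and> l = i then U' \<beta> else X' l)"
    have x: "W x = W'" "w x = w'" "U x = U'" "X x = X'"
      using * by (auto simp: x_def W_def w_def U_def X_def fun_eq_iff)
    show "\<exists>x. \<forall>p\<in>?P. form4 n L (slot b (W x) (fst p)) (slot j (w x) (fst (snd p)))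
      (slot a (U x) (fst (snd (snd p)))) (slot i (X x) (snd (snd (snd p)))) = 0"
    proof (intro exI[of _ x] ballI)
      fix p assume "p \<in> ?P"
      then obtain \<alpha> k \<beta> l where p: "p = (\<alpha>, k, \<beta>, l)" "\<alpha> < 2" "k < n" "\<beta> < 2" "l < n"
        "k = j \<and> \<beta> = a \<and> l = i \<or> \<alpha> = b \<and> \<beta> = a \<and> l = i \<or> \<alpha> = b \<and> k = j \<and> l = i \<or> \<alpha> = b \<and> k = j \<and> \<beta> = a"
        by (auto simp: idx4_def)
      \<comment> \<open>Euler: the form is a combination of its partial derivatives, and this is the
        equation for the base index in each slot.\<close>
      have z: "form4 n L W' w' U' X' = 0" using form4_eq_0 *(5) by (auto simp: sing_pt_def)
      have "form4 n L (slot b W' \<alpha>) w' U' X' = 0"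
        by (cases "\<alpha> = b") (use z p *(5) in \<open>auto simp: sing_pt_def\<close>)
      moreover have "form4 n L W' (slot j w' k) U' X' = 0"
        by (cases "k = j") (use z p *(5) in \<open>auto simp: sing_pt_def\<close>)
      moreover have "form4 n L W' w' (slot a U' \<beta>) X' = 0"
        by (cases "\<beta> = a") (use z p *(5) in \<open>auto simp: sing_pt_def\<close>)
      moreover have "form4 n L W' w' U' (slot i X' l) = 0"
        by (cases "l = i") (use z p *(5) in \<open>auto simp: sing_pt_def\<close>)
      ultimately show "form4 n L (slot b (W x) (fst p)) (slot j (w x) (fst (snd p)))
          (slot a (U x) (fst (snd (snd p)))) (slot i (X x) (snd (snd (snd p)))) = 0"
        using p(6) by (auto simp: x p(1))
    qed
  qed
qed

definition corank2_pt :: "nat \<Rightarrow> complex mat \<Rightarrow> (nat \<Rightarrow> complex) \<Rightarrow> (nat \<Rightarrow> complex) \<Rightarrow>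
    (nat \<Rightarrow> complex) \<Rightarrow> (nat \<Rightarrow> complex) \<Rightarrow> bool" where
  "corank2_pt n L W U X X' \<longleftrightarrow>
     (\<forall>k<n. form4 n L W (unit_fun k) U X = 0 \<and> form4 n L W (unit_fun k) U X' = 0)"

text \<open>Two independent kernel vectors can be reduced so that their coordinates at
  \<open>i\<close>, \<open>i'\<close> form the identity matrix. This leaves 2 (n - 2) parameters for
  them and one each for \<open>W\<close> and \<open>U\<close>, against 2 n equations.\<close>

lemma thin_corank2:
  assumes b: "b < 2" and a: "a < 2" and i: "i < n" "i' < n" "i \<noteq> i'"
  shows "thin (n + n) {L. \<exists>W U X X'. W b = 1 \<and> U a = 1 \<and> X i = 1 \<and> X i' = 0 \<and> X' i' = 1 \<and> X' i = 0 \<and>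
    corank2_pt n L W U X X'}"
proof -
  let ?P = "{b} \<times> {..<n} \<times> {a} \<times> {i, i'}"
  let ?pv = "(b, i, a, i)"
  \<comment> \<open>The positions \<open>(b, i', a, i)\<close> and \<open>(b, i, a, i')\<close>
    belong to the prescribed zeros of \<open>X\<close> and \<open>X'\<close>, so they are free to
    hold the remaining coordinates of \<open>W\<close> and \<open>U\<close>.\<close>
  define W where "W x \<alpha> = (if \<alpha> = b then 1 else x (b, i', a, i))"
    for x :: "nat \<times> nat \<times> nat \<times> nat \<Rightarrow> complex" and \<alpha>
  define U where "U x \<beta> = (if \<beta> = a then 1 else x (b, i, a, i'))"
    for x :: "nat \<times> nat \<times> nat \<times> nat \<Rightarrow> complex" and \<beta>
  define X where "X x m l = (if l = m then 1 else if l = i \<or> l = i' then 0 else x (b, l, a, m))"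
    for x :: "nat \<times> nat \<times> nat \<times> nat \<Rightarrow> complex" and m l
  have "thin (n + n) {L. \<exists>x. \<forall>p\<in>?P. form4 n L (W x) (unit_fun (fst (snd p))) (U x) (X x (snd (snd (snd p)))) = 0}"
  proof (rule thin_form4[where pv = ?pv and W = "\<lambda>x p. W x" and w = "\<lambda>x p. unit_fun (fst (snd p))"
        and U = "\<lambda>x p. U x" and X = "\<lambda>x p. X x (snd (snd (snd p)))"])
    show "?P \<subseteq> idx4 n" using assms by (auto simp: idx4_def)
    show "?pv \<in> ?P" using assms by auto
  qed (use assms in \<open>auto simp: unit_fun_def W_def U_def X_def
        split: if_splits intro!: poly_in.const poly_in_var poly_in_if\<close>)
  then show ?thesis
  proof (rule thin_subset, safe)
    fix L W' U' X1 X2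
    assume *: "W' b = 1" "U' a = 1" "X1 i = 1" "X1 i' = 0" "X2 i' = 1" "X2 i = 0" "corank2_pt n L W' U' X1 X2"
    define x where "x = (\<lambda>(\<alpha>::nat, k::nat, \<beta>::nat, l::nat). if k = i' \<and> l = i then W' (1 - b)
      else if k = i \<and> l = i' then U' (1 - a) else if l = i then X1 k else X2 k)"
    have x: "\<alpha> < 2 \<Longrightarrow> W x \<alpha> = W' \<alpha>" "\<alpha> < 2 \<Longrightarrow> U x \<alpha> = U' \<alpha>" "X x i = X1" "X x i' = X2" for \<alpha>
      using * assms by (auto simp: x_def W_def U_def X_def fun_eq_iff less_2_cases_iff)
    have "form4 n L (W x) w (U x) X = form4 n L W' w U' X" for w X
      by (rule form4_cong) (auto simp: x)
    then show "\<exists>x. \<forall>p\<in>?P. form4 n L (W x) (unit_fun (fst (snd p))) (U x) (X x (snd (snd (snd p)))) = 0"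
      using *(7) by (intro exI[of _ x]) (auto simp: x corank2_pt_def)
  qed
qed

text \<open>There are n equations but n - 1 parameters: one for \<open>W\<close>, and n - 2 for
  \<open>X\<close>, which has one coordinate equal to 1 and the last equal to 0. The coordinate of
  \<open>W\<close> is stored at \<open>k = i\<close>, and \<open>k = n - 1\<close> is the empty
  position.\<close>

lemma thin_vacuum_u_inf:
  assumes b: "b < 2" and i: "Suc i < n"
  shows "thin (n + n) {L. \<exists>W X. W b = 1 \<and> X i = 1 \<and> X (n - 1) = 0 \<and>
    (\<forall>k<n. form4 n L W (unit_fun k) (unit_fun 0) X = 0)}"
proof -
  let ?P = "{b} \<times> {..<n} \<times> {0::nat} \<times> {i}"
  let ?pv = "(b, n - 1, 0, i)"
  define W where "W x \<alpha> = (if \<alpha> = b then 1 else x (b, i, 0, i))"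
    for x :: "nat \<times> nat \<times> nat \<times> nat \<Rightarrow> complex" and \<alpha>
  define X where "X x l = (if l = i then 1 else if l = n - 1 then 0 else x (b, l, 0, i))"
    for x :: "nat \<times> nat \<times> nat \<times> nat \<Rightarrow> complex" and l
  have "thin (n + n) {L. \<exists>x. \<forall>p\<in>?P. form4 n L (W x) (unit_fun (fst (snd p))) (unit_fun 0) (X x) = 0}"
  proof (rule thin_form4[where pv = ?pv and W = "\<lambda>x p. W x" and w = "\<lambda>x p. unit_fun (fst (snd p))"
        and U = "\<lambda>x p. unit_fun 0" and X = "\<lambda>x p. X x"])
    show "?P \<subseteq> idx4 n" using assms by (auto simp: idx4_def)
    show "?pv \<in> ?P" using assms by auto
  qed (use assms in \<open>auto simp: unit_fun_def W_def X_def
        split: if_splits intro!: poly_in.const poly_in_var poly_in_if\<close>)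
  then show ?thesis
  proof (rule thin_subset, safe)
    fix L W' X'
    assume *: "W' b = 1" "X' i = 1" "X' (n - 1) = 0" "\<forall>k<n. form4 n L W' (unit_fun k) (unit_fun 0) X' = 0"
    define x where "x = (\<lambda>(\<alpha>::nat, k, \<beta>::nat, l::nat). if k = i then W' (1 - b) else X' k)"
    have x: "\<alpha> < 2 \<Longrightarrow> W x \<alpha> = W' \<alpha>" "X x = X'" for \<alpha>
      using * assms by (auto simp: x_def W_def X_def fun_eq_iff less_2_cases_iff)
    have "form4 n L (W x) w U X = form4 n L W' w U X" for w U X
      by (rule form4_cong) (auto simp: x)
    then show "\<exists>x. \<forall>p\<in>?P. form4 n L (W x) (unit_fun (fst (snd p))) (unit_fun 0) (X x) = 0"
      using *(4) by (intro exI[of _ x]) (auto simp: x)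
  qed
qed

text \<open>For \<open>V = (1, 0)\<close> the annihilating covector is (0, -1), hence
  \<open>unit_fun 1\<close> up to sign. The parameters are one for \<open>U\<close> and n - 2 for
  \<open>X\<close>, again one fewer than the equations.\<close>

lemma thin_vacuum_v_inf:
  assumes a: "a < 2" and i: "Suc i < n"
  shows "thin (n + n) {L. \<exists>U X. U a = 1 \<and> X i = 1 \<and> X (n - 1) = 0 \<and>
    (\<forall>k<n. form4 n L (unit_fun 1) (unit_fun k) U X = 0)}"
proof -
  let ?P = "{1::nat} \<times> {..<n} \<times> {a} \<times> {i}"
  let ?pv = "(1::nat, n - 1, a, i)"
  define U where "U x \<alpha> = (if \<alpha> = a then 1 else x (1, i, a, i))"
    for x :: "nat \<times> nat \<times> nat \<times> nat \<Rightarrow> complex" and \<alpha>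
  define X where "X x l = (if l = i then 1 else if l = n - 1 then 0 else x (1, l, a, i))"
    for x :: "nat \<times> nat \<times> nat \<times> nat \<Rightarrow> complex" and l
  have "thin (n + n) {L. \<exists>x. \<forall>p\<in>?P. form4 n L (unit_fun 1) (unit_fun (fst (snd p))) (U x) (X x) = 0}"
  proof (rule thin_form4[where pv = ?pv and W = "\<lambda>x p. unit_fun 1" and w = "\<lambda>x p. unit_fun (fst (snd p))"
        and U = "\<lambda>x p. U x" and X = "\<lambda>x p. X x"])
    show "?P \<subseteq> idx4 n" using assms by (auto simp: idx4_def)
    show "?pv \<in> ?P" using assms by auto
    have mem: "(1, l, a, i) \<in> ?P - {?pv}" if "l < n" "l \<noteq> n - 1" for l
      using that by simp
    show "poly_in (vars (?P - {?pv})) (\<lambda>x. U x \<beta>)" for \<beta>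
      unfolding U_def by (intro poly_in_if poly_in.const poly_in_var mem) (use i in simp_all)
    show "poly_in (vars (?P - {?pv})) (\<lambda>x. X x l)" if "l < n" for l
      unfolding X_def by (intro poly_in_if poly_in.const poly_in_var mem that) simp
    show "poly_in (vars (?P - {?pv})) (\<lambda>x. unit_fun 1 l)" "poly_in (vars (?P - {?pv})) (\<lambda>x. unit_fun (fst (snd p)) l)" for p l
      by (rule poly_in.const)+
    show "unit_fun 1 \<alpha> * unit_fun (fst (snd (\<alpha>, k, \<beta>, l))) k * U x \<beta> * X x l = 1"
      if "(\<alpha>, k, \<beta>, l) \<in> ?P" for \<alpha> k \<beta> l x
      using that by (simp add: unit_fun_def U_def X_def)
    show "unit_fun 1 \<alpha> * unit_fun (fst (snd p)) k * U x \<beta> * X x l = 0"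
      if "p \<in> ?P - {?pv}" "(\<alpha>, k, \<beta>, l) \<in> ?P - {p}" for p \<alpha> k \<beta> l x
      using that by (cases p) (auto simp: unit_fun_def)
  qed
  then show ?thesis
  proof (rule thin_subset, safe)
    fix L U' X'
    assume *: "U' a = 1" "X' i = 1" "X' (n - 1) = 0" "\<forall>k<n. form4 n L (unit_fun 1) (unit_fun k) U' X' = 0"
    define x where "x = (\<lambda>(\<alpha>::nat, k, \<beta>::nat, l::nat). if k = i then U' (1 - a) else X' k)"
    have x: "\<alpha> < 2 \<Longrightarrow> U x \<alpha> = U' \<alpha>" "X x = X'" for \<alpha>
      using * assms by (auto simp: x_def U_def X_def fun_eq_iff less_2_cases_iff)
    have "form4 n L W w (U x) X = form4 n L W w U' X" for W w X
      by (rule form4_cong) (auto simp: x)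
    then show "\<exists>x. \<forall>p\<in>?P. form4 n L (unit_fun 1) (unit_fun (fst (snd p))) (U x) (X x) = 0"
      using *(4) by (intro exI[of _ x]) (auto simp: x)
  qed
qed

text \<open>If the last coordinate of \<open>Y\<close> vanishes, the last entries of both blocks of
  \<open>L (U \<otimes> X)\<close> are zero. Together with the equations for
  \<open>k < n - 1\<close> these are n + 1 conditions on n parameters, one for \<open>W\<close> and
  n - 1 for \<open>X\<close>.\<close>

lemma thin_covacuum_u_inf:
  assumes b: "b < 2" and i: "i < n"
  shows "thin (n + n) {L. \<exists>W X. W b = 1 \<and> X i = 1 \<and>
    (\<forall>k<n. form4 n L W (unit_fun k) (unit_fun 0) X = 0) \<and>
    (\<forall>\<alpha><2. form4 n L (unit_fun \<alpha>) (unit_fun (n - 1)) (unit_fun 0) X = 0)}"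
proof -
  let ?P = "insert (1 - b, n - 1, 0, i) ({b} \<times> {..<n} \<times> {0::nat} \<times> {i})"
  let ?pv = "(1 - b, n - 1, 0, i)"
  define W where "W x \<alpha> = (if \<alpha> = b then 1 else x (b, i, 0, i))"
    for x :: "nat \<times> nat \<times> nat \<times> nat \<Rightarrow> complex" and \<alpha>
  define X where "X x l = (if l = i then 1 else x (b, l, 0, i))"
    for x :: "nat \<times> nat \<times> nat \<times> nat \<Rightarrow> complex" and l
  \<comment> \<open>At \<open>k = n - 1\<close> the equation with \<open>W\<close> is a combination
    of the two equations with unit covectors. The latter are taken as the system because
    \<open>W\<close> would couple the two unknowns of \<open>?P\<close> with that
    \<open>k\<close>.\<close>
  define W' where "W' x p \<alpha> = (if fst (snd p) = n - 1 then unit_fun (fst p) \<alpha> else W x \<alpha>)"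
    for x \<alpha> and p :: "nat \<times> nat \<times> nat \<times> nat"
  have "thin (n + n) {L. \<exists>x. \<forall>p\<in>?P. form4 n L (W' x p) (unit_fun (fst (snd p))) (unit_fun 0) (X x) = 0}"
  proof (rule thin_form4[where pv = ?pv and W = "W'" and w = "\<lambda>x p. unit_fun (fst (snd p))"
        and U = "\<lambda>x p. unit_fun 0" and X = "\<lambda>x p. X x"])
    show "?P \<subseteq> idx4 n" using assms by (auto simp: idx4_def)
    show "?pv \<in> ?P" using assms by auto
  qed (use assms in \<open>auto simp: unit_fun_def W_def W'_def X_def less_2_cases_iff
        split: if_splits intro!: poly_in.const poly_in_var poly_in_if\<close>)
  then show ?thesis
  proof (rule thin_subset, safe)
    fix L W0 X'
    assume *: "W0 b = 1" "X' i = 1" "\<forall>k<n. form4 n L W0 (unit_fun k) (unit_fun 0) X' = 0"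
      "\<forall>\<alpha><2. form4 n L (unit_fun \<alpha>) (unit_fun (n - 1)) (unit_fun 0) X' = 0"
    define x where "x = (\<lambda>(\<alpha>::nat, k, \<beta>::nat, l::nat). if k = i then W0 (1 - b) else X' k)"
    have x: "\<alpha> < 2 \<Longrightarrow> W x \<alpha> = W0 \<alpha>" "X x = X'" for \<alpha>
      using * assms by (auto simp: x_def W_def X_def fun_eq_iff less_2_cases_iff)
    have "form4 n L (W x) w U X = form4 n L W0 w U X" for w U X
      by (rule form4_cong) (auto simp: x)
    moreover have "W' x p = (if fst (snd p) = n - 1 then unit_fun (fst p) else W x)" for p
      by (auto simp: W'_def)
    ultimately show "\<exists>x. \<forall>p\<in>?P. form4 n L (W' x p) (unit_fun (fst (snd p))) (unit_fun 0) (X x) = 0"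
      using *(3,4) assms by (intro exI[of _ x]) (auto simp: x)
  qed
qed

text \<open>Over v = infinity the second block of \<open>V \<otimes> Y\<close> is zero, which
  already accounts for n equations; the last coordinate of \<open>Y\<close> sits in the first block
  and adds one more. The parameters number n.\<close>

lemma thin_covacuum_v_inf:
  assumes a: "a < 2" and i: "i < n"
  shows "thin (n + n) {L. \<exists>U X. U a = 1 \<and> X i = 1 \<and>
    (\<forall>k<n. form4 n L (unit_fun 1) (unit_fun k) U X = 0) \<and>
    form4 n L (unit_fun 0) (unit_fun (n - 1)) U X = 0}"
proof -
  let ?P = "insert (0, n - 1, a, i) ({1::nat} \<times> {..<n} \<times> {a} \<times> {i})"
  let ?pv = "(0, n - 1, a, i)"
  define U where "U x \<alpha> = (if \<alpha> = a then 1 else x (1, i, a, i))"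
    for x :: "nat \<times> nat \<times> nat \<times> nat \<Rightarrow> complex" and \<alpha>
  define X where "X x l = (if l = i then 1 else x (1, l, a, i))"
    for x :: "nat \<times> nat \<times> nat \<times> nat \<Rightarrow> complex" and l
  have "thin (n + n) {L. \<exists>x. \<forall>p\<in>?P. form4 n L (unit_fun (fst p)) (unit_fun (fst (snd p))) (U x) (X x) = 0}"
  proof (rule thin_form4[where pv = ?pv and W = "\<lambda>x p. unit_fun (fst p)" and w = "\<lambda>x p. unit_fun (fst (snd p))"
        and U = "\<lambda>x p. U x" and X = "\<lambda>x p. X x"])
    show "?P \<subseteq> idx4 n" using assms by (auto simp: idx4_def)
    show "?pv \<in> ?P" using assms by auto
  qed (use assms in \<open>auto simp: unit_fun_def U_def X_def
        split: if_splits intro!: poly_in.const poly_in_var poly_in_if\<close>)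
  then show ?thesis
  proof (rule thin_subset, safe)
    fix L U' X'
    assume *: "U' a = 1" "X' i = 1" "\<forall>k<n. form4 n L (unit_fun 1) (unit_fun k) U' X' = 0"
      "form4 n L (unit_fun 0) (unit_fun (n - 1)) U' X' = 0"
    define x where "x = (\<lambda>(\<alpha>::nat, k, \<beta>::nat, l::nat). if k = i then U' (1 - a) else X' k)"
    have x: "\<alpha> < 2 \<Longrightarrow> U x \<alpha> = U' \<alpha>" "X x = X'" for \<alpha>
      using * assms by (auto simp: x_def U_def X_def fun_eq_iff less_2_cases_iff)
    have "form4 n L W w (U x) X = form4 n L W w U' X" for W w X
      by (rule form4_cong) (auto simp: x)
    then show "\<exists>x. \<forall>p\<in>?P. form4 n L (unit_fun (fst p)) (unit_fun (fst (snd p))) (U x) (X x) = 0"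
      using *(3,4) by (intro exI[of _ x]) (auto simp: x)
  qed
qed

definition nz :: "nat \<Rightarrow> (nat \<Rightarrow> complex) \<Rightarrow> bool" where
  "nz m f \<longleftrightarrow> (\<exists>i<m. f i \<noteq> 0)"

lemma form4_scaleW: "form4 n L (\<lambda>\<alpha>. W \<alpha> / a) w U X = form4 n L W w U X / a"
  and form4_scalew: "form4 n L W (\<lambda>\<alpha>. w \<alpha> / a) U X = form4 n L W w U X / a"
  and form4_scaleU: "form4 n L W w (\<lambda>\<alpha>. U \<alpha> / a) X = form4 n L W w U X / a"
  and form4_scaleX: "form4 n L W w U (\<lambda>\<alpha>. X \<alpha> / a) = form4 n L W w U X / a"
  by (simp_all add: form4_sum sum_divide_distrib)

lemmas form4_scales = form4_scaleW form4_scalew form4_scaleU form4_scaleX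

text \<open>\<open>W\<close> stands for a covector annihilating \<open>V\<close>. Hence an arbitrary
  \<open>W\<close> next to \<open>unit_fun 0\<close> ranges over the points with u = infinity, and
  \<open>unit_fun 1\<close> in the first slot means v = infinity. The third and fourth conditions
  concern the vacuum vector, the last two the covacuum vector.\<close>

definition generic :: "nat \<Rightarrow> complex mat \<Rightarrow> bool" where
  "generic n L \<longleftrightarrow>
     (\<forall>W w U X. nz 2 W \<longrightarrow> nz n w \<longrightarrow> nz 2 U \<longrightarrow> nz n X \<longrightarrow> \<not> sing_pt n L W w U X) \<and>
     (\<forall>W U X X' i i'. nz 2 W \<longrightarrow> nz 2 U \<longrightarrow> i < n \<longrightarrow> i' < n \<longrightarrow> i \<noteq> i' \<longrightarrow>
        X i = 1 \<longrightarrow> X i' = 0 \<longrightarrow> X' i' = 1 \<longrightarrow> X' i = 0 \<longrightarrow> \<not> corank2_pt n L W U X X') \<and>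
     (\<forall>W X. nz 2 W \<longrightarrow> nz n X \<longrightarrow> X (n - 1) = 0 \<longrightarrow>
        \<not> (\<forall>k<n. form4 n L W (unit_fun k) (unit_fun 0) X = 0)) \<and>
     (\<forall>U X. nz 2 U \<longrightarrow> nz n X \<longrightarrow> X (n - 1) = 0 \<longrightarrow>
        \<not> (\<forall>k<n. form4 n L (unit_fun 1) (unit_fun k) U X = 0)) \<and>
     (\<forall>W X. nz 2 W \<longrightarrow> nz n X \<longrightarrow>
        \<not> ((\<forall>k<n. form4 n L W (unit_fun k) (unit_fun 0) X = 0) \<and>
           (\<forall>\<alpha><2. form4 n L (unit_fun \<alpha>) (unit_fun (n - 1)) (unit_fun 0) X = 0))) \<and>
     (\<forall>U X. nz 2 U \<longrightarrow> nz n X \<longrightarrow>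
        \<not> ((\<forall>k<n. form4 n L (unit_fun 1) (unit_fun k) U X = 0) \<and>
           form4 n L (unit_fun 0) (unit_fun (n - 1)) U X = 0))"

text \<open>Every non-zero vector has a non-zero coordinate. Dividing by it leads into one of
  finitely many charts, and the equations survive because the form is homogeneous in each
  argument.\<close>

lemma thin_not_generic:
  assumes n: "n \<ge> 1"
  shows "thin (n + n) {L. \<not> generic n L}"
proof -
  let ?S1 = "\<lambda>b j a i. {L. \<exists>W w U X. W b = 1 \<and> w j = 1 \<and> U a = 1 \<and> X i = 1 \<and> sing_pt n L W w U X}"
  let ?S2 = "\<lambda>b a i i'. {L. \<exists>W U X X'. W b = 1 \<and> U a = 1 \<and> X i = 1 \<and> X i' = 0 \<and> X' i' = 1 \<and> X' i = 0 \<and>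
    corank2_pt n L W U X X'}"
  let ?S3 = "\<lambda>b i. {L. \<exists>W X. W b = 1 \<and> X i = 1 \<and> X (n - 1) = 0 \<and>
    (\<forall>k<n. form4 n L W (unit_fun k) (unit_fun 0) X = 0)}"
  let ?S4 = "\<lambda>a i. {L. \<exists>U X. U a = 1 \<and> X i = 1 \<and> X (n - 1) = 0 \<and>
    (\<forall>k<n. form4 n L (unit_fun 1) (unit_fun k) U X = 0)}"
  let ?S5 = "\<lambda>b i. {L. \<exists>W X. W b = 1 \<and> X i = 1 \<and>
    (\<forall>k<n. form4 n L W (unit_fun k) (unit_fun 0) X = 0) \<and>
    (\<forall>\<alpha><2. form4 n L (unit_fun \<alpha>) (unit_fun (n - 1)) (unit_fun 0) X = 0)}"
  let ?S6 = "\<lambda>a i. {L. \<exists>U X. U a = 1 \<and> X i = 1 \<and>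
    (\<forall>k<n. form4 n L (unit_fun 1) (unit_fun k) U X = 0) \<and>
    form4 n L (unit_fun 0) (unit_fun (n - 1)) U X = 0}"
  have "thin (n + n) (\<Union>(b, j, a, i)\<in>idx4 n. ?S1 b j a i)"
    by (rule thin_UN) (auto simp: idx4_def intro: thin_sing_pt[simplified])
  moreover have "thin (n + n) (\<Union>(b, a, i, i')\<in>{(b, a, i, i'). b < 2 \<and> a < 2 \<and> i < n \<and> i' < n \<and> i \<noteq> i'}. ?S2 b a i i')"
  proof (rule thin_UN)
    show "finite {(b, a, i, i'). b < (2::nat) \<and> a < (2::nat) \<and> i < n \<and> i' < n \<and> i \<noteq> i'}"
      by (rule finite_subset[of _ "{..<2} \<times> {..<2} \<times> {..<n} \<times> {..<n}"]) auto
  qed (auto intro: thin_corank2[simplified])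
  moreover have "thin (n + n) (\<Union>(b, i)\<in>{..<2} \<times> {..<n - 1}. ?S3 b i)"
    by (rule thin_UN) (auto intro: thin_vacuum_u_inf[simplified])
  moreover have "thin (n + n) (\<Union>(b, i)\<in>{..<2} \<times> {..<n - 1}. ?S4 b i)"
    by (rule thin_UN) (auto intro: thin_vacuum_v_inf[simplified])
  moreover have "thin (n + n) (\<Union>(b, i)\<in>{..<2} \<times> {..<n}. ?S5 b i)"
    by (rule thin_UN) (auto intro: thin_covacuum_u_inf[simplified])
  moreover have "thin (n + n) (\<Union>(b, i)\<in>{..<2} \<times> {..<n}. ?S6 b i)"
    by (rule thin_UN) (auto intro: thin_covacuum_v_inf[simplified])
  ultimately have T: "thin (n + n) ((\<Union>(b, j, a, i)\<in>idx4 n. ?S1 b j a i) \<union>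
      (\<Union>(b, a, i, i')\<in>{(b, a, i, i'). b < 2 \<and> a < 2 \<and> i < n \<and> i' < n \<and> i \<noteq> i'}. ?S2 b a i i') \<union>
      (\<Union>(b, i)\<in>{..<2} \<times> {..<n - 1}. ?S3 b i) \<union> (\<Union>(b, i)\<in>{..<2} \<times> {..<n - 1}. ?S4 b i) \<union>
      (\<Union>(b, i)\<in>{..<2} \<times> {..<n}. ?S5 b i) \<union> (\<Union>(b, i)\<in>{..<2} \<times> {..<n}. ?S6 b i))" (is "thin _ ?S")
    by (intro thin_Un)
  have gen: "generic n L" if L: "L \<notin> ?S" for L
    unfolding generic_def
  proof (intro conjI allI impI notI; (elim conjE)?)
    fix W w U X assume *: "nz 2 W" "nz n w" "nz 2 U" "nz n X" "sing_pt n L W w U X"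
    then obtain b j a i where q: "b < 2" "j < n" "a < 2" "i < n" "W b \<noteq> 0" "w j \<noteq> 0" "U a \<noteq> 0" "X i \<noteq> 0"
      by (auto simp: nz_def)
    have "sing_pt n L (\<lambda>m. W m / W b) (\<lambda>m. w m / w j) (\<lambda>m. U m / U a) (\<lambda>m. X m / X i)"
      using *(5) by (auto simp: sing_pt_def form4_scales)
    then have "L \<in> ?S1 b j a i" using q
      by (intro CollectI exI[of _ "\<lambda>m. W m / W b"] exI[of _ "\<lambda>m. w m / w j"]
        exI[of _ "\<lambda>m. U m / U a"] exI[of _ "\<lambda>m. X m / X i"]) simp
    then have "L \<in> (\<Union>(b, j, a, i)\<in>idx4 n. ?S1 b j a i)"
      by (intro UN_I[of "(b, j, a, i)"]) (use q in \<open>simp_all add: idx4_def\<close>)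
    then show False using L by (simp only: Un_iff simp_thms)
  next
    fix W U X X' i i' assume *: "nz 2 W" "nz 2 U" "i < n" "i' < n" "i \<noteq> i'"
      "X i = 1" "X i' = 0" "X' i' = 1" "X' i = 0" "corank2_pt n L W U X X'"
    then obtain b a where q: "b < 2" "a < 2" "W b \<noteq> 0" "U a \<noteq> 0"
      by (auto simp: nz_def)
    have "corank2_pt n L (\<lambda>m. W m / W b) (\<lambda>m. U m / U a) X X'"
      using *(10) by (auto simp: corank2_pt_def form4_scales)
    then have "L \<in> ?S2 b a i i'" using q *
      by (intro CollectI exI[of _ "\<lambda>m. W m / W b"]
        exI[of _ "\<lambda>m. U m / U a"] exI[of _ X] exI[of _ X']) simp
    then have "L \<in> (\<Union>(b, a, i, i')\<in>{(b, a, i, i'). b < 2 \<and> a < 2 \<and> i < n \<and> i' < n \<and> i \<noteq> i'}. ?S2 b a i i')"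
      by (intro UN_I[of "(b, a, i, i')"]) (use q *  in simp_all)
    then show False using L by (simp only: Un_iff simp_thms)
  next
    fix W X assume *: "nz 2 W" "nz n X" "X (n - 1) = 0"
      "\<forall>k<n. form4 n L W (unit_fun k) (unit_fun 0) X = 0"
    then obtain b i where q: "b < 2" "i < n" "W b \<noteq> 0" "X i \<noteq> 0" by (auto simp: nz_def)
    have "i \<noteq> n - 1" using q *(3) by metis
    then have i: "i < n - 1" using q by simp
    have "L \<in> ?S3 b i" using * q
      by (intro CollectI exI[of _ "\<lambda>m. W m / W b"] exI[of _ "\<lambda>m. X m / X i"]) (simp add: form4_scales)
    then have "L \<in> (\<Union>(b, i)\<in>{..<2} \<times> {..<n - 1}. ?S3 b i)"
      by (intro UN_I[of "(b, i)"]) (use q i in simp_all)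
    then show False using L by (simp only: Un_iff simp_thms)
  next
    fix W X assume *: "nz 2 W" "nz n X" "X (n - 1) = 0"
      "\<forall>k<n. form4 n L (unit_fun 1) (unit_fun k) W X = 0"
    then obtain b i where q: "b < 2" "i < n" "W b \<noteq> 0" "X i \<noteq> 0" by (auto simp: nz_def)
    have "i \<noteq> n - 1" using q *(3) by metis
    then have i: "i < n - 1" using q by simp
    have "L \<in> ?S4 b i" using * q
      by (intro CollectI exI[of _ "\<lambda>m. W m / W b"] exI[of _ "\<lambda>m. X m / X i"]) (simp add: form4_scales)
    then have "L \<in> (\<Union>(b, i)\<in>{..<2} \<times> {..<n - 1}. ?S4 b i)"
      by (intro UN_I[of "(b, i)"]) (use q i in simp_all)
    then show False using L by (simp only: Un_iff simp_thms)
  next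
    fix W X assume *: "nz 2 W" "nz n X"
      "\<forall>k<n. form4 n L W (unit_fun k) (unit_fun 0) X = 0"
      "\<forall>\<alpha><2. form4 n L (unit_fun \<alpha>) (unit_fun (n - 1)) (unit_fun 0) X = 0"
    then obtain b i where q: "b < 2" "i < n" "W b \<noteq> 0" "X i \<noteq> 0" by (auto simp: nz_def)
    have "L \<in> ?S5 b i" using * q
      by (intro CollectI exI[of _ "\<lambda>m. W m / W b"] exI[of _ "\<lambda>m. X m / X i"]) (simp add: form4_scales)
    then have "L \<in> (\<Union>(b, i)\<in>{..<2} \<times> {..<n}. ?S5 b i)"
      by (intro UN_I[of "(b, i)"]) (use q in simp_all)
    then show False using L by (simp only: Un_iff simp_thms)
  next
    fix W X assume *: "nz 2 W" "nz n X"
      "\<forall>k<n. form4 n L (unit_fun 1) (unit_fun k) W X = 0"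
      "form4 n L (unit_fun 0) (unit_fun (n - 1)) W X = 0"
    then obtain b i where q: "b < 2" "i < n" "W b \<noteq> 0" "X i \<noteq> 0" by (auto simp: nz_def)
    have "L \<in> ?S6 b i" using * q
      by (intro CollectI exI[of _ "\<lambda>m. W m / W b"] exI[of _ "\<lambda>m. X m / X i"]) (simp add: form4_scales)
    then have "L \<in> (\<Union>(b, i)\<in>{..<2} \<times> {..<n}. ?S6 b i)"
      by (intro UN_I[of "(b, i)"]) (use q in simp_all)
    then show False using L by (simp only: Un_iff simp_thms)
  qed
  show ?thesis
  proof (rule thin_subset[OF T], rule subsetI, rule ccontr)
    fix L assume "L \<in> {L. \<not> generic n L}" and L: "L \<notin> ?S"
    then show False using gen[OF L] by (simp only: mem_Collect_eq simp_thms)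
  qed
qed

section \<open>The matrix \<open>bmat\<close> of a pair of points and its kernel\<close>

definition sel :: "complex \<times> complex \<Rightarrow> nat \<Rightarrow> complex" where
  "sel U \<beta> = (if \<beta> = 0 then fst U else snd U)"

text \<open>The covector annihilating \<open>V\<close>: contracting the block index of
  \<open>V \<otimes> Y\<close> with it gives zero for every \<open>Y\<close>.\<close>

definition perp :: "complex \<times> complex \<Rightarrow> complex \<times> complex" where
  "perp V = (snd V, - fst V)"

text \<open>In blocks this is \<open>v1 (u0 A + u1 B) - v0 (u0 C + u1 D)\<close>. Written as a
  contraction of the tensor, it connects the determinant of the curve with
  \<open>form4\<close>.\<close>

definition bmat :: "nat \<Rightarrow> complex mat \<Rightarrow> complex \<times> complex \<Rightarrow> complex \<times> complex \<Rightarrow> complex mat" where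
  "bmat n L U V = mat n n (\<lambda>(k, l).
     \<Sum>\<alpha><2. \<Sum>\<beta><2. sel (perp V) \<alpha> * sel U \<beta> * L $$ (\<alpha> * n + k, \<beta> * n + l))"

lemma bmat_carrier [simp]: "bmat n L U V \<in> carrier_mat n n"
  and dim_row_bmat [simp]: "dim_row (bmat n L U V) = n"
  and dim_col_bmat [simp]: "dim_col (bmat n L U V) = n"
  by (simp_all add: bmat_def)

lemma bmat_index:
  "k < n \<Longrightarrow> l < n \<Longrightarrow> bmat n L U V $$ (k, l) =
     snd V * (fst U * L $$ (k, l) + snd U * L $$ (k, n + l)) -
     fst V * (fst U * L $$ (n + k, l) + snd U * L $$ (n + k, n + l))"
  by (simp add: bmat_def sel_def perp_def numeral_2_eq_2 algebra_simps)

lemma vacuum_form_bmat: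
  assumes "L \<in> carrier_mat (n + n) (n + n)"
  shows "vacuum_form n L U V = det (bmat n L U V)"
proof -
  obtain u0 u1 v0 v1 where UV: "U = (u0, u1)" "V = (v0, v1)" by (cases U, cases V)
  obtain A B C D where s: "split_block L n n = (A, B, C, D)"
    by (metis prod_cases4)
  note sp = split_block[OF s, of n n]
  have "(u0 * v1) \<cdot>\<^sub>m A + (u1 * v1) \<cdot>\<^sub>m B - (u0 * v0) \<cdot>\<^sub>m C - (u1 * v0) \<cdot>\<^sub>m D = bmat n L U V"
    (is "?M = _")
  proof (rule eq_matI)
    fix k l assume "k < dim_row (bmat n L U V)" "l < dim_col (bmat n L U V)"
    then have kl: "k < n" "l < n" by auto
    have "A \<in> carrier_mat n n" "B \<in> carrier_mat n n" "C \<in> carrier_mat n n" "D \<in> carrier_mat n n"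
      "L = four_block_mat A B C D" using sp assms by auto
    then have "A $$ (k, l) = L $$ (k, l)" "B $$ (k, l) = L $$ (k, n + l)"
      "C $$ (k, l) = L $$ (n + k, l)" "D $$ (k, l) = L $$ (n + k, n + l)"
      using kl by auto
    then show "?M $$ (k, l) = bmat n L U V $$ (k, l)"
      using kl sp assms by (simp add: bmat_index UV algebra_simps)
  qed (use sp assms in auto)
  then show ?thesis using s UV by (simp add: vacuum_form_def)
qed

definition tens_row :: "nat \<Rightarrow> complex mat \<Rightarrow> complex \<times> complex \<Rightarrow> complex vec \<Rightarrow> nat \<Rightarrow> complex" where
  "tens_row n L U X r = (\<Sum>l<n. (fst U * L $$ (r, l) + snd U * L $$ (r, n + l)) * X $ l)"

lemma bmat_mult_index:
  assumes "X \<in> carrier_vec n" "k < n"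
  shows "(bmat n L U V *\<^sub>v X) $ k = snd V * tens_row n L U X k - fst V * tens_row n L U X (n + k)"
proof -
  have "(bmat n L U V *\<^sub>v X) $ k = (\<Sum>l<n. bmat n L U V $$ (k, l) * X $ l)"
    using assms by (simp add: scalar_prod_def lessThan_atLeast0)
  also have "\<dots> = (\<Sum>l<n. snd V * ((fst U * L $$ (k, l) + snd U * L $$ (k, n + l)) * X $ l) -
     fst V * ((fst U * L $$ (n + k, l) + snd U * L $$ (n + k, n + l)) * X $ l))"
    using assms by (intro sum.cong refl) (simp add: bmat_index algebra_simps)
  also have "\<dots> = snd V * tens_row n L U X k - fst V * tens_row n L U X (n + k)"
    by (simp add: tens_row_def sum_subtractf sum_distrib_left)
  finally show ?thesis .
qed

lemma form4_unit_left:
  assumes "\<alpha> < 2" "k < n" "X \<in> carrier_vec n"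
  shows "form4 n L (unit_fun \<alpha>) (unit_fun k) (sel U) (vec_index X) = tens_row n L U X (\<alpha> * n + k)"
proof -
  have "form4 n L (unit_fun \<alpha>) (unit_fun k) (sel U) (vec_index X) =
    (\<Sum>\<alpha>'<2. \<Sum>k'<n. if \<alpha>' = \<alpha> \<and> k' = k then
       (\<Sum>\<beta><2. \<Sum>l<n. sel U \<beta> * X $ l * L $$ (\<alpha> * n + k, \<beta> * n + l)) else 0)"
    unfolding form4_sum by (intro sum.cong refl) (auto simp: unit_fun_def)
  also have "\<dots> = (\<Sum>\<alpha>'<2. if \<alpha>' = \<alpha> then
       (\<Sum>\<beta><2. \<Sum>l<n. sel U \<beta> * X $ l * L $$ (\<alpha> * n + k, \<beta> * n + l)) else 0)"
    using assms(2) by (intro sum.cong refl) auto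
  also have "\<dots> = (\<Sum>\<beta><2. \<Sum>l<n. sel U \<beta> * X $ l * L $$ (\<alpha> * n + k, \<beta> * n + l))"
    using assms(1) by simp
  also have "\<dots> = tens_row n L U X (\<alpha> * n + k)"
    by (simp add: tens_row_def sel_def numeral_2_eq_2 algebra_simps sum.distrib)
  finally show ?thesis .
qed

lemma form4_bmat:
  assumes "X \<in> carrier_vec n"
  shows "form4 n L (sel (perp V)) w (sel U) (vec_index X) = (\<Sum>k<n. w k * (bmat n L U V *\<^sub>v X) $ k)"
proof -
  have "(\<Sum>k<n. w k * (bmat n L U V *\<^sub>v X) $ k) =
    (\<Sum>k<n. \<Sum>l<n. w k * bmat n L U V $$ (k, l) * X $ l)"
    using assms by (intro sum.cong refl) (simp add: scalar_prod_def lessThan_atLeast0 sum_distrib_left mult.assoc)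
  also have "\<dots> = form4 n L (sel (perp V)) w (sel U) (vec_index X)"
    by (simp add: form4_sum bmat_def numeral_2_eq_2 sum_distrib_left sum_distrib_right sum.distrib algebra_simps)
  finally show ?thesis by simp
qed

lemma sum_double_split:
  fixes f :: "nat \<Rightarrow> complex"
  shows "(\<Sum>i = 0..<n + n. f i) = (\<Sum>l<n. f l) + (\<Sum>l<n. f (n + l))"
proof -
  have "(\<Sum>i = 0..<n + n. f i) = (\<Sum>i = 0..<n. f i) + (\<Sum>i = n..<n + n. f i)"
    by (simp add: sum.atLeastLessThan_concat)
  also have "(\<Sum>i = n..<n + n. f i) = (\<Sum>l<n. f (n + l))"
    using sum.shift_bounds_nat_ivl[of f 0 n n] by (simp add: lessThan_atLeast0 add.commute)
  finally show ?thesis by (simp add: lessThan_atLeast0)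
qed

lemma tens_row_mult:
  assumes "L \<in> carrier_mat (n + n) (n + n)" "X \<in> carrier_vec n" "r < n + n"
  shows "(L *\<^sub>v tensor2 U X) $ r = tens_row n L U X r"
proof -
  have "(L *\<^sub>v tensor2 U X) $ r = (\<Sum>i = 0..<n + n. L $$ (r, i) * tensor2 U X $ i)"
    using assms by (auto simp: scalar_prod_def tensor2_def)
  also have "\<dots> = (\<Sum>l<n. L $$ (r, l) * (fst U * X $ l)) + (\<Sum>l<n. L $$ (r, n + l) * (snd U * X $ l))"
    unfolding sum_double_split using assms(2) by (intro arg_cong2[where f = "(+)"] sum.cong) (auto simp: tensor2_def)
  also have "\<dots> = tens_row n L U X r"
    by (simp add: tens_row_def sum.distrib algebra_simps)
  finally show ?thesis .
qed

lemma tensor_eq_iff: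
  assumes L: "L \<in> carrier_mat (n + n) (n + n)" and X: "X \<in> carrier_vec n" and Y: "Y \<in> carrier_vec n"
  shows "L *\<^sub>v tensor2 U X = tensor2 V Y \<longleftrightarrow>
    (\<forall>k<n. tens_row n L U X k = fst V * Y $ k \<and> tens_row n L U X (n + k) = snd V * Y $ k)"
    (is "?l \<longleftrightarrow> ?r")
proof
  assume l: ?l
  show ?r
  proof (intro allI impI)
    fix k assume k: "k < n"
    have "(L *\<^sub>v tensor2 U X) $ k = tensor2 V Y $ k" "(L *\<^sub>v tensor2 U X) $ (n + k) = tensor2 V Y $ (n + k)"
      using l by auto
    then show "tens_row n L U X k = fst V * Y $ k \<and> tens_row n L U X (n + k) = snd V * Y $ k"
      using k Y tens_row_mult[OF L X] by (auto simp: tensor2_def)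
  qed
next
  assume r: ?r
  show ?l
  proof (rule eq_vecI)
    show "dim_vec (L *\<^sub>v tensor2 U X) = dim_vec (tensor2 V Y)" using L Y by (auto simp: tensor2_def)
    fix i assume "i < dim_vec (tensor2 V Y)"
    then have i: "i < n + n" using Y by (auto simp: tensor2_def)
    show "(L *\<^sub>v tensor2 U X) $ i = tensor2 V Y $ i"
    proof (cases "i < n")
      case True
      then show ?thesis using r Y tens_row_mult[OF L X i] by (auto simp: tensor2_def)
    next
      case False
      then obtain k where k: "i = n + k" "k < n" using i by (metis add_less_cancel_left le_Suc_ex not_less)
      then show ?thesis using r Y tens_row_mult[OF L X i] by (auto simp: tensor2_def)
    qed
  qed
qed

text \<open>The kernel condition says that the two blocks of \<open>L (U \<otimes> X)\<close> are in
  the ratio of the coordinates of \<open>V\<close>. Then \<open>Y\<close> is obtained by dividing a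
  block by a non-zero coordinate of \<open>V\<close>.\<close>

lemma bmat_ker_iff:
  assumes L: "L \<in> carrier_mat (n + n) (n + n)" and X: "X \<in> carrier_vec n" and V: "V \<noteq> (0, 0)"
  shows "bmat n L U V *\<^sub>v X = 0\<^sub>v n \<longleftrightarrow> (\<exists>Y\<in>carrier_vec n. L *\<^sub>v tensor2 U X = tensor2 V Y)"
    (is "?l \<longleftrightarrow> ?r")
proof
  assume ?l
  then have eq: "snd V * tens_row n L U X k = fst V * tens_row n L U X (n + k)" if "k < n" for k
    using bmat_mult_index[OF X that, of L U V] that by simp
  define Y where "Y = vec n (\<lambda>k. if snd V = 0 then tens_row n L U X k / fst V
    else tens_row n L U X (n + k) / snd V)"
  have "L *\<^sub>v tensor2 U X = tensor2 V Y"
    using eq V by (subst tensor_eq_iff[OF L X]) (auto simp: Y_def field_simps prod_eq_iff)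
  then show ?r by (intro bexI[of _ Y]) (auto simp: Y_def)
next
  assume ?r
  then obtain Y where Y: "Y \<in> carrier_vec n" "L *\<^sub>v tensor2 U X = tensor2 V Y" by blast
  then show ?l
    using bmat_mult_index[OF X, of _ L U V] tensor_eq_iff[OF L X Y(1)] by (intro eq_vecI) auto
qed

lemma tensor2_eq_0:
  assumes "X \<in> carrier_vec n" "U \<noteq> (0, 0)" "tensor2 U X = 0\<^sub>v (n + n)"
  shows "X = 0\<^sub>v n"
proof (rule eq_vecI)
  fix k assume k: "k < dim_vec (0\<^sub>v n :: complex vec)"
  have "tensor2 U X $ k = 0" "tensor2 U X $ (n + k) = 0" using assms(3) k by auto
  then show "X $ k = 0\<^sub>v n $ k"
    using assms(1,2) k by (auto simp: tensor2_def prod_eq_iff)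
qed (use assms in auto)

lemma tensor2_carrier [simp]: "X \<in> carrier_vec n \<Longrightarrow> tensor2 U X \<in> carrier_vec (n + n)"
  by (simp add: tensor2_def)

lemma hom_nonzero [simp]: "hom p \<noteq> (0, 0)"
  by (cases p) auto

lemma det_nonzero_mult:
  assumes "L \<in> carrier_mat m m" "det L \<noteq> 0" "x \<in> carrier_vec m" "L *\<^sub>v x = 0\<^sub>v m"
  shows "x = (0\<^sub>v m :: complex vec)"
  using assms det_0_iff_vec_prod_zero[OF assms(1)] by auto

text \<open>\<open>Y = 0\<close> would give \<open>L (U \<otimes> X) = 0\<close>, hence
  \<open>X = 0\<close> because \<open>L\<close> is invertible and \<open>U\<close> is
  non-zero.\<close>

lemma vacuum_pair_iff:
  assumes L: "L \<in> carrier_mat (n + n) (n + n)" "det L \<noteq> 0"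
  shows "vacuum_pair n L p X Y \<longleftrightarrow> X \<in> carrier_vec n \<and> Y \<in> carrier_vec n \<and> X \<noteq> 0\<^sub>v n \<and>
     L *\<^sub>v tensor2 (hom (fst p)) X = tensor2 (hom (snd p)) Y"
proof -
  have "X = 0\<^sub>v n" if "X \<in> carrier_vec n" "L *\<^sub>v tensor2 (hom (fst p)) X = tensor2 (hom (snd p)) (0\<^sub>v n)"
  proof -
    have "tensor2 (hom (snd p)) (0\<^sub>v n :: complex vec) = 0\<^sub>v (n + n)" by (auto simp: tensor2_def)
    then have "tensor2 (hom (fst p)) X = 0\<^sub>v (n + n)"
      using det_nonzero_mult[OF L, of "tensor2 (hom (fst p)) X"] that by simp
    then show ?thesis using tensor2_eq_0[OF that(1) hom_nonzero] by blast
  qed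
  then show ?thesis unfolding vacuum_pair_def by blast
qed

lemma is_vacuum_iff:
  assumes L: "L \<in> carrier_mat (n + n) (n + n)" "det L \<noteq> 0"
  shows "is_vacuum n L p X \<longleftrightarrow> X \<in> carrier_vec n \<and> X \<noteq> 0\<^sub>v n \<and>
    bmat n L (hom (fst p)) (hom (snd p)) *\<^sub>v X = 0\<^sub>v n"
  unfolding is_vacuum_def vacuum_pair_iff[OF L]
  using bmat_ker_iff[OF L(1), of X "hom (snd p)" "hom (fst p)"] by auto

section \<open>Kernels, adjugates and smoothness\<close>

lemma adj_col_ker:
  assumes "(M :: complex mat) \<in> carrier_mat n n" "det M = 0" "j < n"
  shows "M *\<^sub>v col (adj_mat M) j = 0\<^sub>v n"
proof -
  have "M *\<^sub>v col (adj_mat M) j = col (M * adj_mat M) j"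
    using adj_mat(1)[OF assms(1)] assms by (metis col_mult2)
  also have "\<dots> = 0\<^sub>v n" using adj_mat(2)[OF assms(1)] assms by (auto intro!: eq_vecI)
  finally show ?thesis .
qed

lemma adj_row_ker:
  assumes "(M :: complex mat) \<in> carrier_mat n n" "det M = 0" "i < n" "l < n"
  shows "(\<Sum>k<n. adj_mat M $$ (i, k) * M $$ (k, l)) = 0"
proof -
  have "(adj_mat M * M) $$ (i, l) = 0" using adj_mat(3)[OF assms(1)] assms by simp
  then show ?thesis using adj_mat(1)[OF assms(1)] assms
    by (auto simp: scalar_prod_def lessThan_atLeast0)
qed

lemma det_replace_col:
  assumes A: "(A :: complex mat) \<in> carrier_mat n n" and k: "k < n" and b: "b \<in> carrier_vec n"
  shows "det (replace_col A b k) = (\<Sum>i<n. adj_mat A $$ (k, i) * b $ i)"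
proof -
  have Ab: "replace_col A b k \<in> carrier_mat n n" using A by (auto simp: replace_col_def)
  show ?thesis
    using k b A by (subst laplace_expansion_column[OF Ab k], auto intro!: sum.cong arg_cong[of _ _ det]
      arg_cong[of _ _ "\<lambda> x. _ * x"] eq_matI
      simp: replace_col_def adj_mat_def cofactor_def mat_delete_def ac_simps)
qed

lemma replace_col_mult:
  assumes A: "(A :: complex mat) \<in> carrier_mat n n" and i: "i < n" and b: "b \<in> carrier_vec n"
    and y: "y \<in> carrier_vec n" and k: "k < n"
  shows "(replace_col A b i *\<^sub>v y) $ k = (A *\<^sub>v y) $ k - y $ i * A $$ (k, i) + y $ i * b $ k"
proof -
  have "(replace_col A b i *\<^sub>v y) $ k = (\<Sum>l<n. (if l = i then b $ k else A $$ (k, l)) * y $ l)"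
    using assms by (auto simp: replace_col_def scalar_prod_def lessThan_atLeast0 intro!: sum.cong)
  also have "\<dots> = b $ k * y $ i + (\<Sum>l\<in>{..<n} - {i}. A $$ (k, l) * y $ l)"
    using i by (subst sum.remove[of _ i]) (auto intro!: sum.cong)
  also have "(\<Sum>l\<in>{..<n} - {i}. A $$ (k, l) * y $ l) = (\<Sum>l<n. A $$ (k, l) * y $ l) - A $$ (k, i) * y $ i"
    using i by (subst sum.remove[of "{..<n}" i]) auto
  also have "(\<Sum>l<n. A $$ (k, l) * y $ l) = (A *\<^sub>v y) $ k"
    using assms by (auto simp: scalar_prod_def lessThan_atLeast0 intro!: sum.cong)
  finally show ?thesis by (simp add: algebra_simps)
qed

text \<open>Replacing column \<open>i\<close> of \<open>M\<close> by the unit vector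
  \<open>j\<close> produces a matrix with determinant \<open>adj_mat M $$ (i, j)\<close>. A kernel
  vector of \<open>M\<close> with zero coordinate \<open>i\<close> does not see the replacement, so
  it lies in the kernel of an invertible matrix.\<close>

lemma ker_eq_0_if_adj:
  assumes M: "(M :: complex mat) \<in> carrier_mat n n" and ij: "i < n" "j < n" "adj_mat M $$ (i, j) \<noteq> 0"
    and y: "y \<in> carrier_vec n" "M *\<^sub>v y = 0\<^sub>v n" "y $ i = 0"
  shows "y = 0\<^sub>v n"
proof -
  let ?R = "replace_col M (unit_vec n j) i"
  have R: "?R \<in> carrier_mat n n" using M by (auto simp: replace_col_def)
  have "det ?R = (\<Sum>k<n. adj_mat M $$ (i, k) * (if k = j then 1 else 0))"
    using ij by (subst det_replace_col[OF M]) (auto intro!: sum.cong)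
  also have "\<dots> = adj_mat M $$ (i, j)" using ij by (simp add: if_distrib cong: if_cong)
  finally have d: "det ?R \<noteq> 0" using ij by simp
  have "?R *\<^sub>v y = 0\<^sub>v n"
    using R replace_col_mult[OF M ij(1) _ y(1), of "unit_vec n j"] y by (intro eq_vecI) auto
  then show ?thesis using det_nonzero_mult[OF R d y(1)] by simp
qed

lemma ker_multiple_of_adj_col:
  assumes M: "(M :: complex mat) \<in> carrier_mat n n" "det M = 0"
    and ij: "i < n" "j < n" "adj_mat M $$ (i, j) \<noteq> 0"
    and y: "y \<in> carrier_vec n" "M *\<^sub>v y = 0\<^sub>v n"
  shows "y = (y $ i / adj_mat M $$ (i, j)) \<cdot>\<^sub>v col (adj_mat M) j"
proof -
  let ?c = "y $ i / adj_mat M $$ (i, j)" and ?x = "col (adj_mat M) j"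
  note adj = adj_mat(1)[OF M(1)]
  have x: "?x \<in> carrier_vec n" using adj by auto
  have "y - ?c \<cdot>\<^sub>v ?x = 0\<^sub>v n"
  proof (rule ker_eq_0_if_adj[OF M(1) ij])
    show "y - ?c \<cdot>\<^sub>v ?x \<in> carrier_vec n" using y x by auto
    have "M *\<^sub>v (y - ?c \<cdot>\<^sub>v ?x) = M *\<^sub>v y - ?c \<cdot>\<^sub>v (M *\<^sub>v ?x)"
      using M(1) y x by (simp add: mult_minus_distrib_mat_vec mult_mat_vec)
    then show "M *\<^sub>v (y - ?c \<cdot>\<^sub>v ?x) = 0\<^sub>v n"
      using y adj_col_ker[OF M ij(2)] by (auto intro!: eq_vecI)
    show "(y - ?c \<cdot>\<^sub>v ?x) $ i = 0" using ij x y adj by auto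
  qed
  show ?thesis
  proof (rule eq_vecI)
    fix k assume "k < dim_vec (?c \<cdot>\<^sub>v ?x)"
    then have k: "k < n" using adj by auto
    have "(y - ?c \<cdot>\<^sub>v ?x) $ k = 0" using \<open>y - ?c \<cdot>\<^sub>v ?x = 0\<^sub>v n\<close> k by simp
    then show "y $ k = (?c \<cdot>\<^sub>v ?x) $ k" using k x y adj by auto
  qed (use x y adj in auto)
qed

lemma nz_vec: "x \<in> carrier_vec n \<Longrightarrow> x \<noteq> 0\<^sub>v n \<Longrightarrow> nz n (vec_index x)"
  unfolding nz_def by (metis eq_vecI carrier_vecD index_zero_vec)

lemma smult_mat_mult_vec:
  "(A :: complex mat) \<in> carrier_mat n m \<Longrightarrow> x \<in> carrier_vec m \<Longrightarrow> (c \<cdot>\<^sub>m A) *\<^sub>v x = c \<cdot>\<^sub>v (A *\<^sub>v x)"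
  by (rule eq_vecI) (auto simp: scalar_prod_def sum_distrib_left mult.assoc intro!: sum.cong)

text \<open>The first kernel vector has a non-zero coordinate \<open>i\<close>; a left kernel vector
  \<open>w\<close> has a non-zero coordinate \<open>r\<close>. Replacing column \<open>i\<close> by
  the unit vector \<open>r\<close> still gives a singular matrix, and its kernel vector turns out to
  be a kernel vector of \<open>M\<close> with coordinate \<open>i\<close> equal to zero, hence
  independent of the first.\<close>

lemma ker_two_if_adj_0:
  assumes M: "(M :: complex mat) \<in> carrier_mat n n" "det M = 0"
    and adj0: "\<And>i j. i < n \<Longrightarrow> j < n \<Longrightarrow> adj_mat M $$ (i, j) = 0"
  obtains i i' x x' where "i < n" "i' < n" "i \<noteq> i'" "x \<in> carrier_vec n" "x' \<in> carrier_vec n"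
    "M *\<^sub>v x = 0\<^sub>v n" "M *\<^sub>v x' = 0\<^sub>v n" "x $ i = 1" "x $ i' = 0" "x' $ i' = 1" "x' $ i = 0"
proof -
  obtain x0 where x0: "x0 \<in> carrier_vec n" "x0 \<noteq> 0\<^sub>v n" "M *\<^sub>v x0 = 0\<^sub>v n"
    using det_0_iff_vec_prod_zero[OF M(1)] M(2) by auto
  then obtain i where i: "i < n" "x0 $ i \<noteq> 0" using nz_vec by (auto simp: nz_def)
  have Mt: "transpose_mat M \<in> carrier_mat n n" using M by auto
  have "det (transpose_mat M) = 0" using M det_transpose by metis
  then obtain w where w: "w \<in> carrier_vec n" "w \<noteq> 0\<^sub>v n" "transpose_mat M *\<^sub>v w = 0\<^sub>v n"
    using det_0_iff_vec_prod_zero[OF Mt] by auto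
  then obtain r where r: "r < n" "w $ r \<noteq> 0" using nz_vec by (auto simp: nz_def)
  have wM: "(\<Sum>k<n. w $ k * M $$ (k, l)) = 0" if "l < n" for l
  proof -
    have "0 = (transpose_mat M *\<^sub>v w) $ l" using w that by simp
    also have "\<dots> = (\<Sum>k<n. w $ k * M $$ (k, l))"
      using that M w(1) by (auto simp: scalar_prod_def lessThan_atLeast0 intro!: sum.cong)
    finally show ?thesis by simp
  qed
  let ?R = "replace_col M (unit_vec n r) i"
  have R: "?R \<in> carrier_mat n n" using M by (auto simp: replace_col_def)
  have "det ?R = 0" using i adj0 by (subst det_replace_col[OF M(1)]) auto
  then obtain y where y: "y \<in> carrier_vec n" "y \<noteq> 0\<^sub>v n" "?R *\<^sub>v y = 0\<^sub>v n"
    using det_0_iff_vec_prod_zero[OF R] by auto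
  have yk: "(M *\<^sub>v y) $ k - y $ i * M $$ (k, i) + y $ i * unit_vec n r $ k = 0" if "k < n" for k
    using replace_col_mult[OF M(1) i(1) _ y(1) that, of "unit_vec n r"] y(3) that by simp
  \<comment> \<open>Pairing with the left kernel vector removes every term containing
    \<open>M\<close> and leaves \<open>y $ i * w $ r\<close>.\<close>
  have "0 = (\<Sum>k<n. w $ k * ((M *\<^sub>v y) $ k - y $ i * M $$ (k, i) + y $ i * unit_vec n r $ k))"
    using yk by simp
  also have "\<dots> = (\<Sum>k<n. w $ k * (M *\<^sub>v y) $ k) - y $ i * (\<Sum>k<n. w $ k * M $$ (k, i))
      + y $ i * (\<Sum>k<n. w $ k * unit_vec n r $ k)"
    by (simp add: algebra_simps sum.distrib sum_subtractf sum_distrib_left)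
  also have "(\<Sum>k<n. w $ k * (M *\<^sub>v y) $ k) = (\<Sum>k<n. \<Sum>l<n. w $ k * M $$ (k, l) * y $ l)"
    using M y by (intro sum.cong refl) (auto simp: scalar_prod_def lessThan_atLeast0 sum_distrib_left mult.assoc intro!: sum.cong)
  also have "\<dots> = (\<Sum>l<n. (\<Sum>k<n. w $ k * M $$ (k, l)) * y $ l)"
    by (subst sum.swap) (simp add: sum_distrib_right)
  also have "\<dots> = 0" using wM by simp
  also have "(\<Sum>k<n. w $ k * unit_vec n r $ k) = (\<Sum>k<n. if k = r then w $ k else 0)"
    using r by (intro sum.cong refl) auto
  also have "\<dots> = w $ r" using r by simp
  finally have yi: "y $ i = 0" using wM i r by simp
  then have My: "M *\<^sub>v y = 0\<^sub>v n" using yk M y by (intro eq_vecI) auto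
  from y obtain i' where i': "i' < n" "y $ i' \<noteq> 0" using nz_vec by (auto simp: nz_def)
  define x' where "x' = (1 / y $ i') \<cdot>\<^sub>v y"
  define x1 where "x1 = (1 / x0 $ i) \<cdot>\<^sub>v x0"
  define x where "x = x1 - (x1 $ i') \<cdot>\<^sub>v x'"
  have c: "x' \<in> carrier_vec n" "x1 \<in> carrier_vec n" "x \<in> carrier_vec n"
    using y x0 by (auto simp: x'_def x1_def x_def)
  have k1: "M *\<^sub>v x' = 0\<^sub>v n" "M *\<^sub>v x1 = 0\<^sub>v n"
    unfolding x'_def x1_def using M y x0 My by (auto simp: mult_mat_vec)
  have "M *\<^sub>v x = M *\<^sub>v x1 - (x1 $ i') \<cdot>\<^sub>v (M *\<^sub>v x')"
    unfolding x_def using M c by (simp add: mult_minus_distrib_mat_vec mult_mat_vec)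
  then have k2: "M *\<^sub>v x = 0\<^sub>v n" using k1 by (auto intro!: eq_vecI)
  have v: "x' $ i' = 1" "x' $ i = 0" "x1 $ i = 1"
    using i i' yi y x0 by (auto simp: x'_def x1_def)
  have "x $ i = 1" "x $ i' = 0" using v c i i' by (auto simp: x_def)
  then show ?thesis using that[of i i' x x'] v c k1 k2 i i' yi by (metis (no_types))
qed

section \<open>Derivatives of the determinant and smoothness\<close>

definition line :: "complex \<times> complex \<Rightarrow> complex \<times> complex \<Rightarrow> complex \<Rightarrow> complex \<times> complex" where
  "line U E s = (fst U + s * fst E, snd U + s * snd E)"

lemma bmat_line:
  "bmat n L (line U E s) V = bmat n L U V + s \<cdot>\<^sub>m bmat n L E V"
  "bmat n L U (line V E s) = bmat n L U V + s \<cdot>\<^sub>m bmat n L U E"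
  by (rule eq_matI; simp add: bmat_index line_def algebra_simps)+

lemma adj_mat_index: "A \<in> carrier_mat n n \<Longrightarrow> i < n \<Longrightarrow> j < n \<Longrightarrow> adj_mat A $$ (i, j) = cofactor A j i"
  by (auto simp: adj_mat_def)

lemma cofactor_closed:
  fixes M :: "'a \<Rightarrow> complex mat"
  assumes const: "\<And>c. Q (\<lambda>_. c)"
    and add: "\<And>f g. Q f \<Longrightarrow> Q g \<Longrightarrow> Q (\<lambda>x. f x + g x)"
    and mult: "\<And>f g. Q f \<Longrightarrow> Q g \<Longrightarrow> Q (\<lambda>x. f x * g x)"
    and entry: "\<And>i j. i < n \<Longrightarrow> j < n \<Longrightarrow> Q (\<lambda>x. M x $$ (i, j))"
    and carrier: "\<And>x. M x \<in> carrier_mat n n" and ij: "i < n" "j < n"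
  shows "Q (\<lambda>x. adj_mat (M x) $$ (i, j))"
proof -
  have "(\<lambda>x. adj_mat (M x) $$ (i, j)) = (\<lambda>x. (-1) ^ (j + i) * det (mat_delete (M x) j i))"
    using adj_mat_index[OF carrier ij] by (auto simp: cofactor_def)
  moreover have "Q (\<lambda>x. det (mat_delete (M x) j i))"
  proof (rule det_closed[where Q = Q and k = "n - 1", OF const add mult])
    show "mat_delete (M x) j i \<in> carrier_mat (n - 1) (n - 1)" for x
      using mat_delete_carrier[OF carrier] .
    fix a b assume ab: "a < n - 1" "b < n - 1"
    have e: "mat_delete (M x) j i $$ (a, b) = M x $$ (insert_index j a, insert_index i b)" for x
    proof -
      obtain m where m: "n = Suc m" using ij by (cases n) auto
      show ?thesis
        using ab ij carrier[of x] unfolding m by (intro mat_delete_index[symmetric]) simp_all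
    qed
    show "Q (\<lambda>x. mat_delete (M x) j i $$ (a, b))"
      unfolding e using ab by (intro entry) (auto simp: insert_index_def)
  qed
  ultimately show ?thesis using mult[OF const] by simp
qed

text \<open>Apply the adjugate of \<open>N = M + s E\<close> to \<open>N X = s E X\<close>: this
  gives \<open>det N\<close> times \<open>X\<close> on one side and \<open>s\<close> times a
  continuous function of \<open>s\<close> on the other. The derivative at 0 is the value of that
  function, by Caratheodory's characterisation.\<close>

lemma det_line_deriv:
  assumes M: "(M :: complex mat) \<in> carrier_mat n n" and E: "E \<in> carrier_mat n n"
    and X: "X \<in> carrier_vec n" "M *\<^sub>v X = 0\<^sub>v n" and i: "i < n"
  shows "X $ i * deriv (\<lambda>s. det (M + s \<cdot>\<^sub>m E)) 0 = (\<Sum>k<n. adj_mat M $$ (i, k) * (E *\<^sub>v X) $ k)"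
proof -
  have c: "M + s \<cdot>\<^sub>m E \<in> carrier_mat n n" for s using M E by auto
  have e: "(M + s \<cdot>\<^sub>m E) $$ (a, b) = M $$ (a, b) + s * E $$ (a, b)" if "a < n" "b < n" for a b s
    using that M E by auto
  have "(\<lambda>s. det (M + s \<cdot>\<^sub>m E)) field_differentiable (at 0)"
    by (rule det_closed[where Q = "\<lambda>f. f field_differentiable (at 0)" and k = n])
       (auto simp: e c simp del: index_add_mat intro!: derivative_intros)
  then have "((\<lambda>s. det (M + s \<cdot>\<^sub>m E)) has_field_derivative deriv (\<lambda>s. det (M + s \<cdot>\<^sub>m E)) 0) (at 0)"
    by (rule field_differentiable_derivI)
  then have d1: "((\<lambda>s. X $ i * det (M + s \<cdot>\<^sub>m E)) has_field_derivative
      X $ i * deriv (\<lambda>s. det (M + s \<cdot>\<^sub>m E)) 0) (at 0)"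
    by (rule DERIV_cmult)
  define g where "g s = (\<Sum>k<n. adj_mat (M + s \<cdot>\<^sub>m E) $$ (i, k) * (E *\<^sub>v X) $ k)" for s
  have "continuous_on UNIV (\<lambda>s. adj_mat (M + s \<cdot>\<^sub>m E) $$ (i, k))" if "k < n" for k
    by (rule cofactor_closed[where Q = "continuous_on UNIV" and n = n])
       (auto simp: e c i that simp del: index_add_mat intro!: continuous_intros)
  then have "continuous_on UNIV g"
    unfolding g_def by (intro continuous_intros) auto
  then have "isCont g 0" by (simp add: continuous_on_eq_continuous_at)
  moreover have eq: "X $ i * det (M + s \<cdot>\<^sub>m E) = g s * s" for s
  proof -
    let ?N = "M + s \<cdot>\<^sub>m E"
    have "X $ i * det ?N = ((det ?N \<cdot>\<^sub>m 1\<^sub>m n) *\<^sub>v X) $ i"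
      using X i by (simp add: smult_mat_mult_vec[of _ n n])
    also have "(det ?N \<cdot>\<^sub>m 1\<^sub>m n) *\<^sub>v X = adj_mat ?N *\<^sub>v (?N *\<^sub>v X)"
      using adj_mat[OF c, of s] X c by (metis assoc_mult_mat_vec)
    also have "?N *\<^sub>v X = s \<cdot>\<^sub>v (E *\<^sub>v X)"
      using M E X by (simp add: add_mult_distrib_mat_vec smult_mat_mult_vec[of _ n n])
    also have "(adj_mat ?N *\<^sub>v (s \<cdot>\<^sub>v (E *\<^sub>v X))) $ i = g s * s"
      using adj_mat(1)[OF c, of s] E X i
      unfolding g_def sum_distrib_right
      by (auto simp: scalar_prod_def[of "row _ _" "_ \<cdot>\<^sub>v _"] lessThan_atLeast0 intro!: sum.cong)
    finally show ?thesis .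
  qed
  ultimately have "((\<lambda>s. X $ i * det (M + s \<cdot>\<^sub>m E)) has_field_derivative g 0) (at 0)"
    unfolding CARAT_DERIV by (intro exI[of _ g]) auto
  with d1 have "X $ i * deriv (\<lambda>s. det (M + s \<cdot>\<^sub>m E)) 0 = g 0" by (rule DERIV_unique)
  moreover have "M + 0 \<cdot>\<^sub>m E = M" using M E by (intro eq_matI) auto
  ultimately show ?thesis by (simp add: g_def)
qed

text \<open>Smoothness in homogeneous coordinates, with all directions allowed. In this form it is
  stable under a linear change of \<open>U\<close> and \<open>V\<close>, which is how
  \<open>L\<close> and \<open>f L\<close> are related, whereas charts would have to be
  matched.\<close>

definition form_smooth :: "nat \<Rightarrow> complex mat \<Rightarrow> bool" where
  "form_smooth n L \<longleftrightarrow> (\<forall>U V. U \<noteq> (0, 0) \<longrightarrow> V \<noteq> (0, 0) \<longrightarrow> det (bmat n L U V) = 0 \<longrightarrow>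
     (\<exists>E. deriv (\<lambda>s. det (bmat n L (line U E s) V)) 0 \<noteq> 0) \<or>
     (\<exists>E. deriv (\<lambda>s. det (bmat n L U (line V E s))) 0 \<noteq> 0))"

lemma nz_sel: "U \<noteq> (0, 0) \<Longrightarrow> nz 2 (sel U)"
  by (cases "fst U = 0") (force simp: nz_def sel_def prod_eq_iff)+

lemma perp_nonzero: "V \<noteq> (0, 0) \<Longrightarrow> perp V \<noteq> (0, 0)"
  by (auto simp: perp_def prod_eq_iff)

lemma sel_unit: "\<beta> < 2 \<Longrightarrow> form4 n L W w (unit_fun \<beta>) X = form4 n L W w (sel (unit_fun \<beta> 0, unit_fun \<beta> 1)) X"
  by (rule form4_cong) (auto simp: sel_def less_2_cases_iff)

lemma sel_perp_unit:
  "\<alpha> < 2 \<Longrightarrow> form4 n L (unit_fun \<alpha>) w U X = form4 n L (sel (perp (- unit_fun \<alpha> 1, unit_fun \<alpha> 0))) w U X"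
  by (rule form4_cong) (auto simp: sel_def perp_def less_2_cases_iff)

lemma generic_adj_nonzero:
  assumes g: "generic n L" and UV: "U \<noteq> (0, 0)" "V \<noteq> (0, 0)" and det: "det (bmat n L U V) = 0"
  shows "\<exists>i<n. \<exists>j<n. adj_mat (bmat n L U V) $$ (i, j) \<noteq> 0"
proof (rule ccontr)
  assume "\<not> ?thesis"
  then obtain i i' x x' where x: "i < n" "i' < n" "i \<noteq> i'" "x \<in> carrier_vec n" "x' \<in> carrier_vec n"
    "bmat n L U V *\<^sub>v x = 0\<^sub>v n" "bmat n L U V *\<^sub>v x' = 0\<^sub>v n" "x $ i = 1" "x $ i' = 0" "x' $ i' = 1" "x' $ i = 0"
    using ker_two_if_adj_0[OF bmat_carrier det] by metis
  have "corank2_pt n L (sel (perp V)) (sel U) (vec_index x) (vec_index x')"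
    using x by (simp add: corank2_pt_def form4_bmat)
  then show False
    using g x nz_sel[OF UV(1)] nz_sel[OF perp_nonzero[OF UV(2)]] unfolding generic_def by metis
qed

text \<open>With \<open>X\<close> a column and \<open>w\<close> a row of the adjugate, the
  derivatives along lines are, up to the factor \<open>X $ i\<close>, the form with \<open>U\<close>
  or \<open>V\<close> replaced by the direction. If all of them vanish, then together with
  \<open>M X = 0\<close> and \<open>w M = 0\<close> the point is singular for the quadrilinear
  form.\<close>

lemma generic_form_smooth:
  assumes g: "generic n L"
  shows "form_smooth n L"
  unfolding form_smooth_def
proof (intro allI impI)
  fix U V assume UV: "U \<noteq> (0, 0)" "V \<noteq> (0, 0)" and det: "det (bmat n L U V) = 0"
  let ?M = "bmat n L U V"
  obtain i j where ij: "i < n" "j < n" "adj_mat ?M $$ (i, j) \<noteq> 0"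
    using generic_adj_nonzero[OF g UV det] by blast
  note adj = adj_mat(1)[OF bmat_carrier, of n L U V]
  define X where "X = col (adj_mat ?M) j"
  define w where "w k = adj_mat ?M $$ (i, k)" for k
  have X: "X \<in> carrier_vec n" "?M *\<^sub>v X = 0\<^sub>v n" "X $ i \<noteq> 0"
    using adj ij adj_col_ker[OF bmat_carrier det ij(2)] by (auto simp: X_def)
  have "nz n w" "nz n (vec_index X)" using ij X by (auto simp: nz_def w_def)
  then have ns: "\<not> sing_pt n L (sel (perp V)) w (sel U) (vec_index X)"
    using g nz_sel[OF UV(1)] nz_sel[OF perp_nonzero[OF UV(2)]] unfolding generic_def by metis
  have dU: "X $ i * deriv (\<lambda>s. det (bmat n L (line U E s) V)) 0 = form4 n L (sel (perp V)) w (sel E) (vec_index X)" for E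
    using det_line_deriv[OF bmat_carrier bmat_carrier X(1,2) ij(1), of L E V]
    by (simp add: bmat_line form4_bmat[OF X(1)] w_def)
  have dV: "X $ i * deriv (\<lambda>s. det (bmat n L U (line V E s))) 0 = form4 n L (sel (perp E)) w (sel U) (vec_index X)" for E
    using det_line_deriv[OF bmat_carrier bmat_carrier X(1,2) ij(1), of L U E]
    by (simp add: bmat_line form4_bmat[OF X(1)] w_def)
  have a: "form4 n L (sel (perp V)) (unit_fun k) (sel U) (vec_index X) = 0" if "k < n" for k
    using X that by (simp add: form4_bmat)
  have b: "form4 n L (sel (perp V)) w (sel U) (unit_fun l) = 0" if l: "l < n" for l
  proof -
    have "form4 n L (sel (perp V)) w (sel U) (unit_fun l) =
        form4 n L (sel (perp V)) w (sel U) (vec_index (unit_vec n l))"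
      using l by (intro form4_cong) (auto simp: unit_fun_def)
    also have "\<dots> = (\<Sum>k<n. w k * ?M $$ (k, l))"
      using l by (simp add: form4_bmat)
    also have "\<dots> = 0" unfolding w_def by (rule adj_row_ker[OF bmat_carrier det ij(1) l])
    finally show ?thesis .
  qed
  show "(\<exists>E. deriv (\<lambda>s. det (bmat n L (line U E s) V)) 0 \<noteq> 0) \<or>
     (\<exists>E. deriv (\<lambda>s. det (bmat n L U (line V E s))) 0 \<noteq> 0)"
  proof (rule ccontr)
    assume "\<not> ?thesis"
    then have "deriv (\<lambda>s. det (bmat n L (line U E s) V)) 0 = 0"
      "deriv (\<lambda>s. det (bmat n L U (line V E s))) 0 = 0" for E by blast+
    then have "form4 n L (sel (perp V)) w (sel E) (vec_index X) = 0"
      "form4 n L (sel (perp E)) w (sel U) (vec_index X) = 0" for E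
      unfolding dU[symmetric] dV[symmetric] by simp_all
    then have "sing_pt n L (sel (perp V)) w (sel U) (vec_index X)"
      unfolding sing_pt_def
    proof (intro conjI allI impI)
      fix \<alpha> :: nat assume "\<alpha> < 2"
      then have "form4 n L (unit_fun \<alpha>) w (sel U) (vec_index X) =
          form4 n L (sel (perp (- unit_fun \<alpha> 1, unit_fun \<alpha> 0))) w (sel U) (vec_index X)"
        by (rule sel_perp_unit)
      also have "\<dots> = 0" by fact
      finally show "form4 n L (unit_fun \<alpha>) w (sel U) (vec_index X) = 0" .
    next
      fix \<beta> :: nat assume "\<beta> < 2"
      then have "form4 n L (sel (perp V)) w (unit_fun \<beta>) (vec_index X) =
          form4 n L (sel (perp V)) w (sel (unit_fun \<beta> 0, unit_fun \<beta> 1)) (vec_index X)"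
        by (rule sel_unit)
      also have "\<dots> = 0" by fact
      finally show "form4 n L (sel (perp V)) w (unit_fun \<beta>) (vec_index X) = 0" .
    qed (use a b in auto)
    with ns show False by contradiction
  qed
qed

text \<open>Any direction is a combination of the point itself and the chart direction. Along the
  point itself the derivative vanishes on the curve because \<open>M X = 0\<close>, so a non-zero
  derivative must come from the chart direction.\<close>

lemma form_smooth_curve:
  assumes s: "form_smooth n L" and L: "L \<in> carrier_mat (n + n) (n + n)"
  shows "smooth_vacuum_curve n L"
  unfolding smooth_vacuum_curve_def
proof
  fix p assume "p \<in> vacuum_curve n L"
  let ?U = "hom (fst p)" and ?V = "hom (snd p)"
  let ?M = "bmat n L ?U ?V"
  have det: "det ?M = 0" using \<open>p \<in> _\<close> by (simp add: vacuum_curve_def vacuum_form_bmat[OF L])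
  obtain X where X: "X \<in> carrier_vec n" "X \<noteq> 0\<^sub>v n" "?M *\<^sub>v X = 0\<^sub>v n"
    using det_0_iff_vec_prod_zero[OF bmat_carrier, of n L ?U ?V] det by auto
  then obtain i where i: "i < n" "X $ i \<noteq> 0" using nz_vec by (auto simp: nz_def)
  \<comment> \<open>The velocity of the chart: both charts are lines in homogeneous coordinates, and
    \<open>dir q\<close> and \<open>hom q\<close> span the plane.\<close>
  define dir where "dir q = (case q of Aff c \<Rightarrow> (1::complex, 0::complex) | Inf_pt \<Rightarrow> (0, 1))" for q
  have ch: "chart_hom q s = line (hom q) (dir q) s" for q s
    by (cases q) (auto simp: line_def dir_def)
  have sp: "\<exists>a b. E = (a * fst (hom q) + b * fst (dir q), a * snd (hom q) + b * snd (dir q))" for E q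
  proof (cases q)
    case (Aff c)
    then show ?thesis by (intro exI[of _ "snd E"] exI[of _ "fst E - snd E * c"]) (simp add: dir_def)
  next
    case Inf_pt
    then show ?thesis by (intro exI[of _ "fst E"] exI[of _ "snd E"]) (simp add: dir_def)
  qed
  have dU: "X $ i * deriv (\<lambda>s. det (bmat n L (line ?U E s) ?V)) 0 =
      (\<Sum>k<n. adj_mat ?M $$ (i, k) * (bmat n L E ?V *\<^sub>v X) $ k)" for E
    using det_line_deriv[OF bmat_carrier bmat_carrier X(1,3) i(1), of L E ?V] by (simp add: bmat_line)
  have dV: "X $ i * deriv (\<lambda>s. det (bmat n L ?U (line ?V E s))) 0 =
      (\<Sum>k<n. adj_mat ?M $$ (i, k) * (bmat n L ?U E *\<^sub>v X) $ k)" for E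
    using det_line_deriv[OF bmat_carrier bmat_carrier X(1,3) i(1), of L ?U E] by (simp add: bmat_line)
  have linU: "(bmat n L (a * u + b * u', a * v + b * v') V *\<^sub>v X) $ k =
      a * (bmat n L (u, v) V *\<^sub>v X) $ k + b * (bmat n L (u', v') V *\<^sub>v X) $ k" if "k < n" for a b u v u' v' V k
    using X(1) that by (simp add: bmat_mult_index tens_row_def algebra_simps sum.distrib sum_distrib_left
        del: index_mult_mat_vec)
  have linV: "(bmat n L U (a * u + b * u', a * v + b * v') *\<^sub>v X) $ k =
      a * (bmat n L U (u, v) *\<^sub>v X) $ k + b * (bmat n L U (u', v') *\<^sub>v X) $ k" if "k < n" for a b u v u' v' U k
    using X(1) that by (simp add: bmat_mult_index algebra_simps del: index_mult_mat_vec)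
  show "deriv (\<lambda>s. vacuum_form n L (chart_hom (fst p) s) ?V) 0 \<noteq> 0 \<or>
     deriv (\<lambda>t. vacuum_form n L ?U (chart_hom (snd p) t)) 0 \<noteq> 0"
  proof (rule ccontr)
    assume "\<not> ?thesis"
    then have z: "deriv (\<lambda>s. det (bmat n L (line ?U (dir (fst p)) s) ?V)) 0 = 0"
      "deriv (\<lambda>s. det (bmat n L ?U (line ?V (dir (snd p)) s))) 0 = 0"
      by (simp_all add: vacuum_form_bmat[OF L] ch)
    have "deriv (\<lambda>s. det (bmat n L (line ?U E s) ?V)) 0 = 0" for E
    proof -
      obtain a b where E: "E = (a * fst ?U + b * fst (dir (fst p)), a * snd ?U + b * snd (dir (fst p)))"
        using sp by blast
      have "X $ i * deriv (\<lambda>s. det (bmat n L (line ?U E s) ?V)) 0 =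
          (\<Sum>k<n. adj_mat ?M $$ (i, k) * (a * (?M *\<^sub>v X) $ k + b * (bmat n L (dir (fst p)) ?V *\<^sub>v X) $ k))"
        unfolding dU E by (intro sum.cong refl) (simp add: linU del: index_mult_mat_vec)
      also have "\<dots> = b * (\<Sum>k<n. adj_mat ?M $$ (i, k) * (bmat n L (dir (fst p)) ?V *\<^sub>v X) $ k)"
        using X(3) by (simp add: sum_distrib_left algebra_simps del: index_mult_mat_vec)
      also have "\<dots> = 0" unfolding dU[symmetric] z by simp
      finally show ?thesis using i by simp
    qed
    moreover have "deriv (\<lambda>s. det (bmat n L ?U (line ?V E s))) 0 = 0" for E
    proof -
      obtain a b where E: "E = (a * fst ?V + b * fst (dir (snd p)), a * snd ?V + b * snd (dir (snd p)))"
        using sp by blast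
      have "X $ i * deriv (\<lambda>s. det (bmat n L ?U (line ?V E s))) 0 =
          (\<Sum>k<n. adj_mat ?M $$ (i, k) * (a * (?M *\<^sub>v X) $ k + b * (bmat n L ?U (dir (snd p)) *\<^sub>v X) $ k))"
        unfolding dV E by (intro sum.cong refl) (simp add: linV del: index_mult_mat_vec)
      also have "\<dots> = b * (\<Sum>k<n. adj_mat ?M $$ (i, k) * (bmat n L ?U (dir (snd p)) *\<^sub>v X) $ k)"
        using X(3) by (simp add: sum_distrib_left algebra_simps del: index_mult_mat_vec)
      also have "\<dots> = 0" unfolding dV[symmetric] z by simp
      finally show ?thesis using i by simp
    qed
    ultimately show False using s det unfolding form_smooth_def by (metis hom_nonzero)
  qed
qed

section \<open>The map \<open>f\<close>\<close>

lemma mult_smult_one: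
  "(A :: complex mat) \<in> carrier_mat n m \<Longrightarrow> A * (c \<cdot>\<^sub>m 1\<^sub>m m) = c \<cdot>\<^sub>m A"
  by (simp add: mult_smult_distrib[of A n m "1\<^sub>m m" m])

lemma inverse_mat:
  assumes "(L :: complex mat) \<in> carrier_mat m m" "det L \<noteq> 0"
  shows "the (mat_inverse L) \<in> carrier_mat m m" "L * the (mat_inverse L) = 1\<^sub>m m"
    "the (mat_inverse L) * L = 1\<^sub>m m"
proof -
  have "mat_inverse L \<noteq> None"
    using mat_inverse(1)[OF assms(1), where b = "()"] det_non_zero_imp_unit[OF assms, where b = "()"] by blast
  then obtain Li where "mat_inverse L = Some Li" by blast
  then show "the (mat_inverse L) \<in> carrier_mat m m" "L * the (mat_inverse L) = 1\<^sub>m m"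
    "the (mat_inverse L) * L = 1\<^sub>m m" using mat_inverse(2)[OF assms(1)] by auto
qed

lemma block_transpose_props:
  assumes "M \<in> carrier_mat (n + n) (n + n)"
  shows block_transpose_carrier: "block_transpose n M \<in> carrier_mat (n + n) (n + n)"
    and block_transpose_index: "\<And>k l. k < n \<Longrightarrow> l < n \<Longrightarrow> block_transpose n M $$ (k, l) = M $$ (k, l)"
      "\<And>k l. k < n \<Longrightarrow> l < n \<Longrightarrow> block_transpose n M $$ (k, n + l) = M $$ (n + k, l)"
      "\<And>k l. k < n \<Longrightarrow> l < n \<Longrightarrow> block_transpose n M $$ (n + k, l) = M $$ (k, n + l)"
      "\<And>k l. k < n \<Longrightarrow> l < n \<Longrightarrow> block_transpose n M $$ (n + k, n + l) = M $$ (n + k, n + l)"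
proof -
  obtain A B C D where s: "split_block M n n = (A, B, C, D)" by (metis prod_cases4)
  have sp: "A \<in> carrier_mat n n" "B \<in> carrier_mat n n" "C \<in> carrier_mat n n" "D \<in> carrier_mat n n"
    "M = four_block_mat A B C D" using split_block[OF s, of n n] assms by auto
  have e: "block_transpose n M = four_block_mat A C B D" by (simp add: block_transpose_def s)
  show "block_transpose n M \<in> carrier_mat (n + n) (n + n)" using sp(1-4) by (simp add: e)
  fix k l assume kl: "k < n" "l < n"
  have "M $$ (k, l) = A $$ (k, l)" "M $$ (k, n + l) = B $$ (k, l)"
    "M $$ (n + k, l) = C $$ (k, l)" "M $$ (n + k, n + l) = D $$ (k, l)"
    using kl sp(1-4) by (simp_all add: sp(5))
  then show "block_transpose n M $$ (k, l) = M $$ (k, l)"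
    "block_transpose n M $$ (k, n + l) = M $$ (n + k, l)"
    "block_transpose n M $$ (n + k, l) = M $$ (k, n + l)"
    "block_transpose n M $$ (n + k, n + l) = M $$ (n + k, n + l)"
    using kl sp(1-4) by (simp_all add: e)
qed

lemma f_map_carrier:
  assumes "L \<in> carrier_mat (n + n) (n + n)" "det L \<noteq> 0"
  shows "f_map n L \<in> carrier_mat (n + n) (n + n)"
  unfolding f_map_def by (rule block_transpose_carrier[OF inverse_mat(1)[OF assms]])

text \<open>If \<open>U\<close> represents z, this represents -1/z. It is inverse to
  \<open>perp\<close>.\<close>

definition rot :: "complex \<times> complex \<Rightarrow> complex \<times> complex" where
  "rot U = (- snd U, fst U)"

lemma rot_perp [simp]: "rot (perp U) = U"
  by (simp add: rot_def perp_def)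

lemma perp_rot [simp]: "perp (rot U) = U"
  by (simp add: rot_def perp_def)

text \<open>Block transposition exchanges the two block indices of the inverse, so \<open>V\<close>
  is contracted where \<open>perp (rot V) = V\<close> is expected, and \<open>perp U\<close> where
  \<open>rot U = - perp U\<close> is; this is the origin of the sign.\<close>

lemma bmat_f_map_inverse:
  assumes "L \<in> carrier_mat (n + n) (n + n)" "det L \<noteq> 0"
  shows "bmat n (f_map n L) (rot U) (rot V) = (-1) \<cdot>\<^sub>m bmat n (the (mat_inverse L)) V U"
proof (rule eq_matI)
  fix k l assume "k < dim_row ((-1) \<cdot>\<^sub>m bmat n (the (mat_inverse L)) V U)"
    "l < dim_col ((-1) \<cdot>\<^sub>m bmat n (the (mat_inverse L)) V U)"
  then have kl: "k < n" "l < n" by auto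
  let ?Li = "the (mat_inverse L)"
  note bt = block_transpose_index[OF inverse_mat(1)[OF assms] kl]
  have "bmat n (f_map n L) (rot U) (rot V) $$ (k, l) =
      fst V * (- snd U * ?Li $$ (k, l) + fst U * ?Li $$ (n + k, l)) +
      snd V * (- snd U * ?Li $$ (k, n + l) + fst U * ?Li $$ (n + k, n + l))"
    using kl by (simp add: bmat_index f_map_def bt rot_def)
  also have "\<dots> = ((-1) \<cdot>\<^sub>m bmat n ?Li V U) $$ (k, l)"
    using kl by (simp add: bmat_index algebra_simps)
  finally show "bmat n (f_map n L) (rot U) (rot V) $$ (k, l) = ((-1) \<cdot>\<^sub>m bmat n ?Li V U) $$ (k, l)" .
qed auto

text \<open>Multiply the block matrix with columns \<open>U \<otimes> I\<close> and
  \<open>L\<^sup>-\<^sup>1 (V \<otimes> I)\<close> by \<open>L\<close>: the result has columns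
  \<open>L (U \<otimes> I)\<close> and \<open>V \<otimes> I\<close>. In both matrices a block column
  is scalar, so the determinants reduce to n x n ones, which are those of \<open>bmat\<close> for
  \<open>f L\<close> and for \<open>L\<close>.\<close>

lemma det_bmat_f_map:
  assumes L: "L \<in> carrier_mat (n + n) (n + n)" "det L \<noteq> 0"
  shows "det L * det (bmat n (f_map n L) (rot U) (rot V)) = det (bmat n L U V)"
proof -
  let ?Li = "the (mat_inverse L)"
  note Li = inverse_mat[OF L]
  \<comment> \<open>\<open>N1\<close>, \<open>N2\<close> are the two blocks of
    \<open>L\<^sup>-\<^sup>1 (V \<otimes> I)\<close>; \<open>T1\<close>, \<open>T2\<close> are those
    of \<open>L (U \<otimes> I)\<close>.\<close>
  define N1 where "N1 = mat n n (\<lambda>(k, l). fst V * ?Li $$ (k, l) + snd V * ?Li $$ (k, n + l))"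
  define N2 where "N2 = mat n n (\<lambda>(k, l). fst V * ?Li $$ (n + k, l) + snd V * ?Li $$ (n + k, n + l))"
  define T1 where "T1 = mat n n (\<lambda>(k, l). fst U * L $$ (k, l) + snd U * L $$ (k, n + l))"
  define T2 where "T2 = mat n n (\<lambda>(k, l). fst U * L $$ (n + k, l) + snd U * L $$ (n + k, n + l))"
  define I where "I = (1\<^sub>m n :: complex mat)"
  have c: "N1 \<in> carrier_mat n n" "N2 \<in> carrier_mat n n" "T1 \<in> carrier_mat n n" "T2 \<in> carrier_mat n n"
    "I \<in> carrier_mat n n" by (auto simp: N1_def N2_def T1_def T2_def I_def)
  let ?K = "four_block_mat (fst U \<cdot>\<^sub>m I) N1 (snd U \<cdot>\<^sub>m I) N2"
  let ?T = "four_block_mat T1 (fst V \<cdot>\<^sub>m I) T2 (snd V \<cdot>\<^sub>m I)"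
  have K: "?K \<in> carrier_mat (n + n) (n + n)" using c by simp
  have LLi: "(\<Sum>s<n. L $$ (r, s) * ?Li $$ (s, t)) + (\<Sum>s<n. L $$ (r, n + s) * ?Li $$ (n + s, t)) =
      (if r = t then 1 else 0)" if "r < n + n" "t < n + n" for r t
  proof -
    have "(L * ?Li) $$ (r, t) = (if r = t then 1 else 0)" using Li(2) that by simp
    then show ?thesis using that L Li(1) by (simp add: scalar_prod_def sum_double_split)
  qed
  have "L * ?K = ?T"
  proof (rule eq_matI)
    show "dim_row (L * ?K) = dim_row ?T" "dim_col (L * ?K) = dim_col ?T" using L c by auto
    fix r t assume "r < dim_row ?T" "t < dim_col ?T"
    then have rt: "r < n + n" "t < n + n" using c by auto
    have m: "(L * ?K) $$ (r, t) = (\<Sum>s<n. L $$ (r, s) * ?K $$ (s, t)) + (\<Sum>s<n. L $$ (r, n + s) * ?K $$ (n + s, t))"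
      using L K rt by (simp add: scalar_prod_def sum_double_split del: index_mat_four_block)
    show "(L * ?K) $$ (r, t) = ?T $$ (r, t)"
    proof (cases "t < n")
      case True
      have "(L * ?K) $$ (r, t) = (\<Sum>s<n. if s = t then L $$ (r, s) * fst U else 0) +
          (\<Sum>s<n. if s = t then L $$ (r, n + s) * snd U else 0)"
        unfolding m using True c by (intro arg_cong2[where f = "(+)"] sum.cong refl) (auto simp: I_def)
      also have "\<dots> = fst U * L $$ (r, t) + snd U * L $$ (r, n + t)" using True by simp
      also have "\<dots> = ?T $$ (r, t)"
      proof (cases "r < n")
        case False
        then obtain k where "r = n + k" "k < n" using rt by (metis add_less_cancel_left le_Suc_ex not_less)
        then show ?thesis using True c by (simp add: T2_def)
      qed (use True c in \<open>simp add: T1_def\<close>)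
      finally show ?thesis .
    next
      case False
      then obtain l where l: "t = n + l" "l < n" using rt by (metis add_less_cancel_left le_Suc_ex not_less)
      have "(L * ?K) $$ (r, t) =
          (\<Sum>s<n. L $$ (r, s) * (fst V * ?Li $$ (s, l) + snd V * ?Li $$ (s, n + l))) +
          (\<Sum>s<n. L $$ (r, n + s) * (fst V * ?Li $$ (n + s, l) + snd V * ?Li $$ (n + s, n + l)))"
        unfolding m using l c by (intro arg_cong2[where f = "(+)"] sum.cong refl) (auto simp: N1_def N2_def)
      also have "\<dots> = fst V * ((\<Sum>s<n. L $$ (r, s) * ?Li $$ (s, l)) + (\<Sum>s<n. L $$ (r, n + s) * ?Li $$ (n + s, l))) +
          snd V * ((\<Sum>s<n. L $$ (r, s) * ?Li $$ (s, n + l)) + (\<Sum>s<n. L $$ (r, n + s) * ?Li $$ (n + s, n + l)))"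
        by (simp add: sum.distrib sum_distrib_left algebra_simps)
      also have "\<dots> = fst V * (if r = l then 1 else 0) + snd V * (if r = n + l then 1 else 0)"
        using l rt by (simp add: LLi)
      also have "\<dots> = ?T $$ (r, t)"
      proof (cases "r < n")
        case False
        then obtain k where "r = n + k" "k < n" using rt by (metis add_less_cancel_left le_Suc_ex not_less)
        then show ?thesis using l c by (simp add: I_def)
      qed (use l c in \<open>simp add: I_def\<close>)
      finally show ?thesis .
    qed
  qed
  then have "det ?T = det L * det ?K" using det_mult[OF L(1) K] by simp
  moreover have "det ?T = det (bmat n L U V)"
  proof -
    have "det ?T = det (T1 * (snd V \<cdot>\<^sub>m I) - (fst V \<cdot>\<^sub>m I) * T2)"
      using c by (intro det_four_block_mat) (auto simp: I_def)
    also have "T1 * (snd V \<cdot>\<^sub>m I) - (fst V \<cdot>\<^sub>m I) * T2 = snd V \<cdot>\<^sub>m T1 - fst V \<cdot>\<^sub>m T2"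
      using c by (simp add: I_def mult_smult_one mult_smult_assoc_mat[of _ n n])
    also have "\<dots> = bmat n L U V"
      by (rule eq_matI) (auto simp: bmat_index T1_def T2_def)
    finally show ?thesis .
  qed
  moreover have "det ?K = det (bmat n (f_map n L) (rot U) (rot V))"
  proof -
    have "det ?K = det ((fst U \<cdot>\<^sub>m I) * N2 - N1 * (snd U \<cdot>\<^sub>m I))"
      using c by (intro det_four_block_mat) (auto simp: I_def mult_smult_one mult_smult_assoc_mat[of _ n n])
    also have "(fst U \<cdot>\<^sub>m I) * N2 - N1 * (snd U \<cdot>\<^sub>m I) = fst U \<cdot>\<^sub>m N2 - snd U \<cdot>\<^sub>m N1"
      using c by (simp add: I_def mult_smult_one mult_smult_assoc_mat[of _ n n])
    also have "\<dots> = bmat n (f_map n L) (rot U) (rot V)"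
      unfolding bmat_f_map_inverse[OF L]
      by (rule eq_matI) (auto simp: bmat_index N1_def N2_def algebra_simps)
    finally show ?thesis .
  qed
  ultimately show ?thesis by simp
qed

lemma det_bmat_f_map':
  assumes L: "L \<in> carrier_mat (n + n) (n + n)" "det L \<noteq> 0"
  shows "det (bmat n (f_map n L) U V) = det (bmat n L (perp U) (perp V)) / det L"
  using det_bmat_f_map[OF L, of "perp U" "perp V"] L(2) by (simp add: field_simps)

definition scal :: "complex \<Rightarrow> complex \<times> complex \<Rightarrow> complex \<times> complex" where
  "scal c U = (c * fst U, c * snd U)"

lemma bmat_scal: "bmat n L (scal c U) (scal d V) = (c * d) \<cdot>\<^sub>m bmat n L U V"
  by (rule eq_matI) (auto simp: bmat_index scal_def algebra_simps)

lemma det_bmat_scal: "det (bmat n L (scal c U) (scal d V)) = (c * d) ^ n * det (bmat n L U V)"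
  by (simp add: bmat_scal)

text \<open>\<open>hom\<close> picks a normalised representative, hence agreement with
  \<open>rot\<close> only up to a factor.\<close>

lemma hom_neg_inv:
  obtains c where "c \<noteq> 0" "hom (neg_inv q) = scal c (rot (hom q))"
proof (cases q)
  case (Aff z)
  show ?thesis
  proof (cases "z = 0")
    case True
    with Aff show ?thesis by (intro that[of "-1"]) (auto simp: scal_def rot_def)
  next
    case False
    with Aff show ?thesis by (intro that[of "inverse z"]) (auto simp: scal_def rot_def)
  qed
next
  case Inf_pt
  then show ?thesis by (intro that[of 1]) (auto simp: scal_def rot_def)
qed

lemma neg_inv_neg_inv [simp]: "neg_inv (neg_inv q) = q"
  by (cases q) auto

lemma neg_inv2_neg_inv2 [simp]: "neg_inv2 (neg_inv2 p) = p"
  by (simp add: neg_inv2_def prod_eq_iff)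

lemma fst_neg_inv2 [simp]: "fst (neg_inv2 p) = neg_inv (fst p)"
  and snd_neg_inv2 [simp]: "snd (neg_inv2 p) = neg_inv (snd p)"
  by (simp_all add: neg_inv2_def)

lemma vacuum_curve_iff:
  "L \<in> carrier_mat (n + n) (n + n) \<Longrightarrow>
    p \<in> vacuum_curve n L \<longleftrightarrow> det (bmat n L (hom (fst p)) (hom (snd p))) = 0"
  by (simp add: vacuum_curve_def vacuum_form_bmat)

lemma neg_inv2_in_curve_f_map:
  assumes L: "L \<in> carrier_mat (n + n) (n + n)" "det L \<noteq> 0"
  shows "neg_inv2 p \<in> vacuum_curve n (f_map n L) \<longleftrightarrow> p \<in> vacuum_curve n L"
proof -
  obtain c where c: "c \<noteq> 0" "hom (neg_inv (fst p)) = scal c (rot (hom (fst p)))" by (rule hom_neg_inv)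
  obtain d where d: "d \<noteq> 0" "hom (neg_inv (snd p)) = scal d (rot (hom (snd p)))" by (rule hom_neg_inv)
  show ?thesis
    using det_bmat_f_map[OF L, of "hom (fst p)" "hom (snd p)"] c d L(2)
    by (auto simp: vacuum_curve_iff[OF L(1)] vacuum_curve_iff[OF f_map_carrier[OF L]] det_bmat_scal)
qed

lemma vacuum_curve_f_map:
  assumes L: "L \<in> carrier_mat (n + n) (n + n)" "det L \<noteq> 0"
  shows "vacuum_curve n (f_map n L) = {p. neg_inv2 p \<in> vacuum_curve n L}"
  using neg_inv2_in_curve_f_map[OF L, of "neg_inv2 p" for p] by auto

lemma vacuum_poly_bmat:
  assumes "L \<in> carrier_mat (n + n) (n + n)"
  shows "vacuum_poly n L u v = det (bmat n L (u, 1) (v, 1))"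
proof -
  obtain A B C D where s: "split_block L n n = (A, B, C, D)" by (metis prod_cases4)
  have "1 \<cdot>\<^sub>m B = B" by (intro eq_matI) auto
  then have "vacuum_poly n L u v = vacuum_form n L (u, 1) (v, 1)"
    by (simp add: vacuum_poly_def vacuum_form_def s)
  then show ?thesis using vacuum_form_bmat[OF assms] by simp
qed

lemma vacuum_poly_f_map:
  assumes L: "L \<in> carrier_mat (n + n) (n + n)" "det L \<noteq> 0" and uv: "u \<noteq> 0" "v \<noteq> 0"
  shows "vacuum_poly n (f_map n L) u v =
    inverse (det L) * (u ^ n * v ^ n * vacuum_poly n L (- inverse u) (- inverse v))"
proof -
  have "perp (u, 1) = scal (- u) (- inverse u, 1)" "perp (v, 1) = scal (- v) (- inverse v, 1)"
    using uv by (auto simp: perp_def scal_def)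
  then have "det (bmat n L (perp (u, 1)) (perp (v, 1))) =
      (u * v) ^ n * det (bmat n L (- inverse u, 1) (- inverse v, 1))"
    by (simp only: det_bmat_scal) simp
  then show ?thesis
    by (simp add: vacuum_poly_bmat[OF L(1)] vacuum_poly_bmat[OF f_map_carrier[OF L]]
      det_bmat_f_map'[OF L] power_mult_distrib divide_inverse mult_ac)
qed

lemma perp_line: "perp (line U E s) = line (perp U) (perp E) s"
  by (simp add: perp_def line_def)

text \<open>Up to division by \<open>det L\<close>, the determinant for \<open>f L\<close> is the
  one for \<open>L\<close> after the substitution \<open>perp\<close> in both arguments. As
  \<open>perp\<close> is linear and invertible, it carries lines to lines and every direction is
  reached.\<close>

lemma form_smooth_f_map:
  assumes L: "L \<in> carrier_mat (n + n) (n + n)" "det L \<noteq> 0" and s: "form_smooth n L"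
  shows "form_smooth n (f_map n L)"
  unfolding form_smooth_def
proof (intro allI impI)
  have dq: "deriv (\<lambda>s. f s / c) x = 0 \<Longrightarrow> c \<noteq> 0 \<Longrightarrow> f field_differentiable (at x) \<Longrightarrow> deriv f x = 0"
    for f :: "complex \<Rightarrow> complex" and c x
    by (simp add: deriv_cdivide_right)
  have fd: "(\<lambda>s. det (bmat n L (line U E s) V)) field_differentiable (at 0)"
    "(\<lambda>s. det (bmat n L V (line U E s))) field_differentiable (at 0)" for U E V
    by (rule det_closed[where Q = "\<lambda>f. f field_differentiable (at 0)" and k = n];
        auto simp: bmat_index line_def intro!: derivative_intros)+
  fix U V assume UV: "U \<noteq> (0, 0)" "V \<noteq> (0, 0)" "det (bmat n (f_map n L) U V) = 0"
  then have "det (bmat n L (perp U) (perp V)) = 0"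
    using L(2) by (simp add: det_bmat_f_map'[OF L])
  then consider E where "deriv (\<lambda>s. det (bmat n L (line (perp U) E s) (perp V))) 0 \<noteq> 0"
    | E where "deriv (\<lambda>s. det (bmat n L (perp U) (line (perp V) E s))) 0 \<noteq> 0"
    using s perp_nonzero UV(1,2) unfolding form_smooth_def by blast
  then show "(\<exists>E. deriv (\<lambda>s. det (bmat n (f_map n L) (line U E s) V)) 0 \<noteq> 0) \<or>
     (\<exists>E. deriv (\<lambda>s. det (bmat n (f_map n L) U (line V E s))) 0 \<noteq> 0)"
  proof cases
    case 1
    then have "deriv (\<lambda>s. det (bmat n (f_map n L) (line U (rot E) s) V)) 0 \<noteq> 0"
      unfolding det_bmat_f_map'[OF L] perp_line perp_rot using dq[OF _ L(2) fd(1)] by blast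
    then show ?thesis by blast
  next
    case 2
    then have "deriv (\<lambda>s. det (bmat n (f_map n L) U (line V (rot E) s))) 0 \<noteq> 0"
      unfolding det_bmat_f_map'[OF L] perp_line perp_rot using dq[OF _ L(2) fd(2)] by blast
    then show ?thesis by blast
  qed
qed

lemma vacuum_pair_swap:
  assumes L: "L \<in> carrier_mat (n + n) (n + n)" "det L \<noteq> 0"
  shows "vacuum_pair n L p X Y \<longleftrightarrow> vacuum_pair n (the (mat_inverse L)) (prod.swap p) Y X"
proof -
  note Li = inverse_mat[OF L]
  have "L *\<^sub>v a = b \<longleftrightarrow> the (mat_inverse L) *\<^sub>v b = a"
    if "a \<in> carrier_vec (n + n)" "b \<in> carrier_vec (n + n)" for a b
    using that Li L(1) by (metis assoc_mult_mat_vec one_mult_mat_vec)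
  then show ?thesis unfolding vacuum_pair_def by auto
qed

text \<open>A covacuum vector of \<open>L\<close> is a vacuum vector of the inverse, with the two
  coordinates of the point exchanged.\<close>

lemma is_covacuum_iff:
  assumes L: "L \<in> carrier_mat (n + n) (n + n)" "det L \<noteq> 0"
  shows "is_covacuum n L p Y \<longleftrightarrow> Y \<in> carrier_vec n \<and> Y \<noteq> 0\<^sub>v n \<and>
    bmat n (the (mat_inverse L)) (hom (snd p)) (hom (fst p)) *\<^sub>v Y = 0\<^sub>v n"
proof -
  note Li = inverse_mat[OF L]
  have "det L * det (the (mat_inverse L)) = 1"
    using det_mult[OF L(1) Li(1)] Li(2) by simp
  then have d: "det (the (mat_inverse L)) \<noteq> 0" by auto
  have "is_covacuum n L p Y \<longleftrightarrow> is_vacuum n (the (mat_inverse L)) (prod.swap p) Y"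
    unfolding is_covacuum_def is_vacuum_def using vacuum_pair_swap[OF L] by blast
  then show ?thesis using is_vacuum_iff[OF Li(1) d] by simp
qed

text \<open>Both notions are kernels of matrices that differ by a non-zero scalar, composed of the
  sign of \<open>bmat_f_map_inverse\<close> and the factors relating \<open>hom\<close> to
  \<open>rot\<close>.\<close>

lemma is_vacuum_f_map:
  assumes L: "L \<in> carrier_mat (n + n) (n + n)" "det L \<noteq> 0" "det (f_map n L) \<noteq> 0"
  shows "is_vacuum n (f_map n L) (neg_inv2 p) Y \<longleftrightarrow> is_covacuum n L p Y"
proof -
  obtain c where c: "c \<noteq> 0" "hom (neg_inv (fst p)) = scal c (rot (hom (fst p)))" by (rule hom_neg_inv)
  obtain d where d: "d \<noteq> 0" "hom (neg_inv (snd p)) = scal d (rot (hom (snd p)))" by (rule hom_neg_inv)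
  let ?B = "bmat n (the (mat_inverse L)) (hom (snd p)) (hom (fst p))"
  have "bmat n (f_map n L) (hom (neg_inv (fst p))) (hom (neg_inv (snd p))) *\<^sub>v Y = (- c * d) \<cdot>\<^sub>v (?B *\<^sub>v Y)"
    if Y: "Y \<in> carrier_vec n"
  proof -
    have "bmat n (f_map n L) (hom (neg_inv (fst p))) (hom (neg_inv (snd p))) = (- c * d) \<cdot>\<^sub>m ?B"
      unfolding c d bmat_scal bmat_f_map_inverse[OF L(1,2)] by (intro eq_matI) auto
    then show ?thesis using smult_mat_mult_vec[OF bmat_carrier Y] by metis
  qed
  moreover have "(- c * d) \<cdot>\<^sub>v y = 0\<^sub>v n \<longleftrightarrow> y = 0\<^sub>v n" if "y \<in> carrier_vec n" for y :: "complex vec"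
  proof
    assume *: "(- c * d) \<cdot>\<^sub>v y = 0\<^sub>v n"
    show "y = 0\<^sub>v n"
    proof (rule eq_vecI)
      fix k assume "k < dim_vec (0\<^sub>v n :: complex vec)"
      then have "((- c * d) \<cdot>\<^sub>v y) $ k = 0" "k < n" using * by auto
      then show "y $ k = 0\<^sub>v n $ k" using that c d by auto
    qed (use that in auto)
  qed auto
  ultimately show ?thesis
    unfolding is_covacuum_iff[OF L(1,2)] is_vacuum_iff[OF f_map_carrier[OF L(1,2)] L(3)] fst_neg_inv2 snd_neg_inv2
    by (metis bmat_carrier mult_mat_vec_carrier)
qed

section \<open>Thinness of the remaining exclusions\<close>

lemma poly_fun_det_mat:
  assumes "\<And>i j. i < k \<Longrightarrow> j < k \<Longrightarrow> poly_fun m (f i j)"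
  shows "poly_fun m (\<lambda>M. det (mat k k (\<lambda>(i, j). f i j M)))"
  using assms by (intro poly_fun_det[where k = k]) auto

lemma det_one_smult: "det (c \<cdot>\<^sub>m 1\<^sub>m n :: complex mat) = c ^ n"
  by simp

text \<open>The identity matrix is a witness: there \<open>bmat\<close> is a non-zero scalar matrix.
  The two instances needed are the invertibility of the blocks \<open>A\<close> and
  \<open>D\<close>.\<close>

lemma thin_det_bmat:
  assumes "snd V * fst U = 1 \<and> fst V * snd U = 0 \<or> snd V * fst U = 0 \<and> fst V * snd U = 1"
  shows "thin (n + n) {L. det (bmat n L U V) = 0}"
proof (rule thin_zeros[where M = "1\<^sub>m (n + n)"])
  have "poly_fun (n + n) (\<lambda>L. bmat n L U V $$ (i, j))" if "i < n" "j < n" for i j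
    unfolding bmat_def using that
    by (auto intro!: poly_fun_sum poly_fun.mult poly_fun.const poly_fun.entry block_index)
  then show "poly_fun (n + n) (\<lambda>L. det (bmat n L U V))" by (intro poly_fun_det[where k = n]) auto
  obtain c :: complex where c: "c \<noteq> 0" "c = snd V * fst U - fst V * snd U" using assms by fastforce
  have "bmat n (1\<^sub>m (n + n)) U V = c \<cdot>\<^sub>m 1\<^sub>m n"
    by (rule eq_matI) (auto simp: bmat_index c(2))
  then have "det (bmat n (1\<^sub>m (n + n)) U V) = c ^ n" using det_one_smult by metis
  then show "det (bmat n (1\<^sub>m (n + n)) U V) \<noteq> 0" using c(1) by simp
qed simp

lemma thin_det: "thin m {L. det L = 0}"
proof -
  \<comment> \<open>A polynomial function is total on matrices of every size, so the determinant is
    taken of a copy that always has size m; on m x m matrices the copy changes nothing.\<close>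
  let ?N = "\<lambda>L. mat m m (\<lambda>(i, j). L $$ (i, j))"
  have "poly_fun m (\<lambda>L. det (?N L))"
    by (rule poly_fun_det_mat) (rule poly_fun.entry)
  moreover have e: "?N L = L" if "L \<in> carrier_mat m m" for L :: "complex mat"
    using that by (intro eq_matI) auto
  ultimately show ?thesis
    unfolding thin_def by (intro exI[of _ "\<lambda>L. det (?N L)"] conjI bexI[of _ "1\<^sub>m m"]) auto
qed

text \<open>Since \<open>adj_mat L\<close> is \<open>det L\<close> times the inverse, its block
  transpose is a non-zero multiple of \<open>f L\<close>. This makes invertibility of
  \<open>f L\<close> a condition polynomial in the entries of \<open>L\<close>.\<close>

lemma det_f_map:
  assumes L: "L \<in> carrier_mat (n + n) (n + n)" "det L \<noteq> 0"
    and a: "det (block_transpose n (adj_mat L)) \<noteq> 0"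
  shows "det (f_map n L) \<noteq> 0"
proof -
  let ?Li = "the (mat_inverse L)"
  note Li = inverse_mat[OF L] and adj = adj_mat[OF L(1)]
  have "adj_mat L = (?Li * L) * adj_mat L" using Li adj by simp
  also have "\<dots> = ?Li * (L * adj_mat L)" using Li adj L by (metis assoc_mult_mat)
  also have "\<dots> = det L \<cdot>\<^sub>m ?Li" using Li(1) adj by (simp add: mult_smult_one)
  finally have e: "adj_mat L = det L \<cdot>\<^sub>m ?Li" .
  have ei: "adj_mat L $$ (r, t) = det L * ?Li $$ (r, t)" if "r < n + n" "t < n + n" for r t
    using that Li(1) by (simp add: e)
  have "block_transpose n (adj_mat L) = det L \<cdot>\<^sub>m f_map n L"
  proof (rule eq_matI)
    note fc = f_map_carrier[OF L]
    fix r t assume "r < dim_row (det L \<cdot>\<^sub>m f_map n L)" "t < dim_col (det L \<cdot>\<^sub>m f_map n L)"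
    then have rt: "r < n + n" "t < n + n" using fc by auto
    have sp: "\<exists>k<n. r = k \<or> r = n + k" if "r < n + n" for r
      using that by (metis add_less_cancel_left le_Suc_ex not_less)
    obtain k l where "k < n" "l < n" "r = k \<or> r = n + k" "t = l \<or> t = n + l" using sp rt by metis
    then show "block_transpose n (adj_mat L) $$ (r, t) = (det L \<cdot>\<^sub>m f_map n L) $$ (r, t)"
      using fc Li(1) unfolding f_map_def
      by (elim disjE) (simp_all add: block_transpose_index[OF adj(1)] block_transpose_index[OF Li(1)] ei)
  qed (use f_map_carrier[OF L] block_transpose_carrier[OF adj(1)] in auto)
  then show ?thesis using a by auto
qed

text \<open>The identity matrix is fixed by the adjugate and by block transposition, so the
  polynomial has value 1 there.\<close>

lemma thin_det_block_transpose_adj: "thin (n + n) {L. det (block_transpose n (adj_mat L)) = 0}"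
proof -
  let ?m = "n + n"
  define N where "N L = mat ?m ?m (\<lambda>(i, j). L $$ (i, j))" for L :: "complex mat"
  have N: "N L \<in> carrier_mat ?m ?m" for L by (simp add: N_def)
  have adj: "poly_fun ?m (\<lambda>L. adj_mat (N L) $$ (i, j))" if "i < ?m" "j < ?m" for i j
    by (rule cofactor_closed[where Q = "poly_fun ?m" and n = ?m, OF _ _ _ _ N])
       (use that in \<open>auto simp: N_def intro: poly_fun.intros\<close>)
  have Nc: "adj_mat (N L) \<in> carrier_mat ?m ?m" for L by (rule adj_mat(1)[OF N])
  have "poly_fun ?m (\<lambda>L. det (block_transpose n (adj_mat (N L))))"
  proof (rule poly_fun_det[where k = ?m])
    show "block_transpose n (adj_mat (N L)) \<in> carrier_mat ?m ?m" for L
      by (rule block_transpose_carrier[OF Nc])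
    fix r t assume rt: "r < ?m" "t < ?m"
    have sp: "\<exists>k<n. r = k \<or> r = n + k" if "r < n + n" for r
      using that by (metis add_less_cancel_left le_Suc_ex not_less)
    obtain k l where "k < n" "l < n" "r = k \<or> r = n + k" "t = l \<or> t = n + l" using sp rt by metis
    then show "poly_fun ?m (\<lambda>L. block_transpose n (adj_mat (N L)) $$ (r, t))"
      by (elim disjE) (simp_all add: block_transpose_index[OF Nc] adj)
  qed
  moreover have e: "N L = L" if "L \<in> carrier_mat ?m ?m" for L :: "complex mat"
    using that by (intro eq_matI) (auto simp: N_def)
  moreover have "det (block_transpose n (adj_mat (1\<^sub>m ?m :: complex mat))) \<noteq> 0"
  proof -
    have c: "adj_mat (1\<^sub>m ?m) \<in> carrier_mat ?m ?m" by (rule adj_mat) simp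
    have "adj_mat (1\<^sub>m ?m) = (1\<^sub>m ?m :: complex mat)"
    proof -
      have "adj_mat (1\<^sub>m ?m) = 1\<^sub>m ?m * (adj_mat (1\<^sub>m ?m) :: complex mat)"
        by (rule left_mult_one_mat[OF c, symmetric])
      also have "\<dots> = det (1\<^sub>m ?m) \<cdot>\<^sub>m 1\<^sub>m ?m" by (rule adj_mat) simp
      also have "\<dots> = 1\<^sub>m ?m" by (rule eq_matI) auto
      finally show ?thesis .
    qed
    moreover have "block_transpose n (1\<^sub>m ?m :: complex mat) = 1\<^sub>m ?m"
    proof (rule eq_matI)
      note oc = one_carrier_mat[of ?m]
      fix r t assume "r < dim_row (1\<^sub>m ?m :: complex mat)" "t < dim_col (1\<^sub>m ?m :: complex mat)"
      then have rt: "r < n + n" "t < n + n" by auto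
      have sp: "\<exists>k<n. r = k \<or> r = n + k" if "r < n + n" for r
        using that by (metis add_less_cancel_left le_Suc_ex not_less)
      obtain k l where "k < n" "l < n" "r = k \<or> r = n + k" "t = l \<or> t = n + l" using sp rt by metis
      then show "block_transpose n (1\<^sub>m ?m :: complex mat) $$ (r, t) = 1\<^sub>m ?m $$ (r, t)"
        by (elim disjE) (simp_all add: block_transpose_index[OF oc])
    qed (use block_transpose_carrier[OF one_carrier_mat[of ?m]] in auto)
    ultimately show ?thesis by simp
  qed
  ultimately show ?thesis
    unfolding thin_def
    by (intro exI[of _ "\<lambda>L. det (block_transpose n (adj_mat (N L)))"] conjI bexI[of _ "1\<^sub>m ?m"]) auto
qed

section \<open>Local parameters of the curve\<close>

lemma poly_in_continuous:
  assumes "poly_in B f" "\<And>b. b \<in> B \<Longrightarrow> continuous_on S b"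
  shows "continuous_on S f"
  using assms by (induction rule: poly_in.induct) (auto intro: continuous_intros)

lemma poly_in_analytic:
  assumes "poly_in B f" "\<And>b. b \<in> B \<Longrightarrow> (\<lambda>t. b (c t)) analytic_on S"
  shows "(\<lambda>t. f (c t)) analytic_on S"
  using assms by (induction rule: poly_in.induct) (auto intro: analytic_intros)

abbreviation poly2 :: "(complex \<times> complex \<Rightarrow> complex) \<Rightarrow> bool" where
  "poly2 \<equiv> poly_in {fst, snd}"

lemma poly2_continuous: "poly2 f \<Longrightarrow> continuous_on S f"
  by (rule poly_in_continuous) (auto intro: continuous_intros)

lemma poly2_analytic:
  "poly2 f \<Longrightarrow> a analytic_on S \<Longrightarrow> b analytic_on S \<Longrightarrow> (\<lambda>t. f (a t, b t)) analytic_on S"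
  by (rule poly_in_analytic[where c = "\<lambda>t. (a t, b t)"]) auto

text \<open>The partial derivatives are again polynomials, which supplies the continuity required by
  the inverse function theorem.\<close>

lemma poly2_has_derivative:
  assumes "poly2 f"
  obtains fa fb where "poly2 fa" "poly2 fb"
    "\<And>z. (f has_derivative (\<lambda>h. fa z * fst h + fb z * snd h)) (at z)"
proof -
  from assms have "\<exists>fa fb. poly2 fa \<and> poly2 fb \<and>
    (\<forall>z. (f has_derivative (\<lambda>h. fa z * fst h + fb z * snd h)) (at z))"
  proof (induction rule: poly_in.induct)
    case (const c)
    show ?case
      by (intro exI[of _ "\<lambda>_. 0"]) (auto intro: poly_in.const)
  next
    case (base b)
    then consider "b = fst" | "b = snd" by blast
    then show ?case
    proof cases
      case 1
      then show ?thesis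
        by (intro exI[of _ "\<lambda>_. 1"] exI[of _ "\<lambda>_. 0"]) (auto intro!: poly_in.const derivative_eq_intros)
    next
      case 2
      then show ?thesis
        by (intro exI[of _ "\<lambda>_. 0"] exI[of _ "\<lambda>_. 1"]) (auto intro!: poly_in.const derivative_eq_intros)
    qed
  next
    case (add f g)
    then obtain fa fb ga gb where *: "poly2 fa" "poly2 fb" "poly2 ga" "poly2 gb"
      "\<And>z. (f has_derivative (\<lambda>h. fa z * fst h + fb z * snd h)) (at z)"
      "\<And>z. (g has_derivative (\<lambda>h. ga z * fst h + gb z * snd h)) (at z)" by blast
    show ?case
    proof (intro exI conjI allI)
      show "poly2 (\<lambda>z. fa z + ga z)" "poly2 (\<lambda>z. fb z + gb z)" using * by (auto intro: poly_in.add)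
      fix z
      show "((\<lambda>x. f x + g x) has_derivative (\<lambda>h. (fa z + ga z) * fst h + (fb z + gb z) * snd h)) (at z)"
        by (rule has_derivative_eq_rhs[OF has_derivative_add[OF *(5,6)]]) (auto simp: algebra_simps)
    qed
  next
    case (mult f g)
    then obtain fa fb ga gb where *: "poly2 fa" "poly2 fb" "poly2 ga" "poly2 gb"
      "\<And>z. (f has_derivative (\<lambda>h. fa z * fst h + fb z * snd h)) (at z)"
      "\<And>z. (g has_derivative (\<lambda>h. ga z * fst h + gb z * snd h)) (at z)" by blast
    show ?case
    proof (intro exI conjI allI)
      show "poly2 (\<lambda>z. f z * ga z + fa z * g z)" "poly2 (\<lambda>z. f z * gb z + fb z * g z)"
        using * mult(1,2) by (auto intro: poly_in.add poly_in.mult)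
      fix z
      show "((\<lambda>x. f x * g x) has_derivative
          (\<lambda>h. (f z * ga z + fa z * g z) * fst h + (f z * gb z + fb z * g z) * snd h)) (at z)"
        by (rule has_derivative_eq_rhs[OF has_derivative_mult[OF *(5,6)]]) (auto simp: algebra_simps)
    qed
  qed
  then show ?thesis using that by blast
qed

text \<open>The real inverse function theorem is applied to \<open>F (x, y) = (x, f (x, y))\<close>,
  and the inverse is restricted to the zero fibre. Injectivity of \<open>F\<close> on
  \<open>W\<close> yields the converse, that all zeros in \<open>W\<close> lie on the graph.\<close>

lemma implicit_function:
  assumes f: "poly2 f" "f (0, 0) = 0" and nz: "deriv (\<lambda>t. f (0, t)) 0 \<noteq> 0"
  obtains \<beta> W where "\<beta> analytic_on {0}" "\<beta> 0 = 0" "\<forall>\<^sub>F x in nhds 0. f (x, \<beta> x) = 0"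
    "open W" "(0, 0) \<in> W" "\<And>x y. (x, y) \<in> W \<Longrightarrow> f (x, y) = 0 \<Longrightarrow> y = \<beta> x"
proof -
  obtain fa fb where d: "poly2 fa" "poly2 fb"
    "\<And>z. (f has_derivative (\<lambda>h. fa z * fst h + fb z * snd h)) (at z)"
    by (rule poly2_has_derivative[OF f(1)]) auto
  have "((\<lambda>t. (0::complex, t)) has_derivative (\<lambda>h. (0, h))) (at (0::complex))"
    by (auto intro!: derivative_eq_intros)
  then have "((\<lambda>t. f (0, t)) has_derivative (\<lambda>h. fa (0, 0) * fst (0, h) + fb (0, 0) * snd (0, h))) (at (0::complex))"
    using has_derivative_compose[where f = "\<lambda>t. (0::complex, t::complex)" and g = f and x = 0 and s = UNIV] d(3)[of "(0, 0)"]
    by fastforce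
  then have "((\<lambda>t. f (0, t)) has_field_derivative fb (0, 0)) (at 0)"
    by (simp add: has_field_derivative_def)
  then have fb0: "fb (0, 0) \<noteq> 0" using nz DERIV_imp_deriv by metis
  define F where "F z = (fst z, f z)" for z :: "complex \<times> complex"
  define F' where "F' z = Blinfun (\<lambda>h. (fst h, fa z * fst h + fb z * snd h))" for z :: "complex \<times> complex"
  have F': "blinfun_apply (F' z) = (\<lambda>h. (fst h, fa z * fst h + fb z * snd h))" for z
    unfolding F'_def
    by (intro bounded_linear_Blinfun_apply bounded_linear_Pair bounded_linear_add
        bounded_linear_fst bounded_linear_snd bounded_linear_const_mult)
  \<comment> \<open>The inverse of the derivative of \<open>F\<close> at the origin, found by
    solving its triangular system; \<open>fb (0, 0)\<close> is non-zero.\<close>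
  define G where "G = Blinfun (\<lambda>h::complex \<times> complex. (fst h, (1 / fb (0, 0)) * (snd h + (- fa (0, 0)) * fst h)))"
  have G: "blinfun_apply G = (\<lambda>h. (fst h, (1 / fb (0, 0)) * (snd h + (- fa (0, 0)) * fst h)))"
    unfolding G_def
    by (intro bounded_linear_Blinfun_apply bounded_linear_Pair bounded_linear_add
        bounded_linear_fst bounded_linear_snd bounded_linear_const_mult)
  have GF: "G o\<^sub>L F' (0, 0) = id_blinfun"
    by (rule blinfun_eqI) (use fb0 in \<open>auto simp: G F'\<close>)
  have dF: "(F has_derivative blinfun_apply (F' z)) (at z)" for z
    unfolding F_def F' by (intro derivative_intros d(3))
  have cF: "continuous_on UNIV F'"
  proof (rule continuous_on_blinfun_componentwise)
    fix i :: "complex \<times> complex"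
    show "continuous_on UNIV (\<lambda>z. blinfun_apply (F' z) i)"
      unfolding F' by (intro continuous_intros poly2_continuous[OF d(1)] poly2_continuous[OF d(2)])
  qed
  obtain U' V g g' where U': "open U'" "(0, 0) \<in> U'" "open V" "F (0, 0) \<in> V" "homeomorphism U' V F g"
    and dg: "\<And>y. y \<in> V \<Longrightarrow> (g has_derivative (g' y)) (at y)"
      "\<And>y. y \<in> V \<Longrightarrow> g' y = inv_into UNIV (blinfun_apply (F' (g y)))"
      "\<And>y. y \<in> V \<Longrightarrow> bij (blinfun_apply (F' (g y)))"
    by (rule inverse_function_theorem[OF open_UNIV dF cF UNIV_I GF]) auto
  have Fg: "F (g y) = y" "g y \<in> U'" if "y \<in> V" for y
    using U'(5) that by (auto simp: homeomorphism_def)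
  have gF: "g (F z) = z" "F z \<in> V" if "z \<in> U'" for z
    using U'(5) that by (auto simp: homeomorphism_def)
  define \<beta> where "\<beta> x = snd (g (x, 0))" for x
  define V0 where "V0 = (\<lambda>x. (x, 0::complex)) -` V"
  have V0: "open V0" "0 \<in> V0"
    using U'(3,4) f(2) by (auto simp: V0_def F_def intro!: continuous_open_vimage continuous_intros)
  have "\<beta> field_differentiable (at x)" if x: "x \<in> V0" for x
  proof -
    have xV: "(x, 0) \<in> V" using x by (simp add: V0_def)
    let ?z = "g (x, 0)"
    have b: "bij (blinfun_apply (F' ?z))" by (rule dg(3)[OF xV])
    have "fb ?z \<noteq> 0"
    proof
      assume "fb ?z = 0"
      then have "blinfun_apply (F' ?z) (0, 1) = blinfun_apply (F' ?z) (0, 0)" by (simp add: F')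
      then have "(0 :: complex, 1 :: complex) = (0, 0)" by (rule injD[OF bij_is_inj[OF b]])
      then show False by simp
    qed
    \<comment> \<open>The derivative of the inverse solves \<open>fa h + fb k = 0\<close>, so it is
      complex linear in \<open>h\<close> and the real derivative is a complex one.\<close>
    have k: "snd (g' (x, 0) (h, 0)) = (- fa ?z / fb ?z) * h" for h
    proof -
      have "blinfun_apply (F' ?z) (g' (x, 0) (h, 0)) = (h, 0)"
        unfolding dg(2)[OF xV] using b by (simp add: bij_is_surj surj_f_inv_f)
      then have "fst (g' (x, 0) (h, 0)) = h" "fa ?z * h + fb ?z * snd (g' (x, 0) (h, 0)) = 0"
        by (auto simp: F')
      then show ?thesis using \<open>fb ?z \<noteq> 0\<close> by (simp add: field_simps eq_neg_iff_add_eq_0)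
    qed
    have "((\<lambda>x. g (x, 0)) has_derivative (\<lambda>h. g' (x, 0) (h, 0))) (at x)"
    proof -
      have "((\<lambda>x. (x, 0::complex)) has_derivative (\<lambda>h. (h, 0))) (at x)"
        by (auto intro!: derivative_eq_intros)
      then show ?thesis
        using has_derivative_compose[where f = "\<lambda>x. (x, 0::complex)" and f' = "\<lambda>h. (h, 0)" and x = x
            and s = UNIV and g = g and g' = "g' (x, 0)"] dg(1)[OF xV] by simp
    qed
    then have "(\<beta> has_derivative (\<lambda>h. snd (g' (x, 0) (h, 0)))) (at x)"
      unfolding \<beta>_def by (rule has_derivative_snd)
    then have "(\<beta> has_field_derivative (- fa ?z / fb ?z)) (at x)"
      by (simp only: has_field_derivative_def k)
    then show ?thesis by (auto simp: field_differentiable_def)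
  qed
  then have "\<beta> holomorphic_on V0"
    by (auto simp: holomorphic_on_def intro: field_differentiable_at_within)
  then have 1: "\<beta> analytic_on {0}" using V0 analytic_at by blast
  have "f (x, \<beta> x) = 0" if "x \<in> V0" for x
  proof -
    have "(x, 0) \<in> V" using that by (simp add: V0_def)
    then have "F (g (x, 0)) = (x, 0)" by (rule Fg)
    then have *: "fst (g (x, 0)) = x" "f (g (x, 0)) = 0" by (auto simp: F_def)
    then have "g (x, 0) = (x, \<beta> x)" by (simp add: prod_eq_iff \<beta>_def)
    then show ?thesis using *(2) by simp
  qed
  then have 2: "\<forall>\<^sub>F x in nhds 0. f (x, \<beta> x) = 0"
    using V0 eventually_nhds by blast
  have 3: "y = \<beta> x" if "(x, y) \<in> U'" "f (x, y) = 0" for x y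
    using gF(1)[OF that(1)] that(2) by (simp add: F_def \<beta>_def)
  have "\<beta> 0 = 0" using 3[of 0 0] U'(2) f(2) by simp
  then show ?thesis using that[OF 1 _ 2 U'(1,2) 3] by blast
qed

text \<open>Near a smooth point, one of the two coordinates is a parameter of the curve \<open>f = 0\<close>.\<close>
lemma local_curve:
  assumes f: "poly2 f" "f (0, 0) = 0"
    and nz: "deriv (\<lambda>s. f (s, 0)) 0 \<noteq> 0 \<or> deriv (\<lambda>t. f (0, t)) 0 \<noteq> 0"
  obtains a b W \<pi> where "a analytic_on {0}" "b analytic_on {0}" "a 0 = 0" "b 0 = 0"
    "deriv a 0 \<noteq> 0 \<or> deriv b 0 \<noteq> 0" "\<forall>\<^sub>F t in nhds 0. f (a t, b t) = 0"
    "open W" "(0, 0) \<in> W" "\<pi> \<in> {fst, snd}" "\<And>t. \<pi> (a t, b t) = t"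
    "\<And>z. z \<in> W \<Longrightarrow> f z = 0 \<Longrightarrow> z = (a (\<pi> z), b (\<pi> z))"
proof (cases "deriv (\<lambda>t. f (0, t)) 0 \<noteq> 0")
  case True
  obtain \<beta> W where "\<beta> analytic_on {0}" "\<beta> 0 = 0" "\<forall>\<^sub>F x in nhds 0. f (x, \<beta> x) = 0"
    "open W" "(0, 0) \<in> W" "\<And>x y. (x, y) \<in> W \<Longrightarrow> f (x, y) = 0 \<Longrightarrow> y = \<beta> x"
    by (rule implicit_function[OF f True]) blast
  then show ?thesis
    by (intro that[of "\<lambda>t. t" \<beta> W fst]) (auto simp: prod_eq_iff)
next
  case False
  define h where "h z = f (prod.swap z)" for z
  have h: "poly2 h" unfolding h_def
    by (rule poly_in_subst[OF f(1)]) (auto intro: poly_in.base)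
  have h0: "h (0, 0) = 0" "deriv (\<lambda>t. h (0, t)) 0 \<noteq> 0" using False nz f(2) by (auto simp: h_def)
  obtain \<beta> W where W: "\<beta> analytic_on {0}" "\<beta> 0 = 0" "\<forall>\<^sub>F x in nhds 0. h (x, \<beta> x) = 0"
    "open W" "(0, 0) \<in> W" "\<And>x y. (x, y) \<in> W \<Longrightarrow> h (x, y) = 0 \<Longrightarrow> y = \<beta> x"
    by (rule implicit_function[OF h h0]) blast
  have "open (prod.swap -` W)" using W(4) by (intro continuous_open_vimage) (auto intro: continuous_intros)
  then show ?thesis
    using W by (intro that[of \<beta> "\<lambda>t. t" "prod.swap -` W" snd]) (auto simp: prod_eq_iff h_def)
qed

lemma analytic_at_deriv:
  "f analytic_on {z} \<Longrightarrow> (f has_field_derivative deriv f z) (at z)"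
  by (intro field_differentiable_derivI analytic_on_imp_differentiable_at[of f "{z}"]) auto

lemma analytic_tendsto_nhds:
  assumes "f analytic_on {z}"
  shows "(f \<longlongrightarrow> f z) (nhds z)"
  using analytic_at_imp_isCont[OF assms] by (simp add: isCont_def tendsto_at_iff_tendsto_nhds)

text \<open>The change of parameter is the coordinate \<open>\<pi>\<close> along the second
  parametrisation. If its derivative were zero at 0, the chain rule would make the derivatives of
  both \<open>a2\<close> and \<open>b2\<close> vanish.\<close>

lemma local_curve_reparam:
  assumes a: "a analytic_on {0}" "b analytic_on {0}"
    and W: "open W" "(0, 0) \<in> W" "\<pi> \<in> {fst, snd}"
      "\<And>z. z \<in> W \<Longrightarrow> f z = 0 \<Longrightarrow> z = (a (\<pi> z), b (\<pi> z))"
    and a2: "a2 analytic_on {0}" "b2 analytic_on {0}" "a2 0 = 0" "b2 0 = (0::complex)"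
      "deriv a2 0 \<noteq> 0 \<or> deriv b2 0 \<noteq> 0" "\<forall>\<^sub>F t in nhds 0. f (a2 t, b2 t) = (0::complex)"
  obtains \<rho> where "\<rho> analytic_on {0}" "\<rho> 0 = 0" "deriv \<rho> 0 \<noteq> 0"
    "\<forall>\<^sub>F t in nhds 0. a2 t = a (\<rho> t) \<and> b2 t = b (\<rho> t)"
proof -
  define \<rho> where "\<rho> t = \<pi> (a2 t, b2 t)" for t
  have "\<rho> = a2 \<or> \<rho> = b2" using W(3) by (auto simp: \<rho>_def fun_eq_iff)
  then have \<rho>: "\<rho> analytic_on {0}" "\<rho> 0 = 0" using a2 by auto
  have "((\<lambda>t. (a2 t, b2 t)) \<longlongrightarrow> (0, 0)) (nhds 0)"
    using tendsto_Pair[OF analytic_tendsto_nhds[OF a2(1)] analytic_tendsto_nhds[OF a2(2)]] a2(3,4) by simp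
  then have "\<forall>\<^sub>F t in nhds 0. (a2 t, b2 t) \<in> W" using W(1,2) topological_tendstoD by blast
  with a2(6) have ev: "\<forall>\<^sub>F t in nhds 0. a2 t = a (\<rho> t) \<and> b2 t = b (\<rho> t)"
    by eventually_elim (use W(4) in \<open>auto simp: \<rho>_def\<close>)
  have "deriv \<rho> 0 \<noteq> 0"
  proof
    assume z: "deriv \<rho> 0 = 0"
    have r: "(\<rho> has_field_derivative 0) (at 0)"
      using analytic_at_deriv[OF \<rho>(1)] z by simp
    have "deriv c2 0 = 0" if c: "c analytic_on {0}" "\<forall>\<^sub>F t in nhds 0. c2 t = c (\<rho> t)" for c c2
    proof -
      have "(c has_field_derivative deriv c (\<rho> 0)) (at (\<rho> 0))"
        using analytic_at_deriv[OF c(1)] \<rho>(2) by simp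
      then have "((\<lambda>t. c (\<rho> t)) has_field_derivative deriv c (\<rho> 0) * 0) (at 0)"
        by (rule DERIV_chain2[OF _ r])
      then have "deriv (\<lambda>t. c (\<rho> t)) 0 = 0" by (simp add: DERIV_imp_deriv)
      moreover have "deriv c2 0 = deriv (\<lambda>t. c (\<rho> t)) 0" by (rule deriv_cong_ev[OF c(2) refl])
      ultimately show ?thesis by simp
    qed
    from this[OF a(1), of a2] this[OF a(2), of b2] ev a2(5) show False
      by (simp add: eventually_conj_iff)
  qed
  then show ?thesis using that \<rho> ev by blast
qed

lemma hom_of_hom:
  assumes "U \<noteq> (0, 0)"
  obtains c where "c \<noteq> 0" "hom (of_hom U) = scal c U"
proof (cases "snd U = 0")
  case True
  with assms show ?thesis by (intro that[of "1 / fst U"]) (auto simp: of_hom_def scal_def prod_eq_iff)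
next
  case False
  then show ?thesis by (intro that[of "1 / snd U"]) (auto simp: of_hom_def scal_def)
qed

lemma chart_hom_nonzero [simp]: "chart_hom q w \<noteq> (0, 0)"
  by (cases q) auto

lemma chart_hom_0 [simp]: "chart_hom q 0 = hom q"
  by (cases q) auto

lemma of_hom_hom [simp]: "of_hom (hom q) = q"
  by (cases q) (auto simp: of_hom_def)

lemma chart_0 [simp]: "chart q 0 = q"
  by (simp add: chart_def)

text \<open>The equation of the curve in the charts centred at \<open>p\<close>, which becomes the
  origin.\<close>

definition curve_fun :: "nat \<Rightarrow> complex mat \<Rightarrow> cp1_sq \<Rightarrow> complex \<times> complex \<Rightarrow> complex" where
  "curve_fun n L p z = det (bmat n L (chart_hom (fst p) (fst z)) (chart_hom (snd p) (snd z)))"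

lemma poly_in_chart_hom:
  assumes "poly_in B c"
  shows "poly_in B (\<lambda>z. fst (chart_hom q (c z)))" "poly_in B (\<lambda>z. snd (chart_hom q (c z)))"
  using assms by (cases q; auto intro: poly_in.const poly_in.add)+

lemma poly2_curve_fun: "poly2 (curve_fun n L p)"
  unfolding curve_fun_def
proof (rule poly_in_det[where k = n])
  fix i j assume "i < n" "j < n"
  moreover have "poly2 fst" "poly2 snd" by (auto intro: poly_in.base)
  ultimately show "poly2 (\<lambda>x. bmat n L (chart_hom (fst p) (fst x)) (chart_hom (snd p) (snd x)) $$ (i, j))"
    by (simp add: bmat_index) (intro poly_in_diff poly_in.add poly_in.mult poly_in.const
      poly_in_chart_hom)
qed simp

lemma det_bmat_of_hom:
  assumes "U \<noteq> (0, 0)" "V \<noteq> (0, 0)"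
  shows "det (bmat n L (hom (of_hom U)) (hom (of_hom V))) = 0 \<longleftrightarrow> det (bmat n L U V) = 0"
proof -
  obtain c where c: "c \<noteq> 0" "hom (of_hom U) = scal c U" using hom_of_hom[OF assms(1)] by blast
  obtain d where d: "d \<noteq> 0" "hom (of_hom V) = scal d V" using hom_of_hom[OF assms(2)] by blast
  show ?thesis using c d by (simp add: det_bmat_scal)
qed

lemma chart_in_curve_iff:
  assumes "L \<in> carrier_mat (n + n) (n + n)"
  shows "(chart (fst p) s, chart (snd p) t) \<in> vacuum_curve n L \<longleftrightarrow> curve_fun n L p (s, t) = 0"
  by (simp add: vacuum_curve_iff[OF assms] chart_def det_bmat_of_hom curve_fun_def)

lemma local_param_iff:
  assumes "L \<in> carrier_mat (n + n) (n + n)"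
  shows "local_param (vacuum_curve n L) p \<phi> \<longleftrightarrow> (\<exists>a b. a analytic_on {0} \<and> b analytic_on {0} \<and>
     a 0 = 0 \<and> b 0 = 0 \<and> (deriv a 0 \<noteq> 0 \<or> deriv b 0 \<noteq> 0) \<and>
     \<phi> = (\<lambda>t. (chart (fst p) (a t), chart (snd p) (b t))) \<and>
     (\<forall>\<^sub>F t in nhds 0. curve_fun n L p (a t, b t) = 0))"
  unfolding local_param_def
  by (intro iff_exI conj_cong refl) (simp add: chart_in_curve_iff[OF assms])

lemma curve_fun_smooth:
  assumes L: "L \<in> carrier_mat (n + n) (n + n)" and s: "smooth_vacuum_curve n L" and p: "p \<in> vacuum_curve n L"
  shows "curve_fun n L p (0, 0) = 0"
    "deriv (\<lambda>s. curve_fun n L p (s, 0)) 0 \<noteq> 0 \<or> deriv (\<lambda>t. curve_fun n L p (0, t)) 0 \<noteq> 0"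
  using s p unfolding smooth_vacuum_curve_def
  by (auto simp: curve_fun_def vacuum_form_bmat[OF L] vacuum_curve_iff[OF L])

text \<open>Every parametrisation factors through one fixed \<open>\<psi>\<close> by an invertible
  change of parameter. This is what frees orders of poles from the choice made in
  \<open>loc\<close>.\<close>

lemma local_param_universal:
  assumes L: "L \<in> carrier_mat (n + n) (n + n)" and s: "smooth_vacuum_curve n L" and p: "p \<in> vacuum_curve n L"
  obtains \<psi> where "local_param (vacuum_curve n L) p \<psi>"
    "\<And>\<phi>. local_param (vacuum_curve n L) p \<phi> \<Longrightarrow> \<exists>\<rho>. \<rho> analytic_on {0} \<and> \<rho> 0 = 0 \<and> deriv \<rho> 0 \<noteq> 0 \<and>
      (\<forall>\<^sub>F t in nhds 0. \<phi> t = \<psi> (\<rho> t))"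
proof -
  obtain a b W \<pi> where a: "a analytic_on {0}" "b analytic_on {0}" "a 0 = 0" "b 0 = 0"
    "deriv a 0 \<noteq> 0 \<or> deriv b 0 \<noteq> 0" "\<forall>\<^sub>F t in nhds 0. curve_fun n L p (a t, b t) = 0"
    and W: "open W" "(0, 0) \<in> W" "\<pi> \<in> {fst, snd}"
    "\<And>z. z \<in> W \<Longrightarrow> curve_fun n L p z = 0 \<Longrightarrow> z = (a (\<pi> z), b (\<pi> z))"
    by (rule local_curve[OF poly2_curve_fun curve_fun_smooth[OF L s p]]) blast
  show ?thesis
  proof (rule that[of "\<lambda>t. (chart (fst p) (a t), chart (snd p) (b t))"])
    show "local_param (vacuum_curve n L) p (\<lambda>t. (chart (fst p) (a t), chart (snd p) (b t)))"
      using a by (auto simp: local_param_iff[OF L])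
    fix \<phi> assume "local_param (vacuum_curve n L) p \<phi>"
    then obtain a2 b2 where a2: "a2 analytic_on {0}" "b2 analytic_on {0}" "a2 0 = 0" "b2 0 = 0"
      "deriv a2 0 \<noteq> 0 \<or> deriv b2 0 \<noteq> 0" "\<forall>\<^sub>F t in nhds 0. curve_fun n L p (a2 t, b2 t) = 0"
      and \<phi>: "\<phi> = (\<lambda>t. (chart (fst p) (a2 t), chart (snd p) (b2 t)))"
      by (auto simp: local_param_iff[OF L])
    obtain \<rho> where "\<rho> analytic_on {0}" "\<rho> 0 = 0" "deriv \<rho> 0 \<noteq> 0"
      "\<forall>\<^sub>F t in nhds 0. a2 t = a (\<rho> t) \<and> b2 t = b (\<rho> t)"
      using local_curve_reparam[OF a(1,2) W a2] by blast
    then show "\<exists>\<rho>. \<rho> analytic_on {0} \<and> \<rho> 0 = 0 \<and> deriv \<rho> 0 \<noteq> 0 \<and>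
        (\<forall>\<^sub>F t in nhds 0. \<phi> t = (chart (fst p) (a (\<rho> t)), chart (snd p) (b (\<rho> t))))"
      by (intro exI[of _ \<rho>]) (auto simp: \<phi> elim: eventually_mono)
  qed
qed

lemma local_param_loc:
  assumes "L \<in> carrier_mat (n + n) (n + n)" "smooth_vacuum_curve n L" "p \<in> vacuum_curve n L"
  shows "local_param (vacuum_curve n L) p (loc (vacuum_curve n L) p)"
proof -
  obtain \<psi> where "local_param (vacuum_curve n L) p \<psi>" using local_param_universal[OF assms] by blast
  then show ?thesis unfolding loc_def by (rule someI[of "local_param (vacuum_curve n L) p" \<psi>])
qed

section \<open>Pole orders and changes of parameter\<close>

definition pole_ord :: "(complex \<Rightarrow> complex) \<Rightarrow> int" where
  "pole_ord g = (if is_pole g 0 then - zorder g 0 else 0)"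

lemma pole_ord_cong: "\<forall>\<^sub>F t in at 0. f t = g t \<Longrightarrow> pole_ord f = pole_ord g"
  unfolding pole_ord_def using is_pole_cong[of f g 0 0] zorder_cong[of f g 0 0] by auto

lemma deriv_nonzero_eventually_neq:
  assumes "\<rho> analytic_on {0}" "deriv \<rho> 0 \<noteq> 0"
  shows "\<forall>\<^sub>F t in at 0. \<rho> t \<noteq> (w :: complex)"
proof (cases "w = \<rho> 0")
  case False
  have "(\<rho> \<longlongrightarrow> \<rho> 0) (at 0)" using analytic_at_imp_isCont[OF assms(1)] by (simp add: isCont_def)
  then show ?thesis using False tendsto_imp_eventually_ne by metis
next
  case True
  have "(\<rho> has_field_derivative deriv \<rho> 0) (at 0)"
    by (rule analytic_at_deriv[OF assms(1)])
  then have "((\<lambda>t. (\<rho> t - \<rho> 0) / (t - 0)) \<longlongrightarrow> deriv \<rho> 0) (at 0)"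
    by (simp add: has_field_derivative_iff)
  then have "\<forall>\<^sub>F t in at 0. (\<rho> t - \<rho> 0) / (t - 0) \<noteq> 0"
    using assms(2) tendsto_imp_eventually_ne by metis
  then show ?thesis using True by (auto elim: eventually_mono)
qed

text \<open>At a pole the order is multiplied by the order of the zero of \<open>\<rho>\<close>,
  which is 1. Away from poles a finite limit stays a limit after the composition.\<close>

lemma pole_ord_reparam:
  assumes g: "g meromorphic_on {0}" and \<rho>: "\<rho> analytic_on {0}" "\<rho> 0 = 0" "deriv \<rho> 0 \<noteq> 0"
  shows "pole_ord (\<lambda>t. g (\<rho> t)) = pole_ord g"
proof -
  have ne: "\<forall>\<^sub>F t in at 0. \<rho> t \<noteq> 0" by (rule deriv_nonzero_eventually_neq[OF \<rho>(1,3)])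
  have lim: "\<rho> \<midarrow>0\<rightarrow> 0" using analytic_at_imp_isCont[OF \<rho>(1)] \<rho>(2) by (simp add: isCont_def)
  have iso: "isolated_singularity_at g 0" "not_essential g 0" using g by (auto simp: meromorphic_at_iff)
  show ?thesis
  proof (cases "is_pole g 0")
    case True
    have p: "is_pole (\<lambda>t. g (\<rho> t)) 0" by (rule is_pole_compose[OF True lim ne])
    have "zorder (g \<circ> \<rho>) 0 = zorder g (\<rho> 0) * zorder (\<lambda>x. \<rho> x - \<rho> 0) 0"
      using iso \<rho> ne True by (intro zorder_compose') (auto simp: non_zero_neighbour_pole)
    also have "zorder (\<lambda>x. \<rho> x - \<rho> 0) 0 = 1"
      by (rule zorder_zero_eqI') (use \<rho> in \<open>auto intro!: analytic_intros\<close>)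
    finally show ?thesis using p True \<rho>(2) by (simp add: pole_ord_def o_def)
  next
    case False
    then obtain x where "g \<midarrow>0\<rightarrow> x" using iso(2) by (auto simp: not_essential_def)
    then have "(\<lambda>t. g (\<rho> t)) \<midarrow>0\<rightarrow> x"
      by (rule filterlim_compose) (use lim ne in \<open>auto simp: filterlim_at\<close>)
    then have "\<not> is_pole (\<lambda>t. g (\<rho> t)) 0"
      unfolding is_pole_def using not_tendsto_and_filterlim_at_infinity[OF at_neq_bot] by blast
    then show ?thesis using False by (simp add: pole_ord_def)
  qed
qed

lemma pole_ord_local_param:
  assumes L: "L \<in> carrier_mat (n + n) (n + n)" and s: "smooth_vacuum_curve n L" and p: "p \<in> vacuum_curve n L"
    and g: "curve_meromorphic (vacuum_curve n L) g"
    and \<phi>: "local_param (vacuum_curve n L) p \<phi>"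
  shows "pole_ord (g \<circ> \<phi>) = pole_div (vacuum_curve n L) g p"
proof -
  obtain \<psi> where \<psi>: "local_param (vacuum_curve n L) p \<psi>"
    "\<And>\<phi>. local_param (vacuum_curve n L) p \<phi> \<Longrightarrow> \<exists>\<rho>. \<rho> analytic_on {0} \<and> \<rho> 0 = 0 \<and> deriv \<rho> 0 \<noteq> 0 \<and>
      (\<forall>\<^sub>F t in nhds 0. \<phi> t = \<psi> (\<rho> t))" using local_param_universal[OF L s p] by blast
  have "pole_ord (g \<circ> \<phi>) = pole_ord (g \<circ> \<psi>)" if \<phi>: "local_param (vacuum_curve n L) p \<phi>" for \<phi>
  proof -
    obtain \<rho> where \<rho>: "\<rho> analytic_on {0}" "\<rho> 0 = 0" "deriv \<rho> 0 \<noteq> 0" "\<forall>\<^sub>F t in nhds 0. \<phi> t = \<psi> (\<rho> t)"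
      using \<psi>(2)[OF \<phi>] by blast
    have "pole_ord (g \<circ> \<phi>) = pole_ord (\<lambda>t. (g \<circ> \<psi>) (\<rho> t))"
      by (rule pole_ord_cong)
         (use eventually_nhds_conv_at[THEN iffD1, OF \<rho>(4)] in \<open>auto elim: eventually_mono\<close>)
    also have "\<dots> = pole_ord (g \<circ> \<psi>)"
      using g p \<psi>(1) \<rho> by (intro pole_ord_reparam) (auto simp: curve_meromorphic_def simp del: o_apply)
    finally show ?thesis .
  qed
  from this[OF \<phi>] this[OF local_param_loc[OF L s p]] show ?thesis
    by (simp add: pole_div_def pole_ord_def)
qed

lemma neg_inv_chart:
  obtains \<tau> where "\<tau> analytic_on {0}" "\<tau> 0 = 0" "deriv \<tau> 0 \<noteq> 0"
    "\<forall>\<^sub>F w in nhds 0. neg_inv (chart q w) = chart (neg_inv q) (\<tau> w)"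
proof -
  \<comment> \<open>The centres 0 and infinity are exchanged, and \<open>w\<close> goes to
    \<open>1 / (- w)\<close> or \<open>1 / w\<close> to \<open>- w\<close>; in both cases the chart
    coordinate changes its sign.\<close>
  have m: "(\<lambda>w::complex. - w) analytic_on {0}" "deriv (\<lambda>w::complex. - w) 0 \<noteq> 0"
    by (auto intro!: analytic_intros)
  show ?thesis
  proof (cases q)
    case Inf_pt
    then show ?thesis
      by (intro that[OF m(1) _ m(2)]) (auto simp: chart_def of_hom_def intro!: always_eventually)
  next
    case (Aff c)
    show ?thesis
    proof (cases "c = 0")
      case True
      with Aff show ?thesis
        by (intro that[OF m(1) _ m(2)]) (auto simp: chart_def of_hom_def inverse_eq_divide intro!: always_eventually)
    next
      case False
      \<comment> \<open>Chosen so that \<open>- 1 / (c + w)\<close> is \<open>- 1 / c\<close> plus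
        \<open>\<tau> w\<close>.\<close>
      define \<tau> where "\<tau> w = inverse c - inverse (c + w)" for w
      have "\<tau> analytic_on {0}" unfolding \<tau>_def using False by (auto intro!: analytic_intros)
      moreover have "(\<tau> has_field_derivative inverse c * inverse c) (at 0)"
        unfolding \<tau>_def using False by (auto intro!: derivative_eq_intros)
      then have "deriv \<tau> 0 \<noteq> 0" using False by (simp add: DERIV_imp_deriv)
      moreover have "\<forall>\<^sub>F w in nhds 0. neg_inv (chart q w) = chart (neg_inv q) (\<tau> w)"
      proof -
        have "\<forall>\<^sub>F w in nhds 0. w \<in> - {- c}" using False by (intro eventually_nhds_in_open) auto
        then show ?thesis
        proof eventually_elim
          case (elim w)
          then have "c + w \<noteq> 0" by (simp add: add_eq_0_iff)
          then show ?case using Aff False by (simp add: chart_def of_hom_def \<tau>_def)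
        qed
      qed
      ultimately show ?thesis using that[of \<tau>] by (simp add: \<tau>_def)
    qed
  qed
qed

text \<open>The formula for \<open>neg_inv\<close> in charts holds only near 0, whereas
  \<open>local_param\<close> fixes the function for all parameters. Hence a new function
  \<open>\<phi>'\<close> of the prescribed form that agrees with the transported one near 0.\<close>

lemma local_param_neg_inv2:
  assumes "local_param \<Gamma> p \<phi>"
  obtains \<phi>' where "local_param {q. neg_inv2 q \<in> \<Gamma>} (neg_inv2 p) \<phi>'"
    "\<forall>\<^sub>F t in nhds 0. neg_inv2 (\<phi> t) = \<phi>' t"
proof -
  obtain a b where a: "a analytic_on {0}" "b analytic_on {0}" "a 0 = 0" "b 0 = 0"
    "deriv a 0 \<noteq> 0 \<or> deriv b 0 \<noteq> 0" "\<forall>\<^sub>F t in nhds 0. \<phi> t \<in> \<Gamma>"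
    "\<phi> = (\<lambda>t. (chart (fst p) (a t), chart (snd p) (b t)))"
    using assms unfolding local_param_def by blast
  obtain \<tau> where \<tau>: "\<tau> analytic_on {0}" "\<tau> 0 = 0" "deriv \<tau> 0 \<noteq> 0"
    "\<forall>\<^sub>F w in nhds 0. neg_inv (chart (fst p) w) = chart (neg_inv (fst p)) (\<tau> w)"
    using neg_inv_chart by blast
  obtain \<sigma> where \<sigma>: "\<sigma> analytic_on {0}" "\<sigma> 0 = 0" "deriv \<sigma> 0 \<noteq> 0"
    "\<forall>\<^sub>F w in nhds 0. neg_inv (chart (snd p) w) = chart (neg_inv (snd p)) (\<sigma> w)"
    using neg_inv_chart by blast
  have lim: "(c \<longlongrightarrow> 0) (nhds 0)" if "c analytic_on {0}" "c 0 = (0::complex)" for c :: "complex \<Rightarrow> complex"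
    using analytic_tendsto_nhds[OF that(1)] that(2) by simp
  have an: "(\<lambda>t. s (c t)) analytic_on {0}" if "s analytic_on {0}" "c analytic_on {0}" "c 0 = 0" for s c :: "complex \<Rightarrow> complex"
    using analytic_on_compose_gen[OF that(2,1)] that(3) by (simp add: o_def)
  have dd: "deriv (\<lambda>t. s (c t)) 0 = deriv s 0 * deriv c 0"
    if "s analytic_on {0}" "c analytic_on {0}" "c 0 = 0" for s c :: "complex \<Rightarrow> complex"
  proof -
    have "(s has_field_derivative deriv s (c 0)) (at (c 0))"
      using analytic_at_deriv[OF that(1)] that(3) by simp
    moreover have "(c has_field_derivative deriv c 0) (at 0)"
      by (rule analytic_at_deriv[OF that(2)])
    ultimately have "((\<lambda>t. s (c t)) has_field_derivative deriv s (c 0) * deriv c 0) (at 0)"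
      by (rule DERIV_chain2)
    then show ?thesis using that(3) by (simp add: DERIV_imp_deriv)
  qed
  define \<phi>' where "\<phi>' t = (chart (neg_inv (fst p)) (\<tau> (a t)), chart (neg_inv (snd p)) (\<sigma> (b t)))" for t
  have e1: "\<forall>\<^sub>F t in nhds 0. neg_inv (chart (fst p) (a t)) = chart (neg_inv (fst p)) (\<tau> (a t))"
    using filterlim_iff[THEN iffD1, rule_format, OF lim[OF a(1,3)] \<tau>(4)] .
  have e2: "\<forall>\<^sub>F t in nhds 0. neg_inv (chart (snd p) (b t)) = chart (neg_inv (snd p)) (\<sigma> (b t))"
    using filterlim_iff[THEN iffD1, rule_format, OF lim[OF a(2,4)] \<sigma>(4)] .
  have e: "\<forall>\<^sub>F t in nhds 0. neg_inv2 (\<phi> t) = \<phi>' t"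
    using e1 e2 by eventually_elim (simp add: a(7) \<phi>'_def neg_inv2_def)
  have "\<forall>\<^sub>F t in nhds 0. \<phi>' t \<in> {q. neg_inv2 q \<in> \<Gamma>}"
    using e a(6) by eventually_elim (metis mem_Collect_eq neg_inv2_neg_inv2)
  moreover have "deriv (\<lambda>t. \<tau> (a t)) 0 \<noteq> 0 \<or> deriv (\<lambda>t. \<sigma> (b t)) 0 \<noteq> 0"
    using a(5) \<tau>(3) \<sigma>(3) dd[OF \<tau>(1) a(1,3)] dd[OF \<sigma>(1) a(2,4)] by simp
  moreover have "\<phi>' = (\<lambda>t. (chart (fst (neg_inv2 p)) (\<tau> (a t)), chart (snd (neg_inv2 p)) (\<sigma> (b t))))"
    by (simp add: \<phi>'_def fun_eq_iff)
  moreover have "\<tau> (a 0) = 0" "\<sigma> (b 0) = 0" using a \<tau> \<sigma> by simp_all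
  ultimately have "local_param {q. neg_inv2 q \<in> \<Gamma>} (neg_inv2 p) \<phi>'"
    unfolding local_param_def using an[OF \<tau>(1) a(1,3)] an[OF \<sigma>(1) a(2,4)] by blast
  then show ?thesis by (rule that[OF _ e])
qed

section \<open>Finiteness of common zeros\<close>

type_synonym cpair = "(complex \<times> complex) \<times> (complex \<times> complex)"

abbreviation poly4 :: "(cpair \<Rightarrow> complex) \<Rightarrow> bool" where
  "poly4 \<equiv> poly_in {\<lambda>z. fst (fst z), \<lambda>z. snd (fst z), \<lambda>z. fst (snd z), \<lambda>z. snd (snd z)}"

lemma poly4_continuous: "poly4 f \<Longrightarrow> continuous_on S f"
  by (rule poly_in_continuous) (auto intro!: continuous_intros)

lemma poly4_analytic:
  assumes "poly4 g" "u0 analytic_on S" "u1 analytic_on S" "v0 analytic_on S" "v1 analytic_on S"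
  shows "(\<lambda>t. g ((u0 t, u1 t), (v0 t, v1 t))) analytic_on S"
  using assms(1) by (rule poly_in_analytic[where c = "\<lambda>t. ((u0 t, u1 t), (v0 t, v1 t))"]) (use assms in auto)

lemma poly4_bmat:
  assumes "i < n" "j < n"
  shows "poly4 (\<lambda>z. bmat n L (fst z) (snd z) $$ (i, j))"
proof -
  have b: "poly4 (\<lambda>z. fst (fst z))" "poly4 (\<lambda>z. snd (fst z))" "poly4 (\<lambda>z. fst (snd z))" "poly4 (\<lambda>z. snd (snd z))"
    by (rule poly_in.base, simp)+
  show ?thesis
    using assms by (simp add: bmat_index) (intro poly_in_diff poly_in.add poly_in.mult poly_in.const b)
qed

lemma poly4_det_bmat: "poly4 (\<lambda>z. det (bmat n L (fst z) (snd z)))"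
  by (rule poly_in_det[where k = n]) (auto intro: poly4_bmat)

lemma poly4_adj_bmat:
  assumes "i < n" "j < n"
  shows "poly4 (\<lambda>z. adj_mat (bmat n L (fst z) (snd z)) $$ (i, j))"
  by (rule cofactor_closed[where Q = poly4 and n = n])
     (auto intro: poly_in.const poly_in.add poly_in.mult poly4_bmat assms)

text \<open>The trace of bihomogeneity on zero sets: enough for vanishing to depend only on the
  point of the product of projective lines.\<close>

definition scale_inv :: "(cpair \<Rightarrow> complex) \<Rightarrow> bool" where
  "scale_inv g \<longleftrightarrow> (\<forall>U V c d. g (U, V) = 0 \<longrightarrow> g (scal c U, scal d V) = 0)"

lemma scale_inv_det: "n \<ge> 1 \<Longrightarrow> scale_inv (\<lambda>z. det (bmat n L (fst z) (snd z)))"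
  by (simp add: scale_inv_def det_bmat_scal)

lemma adj_mat_smult:
  assumes "(M :: complex mat) \<in> carrier_mat n n" "i < n" "j < n"
  shows "adj_mat (c \<cdot>\<^sub>m M) $$ (i, j) = c ^ (n - 1) * adj_mat M $$ (i, j)"
proof -
  have "mat_delete (c \<cdot>\<^sub>m M) j i = c \<cdot>\<^sub>m mat_delete M j i"
    using assms by (intro eq_matI) (auto simp: mat_delete_def)
  moreover have "dim_col (mat_delete M j i) = n - 1" using assms by (simp add: mat_delete_def)
  ultimately show ?thesis
    using assms by (simp add: adj_mat_index[OF assms] adj_mat_index[of "c \<cdot>\<^sub>m M" n] cofactor_def)
qed

lemma adj_bmat_scal:
  "i < n \<Longrightarrow> j < n \<Longrightarrow> adj_mat (bmat n L (scal c U) (scal d V)) $$ (i, j) =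
     (c * d) ^ (n - 1) * adj_mat (bmat n L U V) $$ (i, j)"
  by (simp add: bmat_scal adj_mat_smult[OF bmat_carrier])

lemma scale_inv_adj:
  "i < n \<Longrightarrow> j < n \<Longrightarrow> scale_inv (\<lambda>z. adj_mat (bmat n L (fst z) (snd z)) $$ (i, j))"
  by (simp add: scale_inv_def adj_bmat_scal)

text \<open>Otherwise the common zeros have a limit point of maximal norm, and the curve stays in the set
  of common zeros near that point. Along a local parameter, the maximum principle applied to the
  (real) inner product with the point then makes the parameter constant.\<close>
lemma finite_affine_common_zeros:
  fixes gs :: "(cpair \<Rightarrow> complex) set"
  assumes L: "L \<in> carrier_mat (n + n) (n + n)" and s: "smooth_vacuum_curve n L"
    and gs: "finite gs" "(\<lambda>z. det (bmat n L (fst z) (snd z))) \<in> gs"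
    and poly: "\<And>g. g \<in> gs \<Longrightarrow> poly4 g" and inv: "\<And>g. g \<in> gs \<Longrightarrow> scale_inv g"
    and inf: "\<And>U V. U \<noteq> (0, 0) \<Longrightarrow> V \<noteq> (0, 0) \<Longrightarrow> snd U = 0 \<or> snd V = 0 \<Longrightarrow> \<exists>g\<in>gs. g (U, V) \<noteq> 0"
  shows "finite {(u, v). \<forall>g\<in>gs. g ((u, 1), (v, 1)) = 0}"
proof (rule ccontr)
  define Bd where "Bd = {(u, v). \<forall>g\<in>gs. g ((u, 1), (v, 1)) = 0}"
  assume "\<not> finite {(u, v). \<forall>g\<in>gs. g ((u, 1), (v, 1)) = 0}"
  then have infinite: "infinite Bd" by (simp add: Bd_def)
  \<comment> \<open>Unit representatives of the common zeros form a compact set. No common zero lies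
    over infinity, so dividing by the last coordinates is continuous on it and the affine set
    \<open>Bd\<close> is a continuous image.\<close>
  define C where "C = (sphere 0 1 \<times> sphere 0 1) \<inter> {z. \<forall>g\<in>gs. g z = 0}"
  have "closed {z. \<forall>g\<in>gs. g z = 0}"
  proof -
    have "{z. \<forall>g\<in>gs. g z = 0} = (\<Inter>g\<in>gs. {z. g z = 0})" by auto
    also have "closed \<dots>"
    proof (rule closed_INT, rule ballI)
      fix g assume "g \<in> gs"
      then show "closed {z. g z = 0}"
        using poly4_continuous[OF poly, of g UNIV] by (intro closed_Collect_eq) auto
    qed
    finally show ?thesis .
  qed
  then have C: "compact C" unfolding C_def by (intro compact_Int_closed compact_Times) auto
  have ne: "snd (fst z) \<noteq> 0" "snd (snd z) \<noteq> 0" if "z \<in> C" for z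
  proof -
    have "fst z \<noteq> (0, 0)" "snd z \<noteq> (0, 0)" using that by (auto simp: C_def)
    then show "snd (fst z) \<noteq> 0" "snd (snd z) \<noteq> 0"
      using inf[of "fst z" "snd z"] that by (auto simp: C_def)
  qed
  define q where "q z = (fst (fst z) / snd (fst z), fst (snd z) / snd (snd z))" for z :: cpair
  have "Bd = q ` C"
  proof (intro equalityI subsetI)
    fix x assume "x \<in> Bd"
    then obtain u v where x: "x = (u, v)" "\<And>g. g \<in> gs \<Longrightarrow> g ((u, 1), (v, 1)) = 0" by (auto simp: Bd_def)
    define c where "c = (1 / norm (u, 1 :: complex))"
    define d where "d = (1 / norm (v, 1 :: complex))"
    let ?U = "scal (of_real c) (u, 1)" and ?V = "scal (of_real d) (v, 1)"
    have sc: "scal (of_real r) w = r *\<^sub>R w" for r w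
      by (simp add: scal_def scaleR_conv_of_real prod_eq_iff)
    have nz: "(w, 1 :: complex) \<noteq> 0" for w :: complex by (simp add: zero_prod_def)
    then have cd: "c \<noteq> 0" "d \<noteq> 0" by (auto simp: c_def d_def)
    have "norm ?U = 1" "norm ?V = 1" unfolding sc norm_scaleR c_def d_def using nz by simp_all
    moreover have "g (?U, ?V) = 0" if "g \<in> gs" for g
      using inv[OF that] x(2)[OF that] unfolding scale_inv_def by blast
    ultimately have "(?U, ?V) \<in> C" by (simp add: C_def)
    moreover have "q (?U, ?V) = x" using cd by (simp add: q_def scal_def x)
    ultimately show "x \<in> q ` C" by (metis imageI)
  next
    fix x assume "x \<in> q ` C"
    then obtain z where z: "z \<in> C" "x = q z" by blast
    note n = ne[OF z(1)]
    have "g ((fst x, 1), (snd x, 1)) = 0" if "g \<in> gs" for g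
    proof -
      have "g (fst z, snd z) = 0" using z(1) that by (simp add: C_def)
      then have "g (scal (1 / snd (fst z)) (fst z), scal (1 / snd (snd z)) (snd z)) = 0"
        using inv[OF that] unfolding scale_inv_def by blast
      then show ?thesis using n by (simp add: scal_def z(2) q_def)
    qed
    then show "x \<in> Bd" by (cases x) (simp add: Bd_def)
  qed
  moreover have "compact (q ` C)"
  proof (rule compact_continuous_image[OF _ C])
    show "continuous_on C q" unfolding q_def by (intro continuous_intros) (use ne in auto)
  qed
  ultimately have Bd: "compact Bd" by simp
  \<comment> \<open>Passing to accumulation points keeps compactness, and the infinite compact set
    \<open>Bd\<close> has at least one.\<close>
  define K where "K = Bd \<inter> {x. x islimpt Bd}"
  have "compact K" unfolding K_def using Bd closed_limpts by (rule compact_Int_closed)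
  moreover have "K \<noteq> {}" using Bd infinite unfolding compact_eq_Bolzano_Weierstrass K_def by blast
  moreover have "continuous_on K norm" by (intro continuous_intros)
  ultimately have "\<exists>x\<in>K. \<forall>y\<in>K. norm y \<le> norm x" by (rule continuous_attains_sup)
  then obtain x0 where x0: "x0 \<in> K" and max: "\<And>x. x \<in> K \<Longrightarrow> norm x \<le> norm x0" by blast
  obtain u0 v0 where uv: "x0 = (u0, v0)" by (cases x0)
  define p where "p = (Aff u0, Aff v0)"
  have cf: "curve_fun n L p z = det (bmat n L (u0 + fst z, 1) (v0 + snd z, 1))" for z
    by (simp add: curve_fun_def p_def)
  have Bd_curve: "curve_fun n L p (x - x0) = 0" if "x \<in> Bd" for x
    using that gs(2) by (cases x) (fastforce simp: Bd_def cf uv)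
  have p: "p \<in> vacuum_curve n L"
  proof -
    have "curve_fun n L p (x0 - x0) = 0" by (rule Bd_curve) (use x0 in \<open>simp add: K_def\<close>)
    then show ?thesis by (simp add: vacuum_curve_iff[OF L] curve_fun_def)
  qed
  obtain a b W \<pi> where ab: "a analytic_on {0}" "b analytic_on {0}" "a 0 = 0" "b 0 = 0"
    and W: "open W" "(0, 0) \<in> W" "\<pi> \<in> {fst, snd}" "\<And>t. \<pi> (a t, b t) = t"
    "\<And>z. z \<in> W \<Longrightarrow> curve_fun n L p z = 0 \<Longrightarrow> z = (a (\<pi> z), b (\<pi> z))"
    by (rule local_curve[OF poly2_curve_fun curve_fun_smooth[OF L s p]]) blast
  define y where "y t = (u0 + a t, v0 + b t)" for t
  have \<pi>: "continuous_on UNIV \<pi>" "\<pi> (0, 0) = 0" using W(3) by (auto intro: continuous_intros)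
  \<comment> \<open>Near \<open>x0\<close> the points of \<open>Bd\<close> lie on the one branch
    through \<open>x0\<close>, so each \<open>g\<close> has zeros accumulating at parameter 0 along
    it and vanishes identically by the isolation of zeros.\<close>
  have yg: "\<forall>\<^sub>F t in nhds 0. g ((u0 + a t, 1), (v0 + b t, 1)) = 0" if g: "g \<in> gs" for g
  proof -
    let ?G = "\<lambda>t. g ((u0 + a t, 1), (v0 + b t, 1))"
    have an: "?G analytic_on {0}"
      using ab by (intro poly4_analytic[OF poly[OF g]] analytic_intros)
    have "\<exists>\<^sub>F t in at 0. ?G t = 0"
    proof (rule ccontr)
      assume "\<not> ?thesis"
      then have "\<forall>\<^sub>F t in at 0. ?G t \<noteq> 0" by (simp add: frequently_def)
      then obtain e where e: "e > 0" "\<And>t. t \<noteq> 0 \<Longrightarrow> dist t 0 < e \<Longrightarrow> ?G t \<noteq> 0"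
        unfolding eventually_at by auto
      define T where "T = (\<lambda>x. x - x0) -` (W \<inter> \<pi> -` ball 0 e)"
      have "open (\<pi> -` ball 0 e)" by (rule open_vimage[OF open_ball \<pi>(1)])
      from open_Int[OF W(1) this] have "open T" unfolding T_def
        by (rule open_vimage) (intro continuous_intros)
      moreover have "x0 \<in> T" using W(2) \<pi>(2) e(1) by (simp add: T_def zero_prod_def)
      ultimately obtain x where x: "x \<in> Bd" "x \<in> T" "x \<noteq> x0"
        using x0 unfolding K_def islimpt_def by blast
      define r where "r = \<pi> (x - x0)"
      have z: "x - x0 = (a r, b r)" using W(5) x(2) Bd_curve[OF x(1)] by (simp add: T_def r_def)
      have "r \<noteq> 0"
      proof
        assume "r = 0"
        then have "x - x0 = (0, 0)" using z ab(3,4) by simp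
        then show False using x(3) by (simp add: prod_eq_iff)
      qed
      moreover have "dist r 0 < e" using x(2) by (simp add: T_def r_def dist_commute)
      ultimately have "?G r \<noteq> 0" by (rule e(2))
      moreover have "x = (u0 + a r, v0 + b r)" using z uv by (simp add: prod_eq_iff algebra_simps)
      ultimately show False using x(1) g by (auto simp: Bd_def)
    qed
    then have "\<forall>\<^sub>F t in at 0. ?G t = 0"
      using an by (intro not_essential_frequently_0_imp_eventually_0)
        (auto intro: isolated_singularity_at_analytic not_essential_analytic)
    moreover have "?G 0 = 0" using x0 g ab(3,4) by (auto simp: K_def Bd_def uv)
    ultimately show ?thesis by (simp add: eventually_nhds_conv_at)
  qed
  have yBd: "\<forall>\<^sub>F t in nhds 0. y t \<in> Bd"
  proof -
    have "\<forall>\<^sub>F t in nhds 0. \<forall>g\<in>gs. g ((u0 + a t, 1), (v0 + b t, 1)) = 0"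
      using yg by (intro eventually_ball_finite gs(1)) auto
    then show ?thesis by eventually_elim (simp add: Bd_def y_def)
  qed
  obtain A where A: "open A" "0 \<in> A" "a holomorphic_on A" using ab(1) analytic_at by blast
  obtain B where B: "open B" "0 \<in> B" "b holomorphic_on B" using ab(2) analytic_at by blast
  obtain O1 where O1: "open O1" "0 \<in> O1" "\<And>t. t \<in> O1 \<Longrightarrow> y t \<in> Bd" 
    using yBd unfolding eventually_nhds by blast
  have "open (A \<inter> B \<inter> O1)" "0 \<in> A \<inter> B \<inter> O1" using A B O1 by auto
  then obtain e where e: "e > 0" "ball 0 e \<subseteq> A \<inter> B \<inter> O1" by (rule openE)
  let ?S = "ball 0 e :: complex set"
  have hol: "a holomorphic_on ?S" "b holomorphic_on ?S" 
    by (rule holomorphic_on_subset[OF A(3)], use e in blast)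
       (rule holomorphic_on_subset[OF B(3)], use e in blast)
  have ycont: "continuous_on ?S y" unfolding y_def
    using hol by (intro continuous_intros holomorphic_on_imp_continuous_on)
  have yinj: "s = t" if "y s = y t" for s t
  proof -
    have "(a s, b s) = (a t, b t)" using that by (simp add: y_def)
    then have "\<pi> (a s, b s) = \<pi> (a t, b t)" by (rule arg_cong)
    then show ?thesis by (simp only: W(4))
  qed
  have yK: "y t \<in> K" if t: "t \<in> ?S" for t
  proof -
    have "y t islimpt Bd"
      unfolding islimpt_def
    proof (intro allI impI)
      fix T assume T: "y t \<in> T" "open T"
      have "isCont y t" using ycont t by (simp add: continuous_on_eq_continuous_at)
      then have "\<forall>\<^sub>F s in at t. y s \<in> T" using T by (simp add: isCont_def topological_tendstoD)
      moreover have "\<forall>\<^sub>F s in at t. s \<in> ?S" using t by (intro eventually_at_in_open') auto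
      moreover have "\<forall>\<^sub>F s in at t. s \<noteq> t" by (simp add: eventually_at_filter)
      ultimately have "\<forall>\<^sub>F s in at t. y s \<in> T \<and> s \<in> ?S \<and> s \<noteq> t" by eventually_elim auto
      then obtain s where "y s \<in> T" "s \<in> ?S" "s \<noteq> t" using eventually_happens[of _ "at t"] by auto
      then show "\<exists>x\<in>Bd. x \<in> T \<and> x \<noteq> y t" using O1(3)[of s] e(2) yinj[of s t]
        by (intro bexI[of _ "y s"]) auto
    qed
    then show ?thesis using O1(3) e(2) t by (auto simp: K_def)
  qed
  \<comment> \<open>Its modulus is the exponential of the real inner product of \<open>x0\<close>
    with \<open>y t\<close>, which Cauchy-Schwarz and the maximality of \<open>x0\<close> bound by
    the value at 0.\<close>
  define H where "H t = exp (cnj u0 * (u0 + a t) + cnj v0 * (v0 + b t))" for t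
  have normH: "norm (H t) = exp (x0 \<bullet> y t)" for t
    by (simp add: H_def uv y_def inner_complex_def algebra_simps)
  have y0: "y 0 = x0" using ab by (simp add: y_def uv)
  have le: "x0 \<bullet> y t \<le> x0 \<bullet> x0" if "t \<in> ?S" for t
  proof -
    have "x0 \<bullet> y t \<le> norm x0 * norm (y t)" by (rule norm_cauchy_schwarz)
    also have "\<dots> \<le> norm x0 * norm x0" using max[OF yK[OF that]] by (intro mult_left_mono) auto
    finally show ?thesis by (simp add: dot_square_norm power2_eq_square)
  qed
  have "H constant_on ?S"
  proof (rule maximum_modulus_principle[where U = ?S and \<xi> = 0])
    show "H holomorphic_on ?S" unfolding H_def using hol by (intro holomorphic_intros)
    show "norm (H t) \<le> norm (H 0)" if "t \<in> ?S" for t using le[OF that] by (simp add: normH y0)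
  qed (use e in auto)
  define t where "t = complex_of_real (e / 2)"
  have t: "t \<in> ?S" "t \<noteq> 0" using e(1) by (auto simp: t_def)
  have "H t = H 0" using \<open>H constant_on ?S\<close> t e(1) unfolding constant_on_def by auto
  then have "x0 \<bullet> y t = x0 \<bullet> x0" using normH[of t] normH[of 0] y0 by simp
  moreover have "y t \<bullet> y t \<le> x0 \<bullet> x0"
    using max[OF yK[OF t(1)]] by (simp add: dot_square_norm)
  \<comment> \<open>Expanding the square: the inner product with \<open>x0\<close> equals the square
    norm of \<open>x0\<close>, and the norm of \<open>y t\<close> is no larger.\<close>
  ultimately have "(y t - x0) \<bullet> (y t - x0) \<le> 0"
    by (simp add: inner_diff inner_commute)
  then have "y t = y 0" using y0 by (metis inner_gt_zero_iff not_less right_minus_eq)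
  then show False using yinj t(2) by blast
qed

text \<open>Adding the determinant to the family allows the condition over infinity to be asked only
  at points of the curve; no common zero has an infinite coordinate, so all of them are
  affine.\<close>

lemma finite_common_zeros:
  fixes gs :: "(cpair \<Rightarrow> complex) set"
  assumes L: "L \<in> carrier_mat (n + n) (n + n)" and s: "smooth_vacuum_curve n L" and n: "n \<ge> 1"
    and gs: "finite gs" and poly: "\<And>g. g \<in> gs \<Longrightarrow> poly4 g" and inv: "\<And>g. g \<in> gs \<Longrightarrow> scale_inv g"
    and inf: "\<And>U V. U \<noteq> (0, 0) \<Longrightarrow> V \<noteq> (0, 0) \<Longrightarrow> snd U = 0 \<or> snd V = 0 \<Longrightarrow>
      det (bmat n L U V) = 0 \<Longrightarrow> \<exists>g\<in>gs. g (U, V) \<noteq> 0"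
  shows "finite {p \<in> vacuum_curve n L. \<forall>g\<in>gs. g (hom (fst p), hom (snd p)) = 0}"
proof -
  let ?gs = "insert (\<lambda>z. det (bmat n L (fst z) (snd z))) gs"
  have "finite {(u, v). \<forall>g\<in>?gs. g ((u, 1), (v, 1)) = 0}"
  proof (rule finite_affine_common_zeros[OF L s])
    show "\<exists>g\<in>?gs. g (U, V) \<noteq> 0" if "U \<noteq> (0, 0)" "V \<noteq> (0, 0)" "snd U = 0 \<or> snd V = 0" for U V
      using inf[OF that] by auto
  qed (use gs poly inv poly4_det_bmat scale_inv_det[OF n] in auto)
  then have "finite ((\<lambda>(u, v). (Aff u, Aff v)) ` {(u, v). \<forall>g\<in>?gs. g ((u, 1), (v, 1)) = 0})" (is "finite ?F")
    by (rule finite_imageI)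
  moreover have "{p \<in> vacuum_curve n L. \<forall>g\<in>gs. g (hom (fst p), hom (snd p)) = 0} \<subseteq> ?F"
  proof
    fix p assume p: "p \<in> {p \<in> vacuum_curve n L. \<forall>g\<in>gs. g (hom (fst p), hom (snd p)) = 0}"
    then have d: "det (bmat n L (hom (fst p)) (hom (snd p))) = 0" by (simp add: vacuum_curve_iff[OF L])
    then have "snd (hom (fst p)) \<noteq> 0" "snd (hom (snd p)) \<noteq> 0"
      using inf[of "hom (fst p)" "hom (snd p)"] p by auto
    then obtain u v where "p = (Aff u, Aff v)" by (cases p; cases "fst p"; cases "snd p") auto
    then show "p \<in> ?F" using p d by (intro image_eqI[of _ _ "(u, v)"]) auto
  qed
  ultimately show ?thesis by (rule finite_subset[rotated])
qed

lemma tens_row_scal: "tens_row n L (scal c U) X r = c * tens_row n L U X r"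
  by (simp add: tens_row_def scal_def sum_distrib_left algebra_simps)

lemma tens_row_smult: "X \<in> carrier_vec n \<Longrightarrow> tens_row n L U (c \<cdot>\<^sub>v X) r = c * tens_row n L U X r"
  by (auto simp: tens_row_def sum_distrib_left algebra_simps intro!: sum.cong)

lemma col_adj_carrier: "(A :: complex mat) \<in> carrier_mat n n \<Longrightarrow> col (adj_mat A) j \<in> carrier_vec n"
  by (rule carrier_vecI) (simp add: adj_mat_def)

text \<open>On the curve this is a coordinate of \<open>V \<otimes> Y\<close> for the kernel vector
  in column \<open>j\<close>. It expresses the vanishing of a coordinate of the covacuum vector by
  polynomials.\<close>

lemma poly4_tens_row_adj:
  assumes "j < n"
  shows "poly4 (\<lambda>z. tens_row n L (fst z) (col (adj_mat (bmat n L (fst z) (snd z))) j) r)"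
proof -
  have b: "poly4 (\<lambda>z. fst (fst z))" "poly4 (\<lambda>z. snd (fst z))" by (rule poly_in.base, simp)+
  have "(\<lambda>z. tens_row n L (fst z) (col (adj_mat (bmat n L (fst z) (snd z))) j) r) =
    (\<lambda>z. \<Sum>l<n. (fst (fst z) * L $$ (r, l) + snd (fst z) * L $$ (r, n + l)) *
      adj_mat (bmat n L (fst z) (snd z)) $$ (l, j))"
  proof
    fix z
    show "tens_row n L (fst z) (col (adj_mat (bmat n L (fst z) (snd z))) j) r =
      (\<Sum>l<n. (fst (fst z) * L $$ (r, l) + snd (fst z) * L $$ (r, n + l)) *
        adj_mat (bmat n L (fst z) (snd z)) $$ (l, j))"
      using assms adj_mat(1)[OF bmat_carrier, of n L "fst z" "snd z"]
      by (auto simp: tens_row_def intro!: sum.cong)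
  qed
  moreover have "poly4 (\<lambda>z. \<Sum>l<n. (fst (fst z) * L $$ (r, l) + snd (fst z) * L $$ (r, n + l)) *
      adj_mat (bmat n L (fst z) (snd z)) $$ (l, j))"
    using assms by (intro poly_in_sum poly_in.mult poly_in.add poly_in.const b poly4_adj_bmat) auto
  ultimately show ?thesis by simp
qed

lemma scale_inv_tens_row_adj:
  assumes "j < n"
  shows "scale_inv (\<lambda>z. tens_row n L (fst z) (col (adj_mat (bmat n L (fst z) (snd z))) j) r)"
proof -
  have "col (adj_mat (bmat n L (scal c U) (scal d V))) j =
      (c * d) ^ (n - 1) \<cdot>\<^sub>v col (adj_mat (bmat n L U V)) j" for c d U V
    using assms adj_mat(1)[OF bmat_carrier, of n L "scal c U" "scal d V"] adj_mat(1)[OF bmat_carrier, of n L U V]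
    by (intro eq_vecI) (auto simp: adj_bmat_scal)
  moreover have "col (adj_mat (bmat n L U V)) j \<in> carrier_vec n" for U V
    by (rule col_adj_carrier[OF bmat_carrier])
  ultimately show ?thesis by (simp add: scale_inv_def tens_row_scal tens_row_smult)
qed

section \<open>Normalised vectors and pole orders of quotients\<close>

lemma normalized_index:
  "X \<in> carrier_vec n \<Longrightarrow> m < n \<Longrightarrow> X $ m \<noteq> 0 \<Longrightarrow> ((1 / X $ m) \<cdot>\<^sub>v X) $ m = (1::complex)"
  by simp

lemma the_normalized:
  assumes P: "P X" "X $ m \<noteq> 0" "m < n"
    and mult: "\<And>X. P X \<Longrightarrow> X \<in> carrier_vec n \<and> (\<exists>c. X = c \<cdot>\<^sub>v X0)"
    and scale: "\<And>X c. P X \<Longrightarrow> c \<noteq> 0 \<Longrightarrow> P (c \<cdot>\<^sub>v X)"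
  shows "(THE X. P X \<and> X $ m = (1::complex)) = (1 / X $ m) \<cdot>\<^sub>v X"
proof (rule the_equality)
  have X: "X \<in> carrier_vec n" using mult[OF P(1)] by blast
  then show "P ((1 / X $ m) \<cdot>\<^sub>v X) \<and> ((1 / X $ m) \<cdot>\<^sub>v X) $ m = 1"
    using P scale by auto
  obtain c where c: "X = c \<cdot>\<^sub>v X0" using mult[OF P(1)] by blast
  then have X0: "X0 \<in> carrier_vec n" using X by auto
  fix Y assume Y: "P Y \<and> Y $ m = 1"
  then obtain d where d: "Y = d \<cdot>\<^sub>v X0" using mult by blast
  have "d * X0 $ m = 1" "X $ m = c * X0 $ m" using Y d c X0 P(3) by auto
  then show "Y = (1 / X $ m) \<cdot>\<^sub>v X"
    using P(2) X0 by (intro eq_vecI) (auto simp: c d field_simps)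
qed

lemma analytic_zero_dichotomy:
  assumes "f analytic_on {0}"
  shows "(\<forall>\<^sub>F t in at 0. f t = (0::complex)) \<or> (\<forall>\<^sub>F t in at 0. f t \<noteq> 0)"
  using not_essential_frequently_0_imp_eventually_0[of f 0] assms
  by (auto simp: frequently_def intro: isolated_singularity_at_analytic not_essential_analytic)

lemma analytic_nonzero_eventually:
  assumes "f analytic_on {0}" "f 0 \<noteq> (0::complex)"
  shows "\<forall>\<^sub>F t in nhds 0. f t \<noteq> 0"
  using analytic_tendsto_nhds[OF assms(1)] assms(2) by (rule tendsto_imp_eventually_ne)

text \<open>A zero of \<open>f\<close> can only lower the pole order below the order of the zero of
  \<open>g\<close>, and \<open>f 0 \<noteq> 0\<close> excludes cancellation. An \<open>f\<close>
  that is identically zero near 0 has no meaningful order and is treated apart.\<close>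

lemma pole_ord_quotient:
  assumes f: "f analytic_on {0}" and g: "g analytic_on {0}" and gnz: "\<forall>\<^sub>F t in at 0. g t \<noteq> 0"
    and q: "\<forall>\<^sub>F t in at 0. q t = f t / g t"
  shows "0 \<le> pole_ord q" "pole_ord q \<le> zorder g 0" "f 0 \<noteq> 0 \<Longrightarrow> pole_ord q = zorder g 0"
proof -
  have fg: "pole_ord q = pole_ord (\<lambda>t. f t / g t)" by (rule pole_ord_cong[OF q])
  have zg: "zorder g 0 \<ge> 0" by (rule zorder_ge_0[OF g eventually_frequently[OF at_neq_bot gnz]])
  have mer: "(\<lambda>t. f t / g t) meromorphic_on {0}"
    using f g by (intro meromorphic_on_divide analytic_on_imp_meromorphic_on)
  show "0 \<le> pole_ord q" "pole_ord q \<le> zorder g 0" "f 0 \<noteq> 0 \<Longrightarrow> pole_ord q = zorder g 0"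
  proof -
    consider "\<forall>\<^sub>F t in at 0. f t = 0" | "\<forall>\<^sub>F t in at 0. f t \<noteq> 0"
      using analytic_zero_dichotomy[OF f] by blast
    then have "0 \<le> pole_ord q \<and> pole_ord q \<le> zorder g 0 \<and> (f 0 \<noteq> 0 \<longrightarrow> pole_ord q = zorder g 0)"
    proof cases
      case 1
      have "pole_ord (\<lambda>t. f t / g t) = pole_ord (\<lambda>_. 0)"
      proof (rule pole_ord_cong)
        show "\<forall>\<^sub>F t in at 0. f t / g t = 0" using 1 by eventually_elim simp
      qed
      also have "\<dots> = 0" by (simp add: pole_ord_def)
      finally have "pole_ord q = 0" using fg by simp
      moreover have "f 0 = 0"
      proof (rule ccontr)
        assume "f 0 \<noteq> 0"
        then have "\<forall>\<^sub>F t in at 0. f t \<noteq> 0"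
          using analytic_nonzero_eventually[OF f] by (simp add: eventually_nhds_conv_at)
        with 1 have "\<forall>\<^sub>F t in at (0::complex). False" by eventually_elim simp
        then show False by simp
      qed
      ultimately show ?thesis using zg by simp
    next
      case 2
      have ff: "\<exists>\<^sub>F t in at 0. f t \<noteq> 0" "\<exists>\<^sub>F t in at 0. g t \<noteq> 0"
        using eventually_frequently[OF at_neq_bot 2] eventually_frequently[OF at_neq_bot gnz] by auto
      have z: "zorder (\<lambda>t. f t / g t) 0 = zorder f 0 - zorder g 0"
        using f g ff by (intro zorder_divide analytic_on_imp_meromorphic_on)
      have zf: "zorder f 0 \<ge> 0" by (rule zorder_ge_0[OF f ff(1)])
      have zf0: "zorder f 0 = 0" if "f 0 \<noteq> 0" using zorder_eq_0_iff[OF f ff(1)] that by simp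
      have nz: "\<forall>\<^sub>F t in at 0. f t / g t \<noteq> 0" using 2 gnz by eventually_elim simp
      have "isolated_singularity_at (\<lambda>t. f t / g t) 0" using mer by (simp add: meromorphic_at_iff)
      then have "is_pole (\<lambda>t. f t / g t) 0 \<longleftrightarrow> zorder (\<lambda>t. f t / g t) 0 < 0"
        using zorder_neg_imp_is_pole[OF mer nz] isolated_pole_imp_neg_zorder[of "\<lambda>t. f t / g t" 0]
        by blast
      then show ?thesis using fg z zf zf0 zg by (auto simp: pole_ord_def)
    qed
    then show "0 \<le> pole_ord q" "pole_ord q \<le> zorder g 0" "f 0 \<noteq> 0 \<Longrightarrow> pole_ord q = zorder g 0" by auto
  qed
qed

text \<open>All coordinates share the denominator \<open>g\<close>, which bounds their pole orders;
  a coordinate of \<open>x\<close> that is non-zero at 0 attains the bound, so the maximum is the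
  order of \<open>g\<close>.\<close>

lemma pole_div_vec_quotient:
  assumes n: "n \<ge> 1" and x: "\<And>i. i < n \<Longrightarrow> (\<lambda>t. x t $ i) analytic_on {0}" and xi: "\<exists>i<n. x 0 $ i \<noteq> 0"
    and g: "g analytic_on {0}" and gnz: "\<forall>\<^sub>F t in at 0. g t \<noteq> 0"
    and q: "\<And>i. i < n \<Longrightarrow> \<forall>\<^sub>F t in at 0. X (loc \<Gamma> p t) $ i = x t $ i / g t"
  shows "pole_div_vec n \<Gamma> X p = zorder g 0"
proof -
  have e: "pole_div \<Gamma> (\<lambda>q. X q $ i) p = pole_ord (\<lambda>t. X (loc \<Gamma> p t) $ i)" for i
    by (simp add: pole_div_def pole_ord_def o_def)
  note pq = pole_ord_quotient[OF x g gnz q]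
  show ?thesis
    unfolding pole_div_vec_def e
  proof (rule Max_eqI)
    show "y \<le> zorder g 0" if "y \<in> (\<lambda>i. pole_ord (\<lambda>t. X (loc \<Gamma> p t) $ i)) ` {..<n}" for y
      using that pq(2) by auto
    obtain i where "i < n" "x 0 $ i \<noteq> 0" using xi by blast
    then show "zorder g 0 \<in> (\<lambda>i. pole_ord (\<lambda>t. X (loc \<Gamma> p t) $ i)) ` {..<n}"
      using pq(3)[of i] by (intro image_eqI[of _ _ i]) auto
  qed simp
qed

text \<open>One chart coordinate has non-zero derivative, and such a function takes a given value at
  no parameter close to but different from 0.\<close>

lemma local_param_avoids:
  assumes "local_param \<Gamma> p \<phi>" "finite S"
  shows "\<forall>\<^sub>F t in at 0. \<phi> t \<notin> S"
proof -
  obtain a b where a: "a analytic_on {0}" "b analytic_on {0}" "deriv a 0 \<noteq> 0 \<or> deriv b 0 \<noteq> 0"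
    "\<phi> = (\<lambda>t. (chart (fst p) (a t), chart (snd p) (b t)))"
    using assms(1) unfolding local_param_def by blast
  have inj: "chart r w = chart r w' \<Longrightarrow> w = w'" for r w w'
    by (cases r) (auto simp: chart_def of_hom_def split: if_splits)
  have one: "\<forall>\<^sub>F t in at 0. chart r (c t) \<noteq> q" if "c analytic_on {0}" "deriv c 0 \<noteq> 0" for r c q
  proof (cases "\<exists>w. chart r w = q")
    case True
    then obtain w where w: "chart r w = q" by blast
    have "\<forall>\<^sub>F t in at 0. c t \<noteq> w" by (rule deriv_nonzero_eventually_neq[OF that])
    then show ?thesis by eventually_elim (use inj w in blast)
  qed auto
  have "\<forall>\<^sub>F t in at 0. \<phi> t \<noteq> q" for q
    using a(3)
  proof
    assume "deriv a 0 \<noteq> 0"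
    from one[OF a(1) this, of "fst p" "fst q"] show ?thesis by eventually_elim (auto simp: a(4))
  next
    assume "deriv b 0 \<noteq> 0"
    from one[OF a(2) this, of "snd p" "snd q"] show ?thesis by eventually_elim (auto simp: a(4))
  qed
  then have "\<forall>\<^sub>F t in at 0. \<forall>q\<in>S. \<phi> t \<noteq> q" by (intro eventually_ball_finite assms(2)) auto
  then show ?thesis by eventually_elim auto
qed

lemma finite_roots_if_poly:
  assumes "f = poly p" "f 0 \<noteq> (0::complex)"
  shows "finite {v. f v = 0}"
proof -
  have "p \<noteq> 0" using assms by auto
  then show ?thesis using poly_roots_finite assms(1) by simp
qed

section \<open>Vacuum vectors of a generic operator\<close>

text \<open>\<open>u_inf\<close> and \<open>v_inf\<close> say that (infinity, 0) and (0, infinity)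
  are off the curve, so that neither line at infinity is part of it; \<open>det_adj\<close> ensures
  that \<open>f L\<close> is invertible.\<close>

locale generic_operator =
  fixes n :: nat and L :: "complex mat"
  assumes n: "n \<ge> 1" and L: "L \<in> carrier_mat (n + n) (n + n)" and det_L: "det L \<noteq> 0"
    and generic: "generic n L"
    and u_inf: "det (bmat n L (1, 0) (0, 1)) \<noteq> 0" and v_inf: "det (bmat n L (0, 1) (1, 0)) \<noteq> 0"
    and det_adj: "det (block_transpose n (adj_mat L)) \<noteq> 0"
begin

abbreviation "\<Gamma> \<equiv> vacuum_curve n L"
abbreviation "M p \<equiv> bmat n L (hom (fst p)) (hom (snd p))"

lemma smooth: "smooth_vacuum_curve n L"
  by (rule form_smooth_curve[OF generic_form_smooth[OF generic] L])

lemmas vacuum_iff = is_vacuum_iff[OF L det_L]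
lemmas pair_iff = vacuum_pair_iff[OF L det_L]
lemmas in_curve = vacuum_curve_iff[OF L]

lemma adj_nonzero: "p \<in> \<Gamma> \<Longrightarrow> \<exists>i<n. \<exists>j<n. adj_mat (M p) $$ (i, j) \<noteq> 0"
  by (rule generic_adj_nonzero[OF generic hom_nonzero hom_nonzero]) (simp add: in_curve)

text \<open>A non-zero entry of the adjugate makes the kernel a line, which determines
  \<open>X\<close> up to a factor. \<open>Y\<close> then scales by the same factor, because some
  coordinate of \<open>V\<close> is non-zero.\<close>

lemma unique_pair:
  assumes p: "p \<in> \<Gamma>"
  obtains X Y where "vacuum_pair n L p X Y"
    "\<And>X' Y'. vacuum_pair n L p X' Y' \<Longrightarrow> (\<exists>c. X' = c \<cdot>\<^sub>v X) \<and> (\<exists>c. Y' = c \<cdot>\<^sub>v Y)"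
proof -
  have det: "det (M p) = 0" using p in_curve by simp
  obtain i j where ij: "i < n" "j < n" "adj_mat (M p) $$ (i, j) \<noteq> 0" using adj_nonzero[OF p] by blast
  define X where "X = col (adj_mat (M p)) j"
  have X: "X \<in> carrier_vec n" "M p *\<^sub>v X = 0\<^sub>v n" "X $ i \<noteq> 0"
    using adj_mat(1)[OF bmat_carrier, of n L "hom (fst p)" "hom (snd p)"] ij
      adj_col_ker[OF bmat_carrier det ij(2)] by (auto simp: X_def)
  then obtain Y where Y: "Y \<in> carrier_vec n" "L *\<^sub>v tensor2 (hom (fst p)) X = tensor2 (hom (snd p)) Y"
    using bmat_ker_iff[OF L X(1) hom_nonzero] by blast
  have "X \<noteq> 0\<^sub>v n" using X ij by auto
  then have pair: "vacuum_pair n L p X Y" using X Y by (simp add: pair_iff)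
  moreover have "(\<exists>c. X' = c \<cdot>\<^sub>v X) \<and> (\<exists>c. Y' = c \<cdot>\<^sub>v Y)" if "vacuum_pair n L p X' Y'" for X' Y'
  proof -
    have X': "X' \<in> carrier_vec n" "Y' \<in> carrier_vec n"
      "L *\<^sub>v tensor2 (hom (fst p)) X' = tensor2 (hom (snd p)) Y'" using that by (auto simp: pair_iff)
    then have "M p *\<^sub>v X' = 0\<^sub>v n" using bmat_ker_iff[OF L X'(1) hom_nonzero] by blast
    then obtain c where c: "X' = c \<cdot>\<^sub>v X"
      using ker_multiple_of_adj_col[OF bmat_carrier det ij X'(1)] X_def by blast
    have "Y' = c \<cdot>\<^sub>v Y"
    proof (rule eq_vecI)
      fix k assume "k < dim_vec (c \<cdot>\<^sub>v Y)"
      then have k: "k < n" using Y by auto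
      let ?V = "hom (snd p)"
      have "fst ?V * Y' $ k = c * (fst ?V * Y $ k)" "snd ?V * Y' $ k = c * (snd ?V * Y $ k)"
        using k X' Y c tensor_eq_iff[OF L X'(1,2)] tensor_eq_iff[OF L X(1) Y(1)] tens_row_smult[OF X(1)] by metis+
      moreover have "fst ?V \<noteq> 0 \<or> snd ?V \<noteq> 0" using hom_nonzero[of "snd p"] by (auto simp: prod_eq_iff)
      ultimately have "Y' $ k = c * Y $ k" by auto
      then show "Y' $ k = (c \<cdot>\<^sub>v Y) $ k" using k Y by simp
    qed (use X' Y in auto)
    with c show ?thesis by blast
  qed
  ultimately show ?thesis using that by blast
qed

lemma unique_pairs: "unique_vacuum_pairs n L"
  unfolding unique_vacuum_pairs_def
proof
  fix p assume "p \<in> \<Gamma>"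
  then obtain X Y where "vacuum_pair n L p X Y"
    "\<And>X' Y'. vacuum_pair n L p X' Y' \<Longrightarrow> (\<exists>c. X' = c \<cdot>\<^sub>v X) \<and> (\<exists>c. Y' = c \<cdot>\<^sub>v Y)"
    by (rule unique_pair) blast
  then show "\<exists>X Y. vacuum_pair n L p X Y \<and>
     (\<forall>X' Y'. vacuum_pair n L p X' Y' \<longrightarrow> (\<exists>c. X' = c \<cdot>\<^sub>v X) \<and> (\<exists>c. Y' = c \<cdot>\<^sub>v Y))"
    by (intro exI[of _ X] exI[of _ Y]) simp
qed

lemma vacuum_smult: "is_vacuum n L p X \<Longrightarrow> c \<noteq> 0 \<Longrightarrow> is_vacuum n L p (c \<cdot>\<^sub>v X)"
  and covacuum_smult: "is_covacuum n L p Y \<Longrightarrow> c \<noteq> 0 \<Longrightarrow> is_covacuum n L p (c \<cdot>\<^sub>v Y)"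
proof -
  have z: "c \<cdot>\<^sub>v Z \<noteq> 0\<^sub>v n" if "Z \<in> carrier_vec n" "Z \<noteq> 0\<^sub>v n" "c \<noteq> 0" for c and Z :: "complex vec"
  proof
    assume "c \<cdot>\<^sub>v Z = 0\<^sub>v n"
    then have "(1 / c) \<cdot>\<^sub>v (c \<cdot>\<^sub>v Z) = 0\<^sub>v n" by auto
    then show False using that by (simp add: smult_smult_assoc)
  qed
  show "is_vacuum n L p X \<Longrightarrow> c \<noteq> 0 \<Longrightarrow> is_vacuum n L p (c \<cdot>\<^sub>v X)"
    using z by (auto simp: vacuum_iff mult_mat_vec[of _ n n])
  show "is_covacuum n L p Y \<Longrightarrow> c \<noteq> 0 \<Longrightarrow> is_covacuum n L p (c \<cdot>\<^sub>v Y)"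
    using z by (auto simp: is_covacuum_iff[OF L det_L] mult_mat_vec[of _ n n])
qed

lemma vacuum_vec_eq:
  assumes "is_vacuum n L p X" "X $ (n - 1) \<noteq> 0" "p \<in> \<Gamma>"
  shows "vacuum_vec n L p = (1 / X $ (n - 1)) \<cdot>\<^sub>v X"
proof -
  obtain X0 Y0 where "\<And>X' Y'. vacuum_pair n L p X' Y' \<Longrightarrow> (\<exists>c. X' = c \<cdot>\<^sub>v X0) \<and> (\<exists>c. Y' = c \<cdot>\<^sub>v Y0)"
    by (rule unique_pair[OF assms(3)]) blast
  note X0 = this
  show ?thesis
    unfolding vacuum_vec_def
  proof (rule the_normalized[where P = "is_vacuum n L p" and n = n])
    show "X \<in> carrier_vec n \<and> (\<exists>c. X = c \<cdot>\<^sub>v X0)" if "is_vacuum n L p X" for X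
      using that X0 by (auto simp: is_vacuum_def vacuum_pair_def)
    show "is_vacuum n L p (c \<cdot>\<^sub>v X)" if "is_vacuum n L p X" "c \<noteq> 0" for X c
      by (rule vacuum_smult[OF that])
  qed (use assms n in auto)
qed

lemma covacuum_vec_eq:
  assumes "is_covacuum n L p Y" "Y $ (n - 1) \<noteq> 0" "p \<in> \<Gamma>"
  shows "covacuum_vec n L p = (1 / Y $ (n - 1)) \<cdot>\<^sub>v Y"
proof -
  obtain X0 Y0 where "\<And>X' Y'. vacuum_pair n L p X' Y' \<Longrightarrow> (\<exists>c. X' = c \<cdot>\<^sub>v X0) \<and> (\<exists>c. Y' = c \<cdot>\<^sub>v Y0)"
    by (rule unique_pair[OF assms(3)]) blast
  note Y0 = this
  show ?thesis
    unfolding covacuum_vec_def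
  proof (rule the_normalized[where P = "is_covacuum n L p" and n = n])
    show "Y \<in> carrier_vec n \<and> (\<exists>c. Y = c \<cdot>\<^sub>v Y0)" if "is_covacuum n L p Y" for Y
      using that Y0 by (auto simp: is_covacuum_def vacuum_pair_def)
    show "is_covacuum n L p (c \<cdot>\<^sub>v Y)" if "is_covacuum n L p Y" "c \<noteq> 0" for Y c
      by (rule covacuum_smult[OF that])
  qed (use assms n in auto)
qed

text \<open>The points where the definite description of the normalised vector has no solution;
  \<open>bad_Y\<close> is its counterpart for covacuum vectors.\<close>

definition "bad_X = {p \<in> \<Gamma>. \<not> (\<exists>X. is_vacuum n L p X \<and> X $ (n - 1) = 1)}"
definition "bad_Y = {p \<in> \<Gamma>. \<not> (\<exists>Y. is_covacuum n L p Y \<and> Y $ (n - 1) = 1)}"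

lemma kernel_col:
  assumes "U \<noteq> (0, 0)" "V \<noteq> (0, 0)" "det (bmat n L U V) = 0"
  obtains j where "j < n" "nz n (vec_index (col (adj_mat (bmat n L U V)) j))"
    "\<And>k. k < n \<Longrightarrow> form4 n L (sel (perp V)) (unit_fun k) (sel U) (vec_index (col (adj_mat (bmat n L U V)) j)) = 0"
proof -
  obtain i j where ij: "i < n" "j < n" "adj_mat (bmat n L U V) $$ (i, j) \<noteq> 0"
    using generic_adj_nonzero[OF generic assms] by blast
  let ?X = "col (adj_mat (bmat n L U V)) j"
  note adj = adj_mat(1)[OF bmat_carrier, of n L U V]
  have X: "?X \<in> carrier_vec n" by (rule col_adj_carrier[OF bmat_carrier])
  have "?X $ i \<noteq> 0" using adj ij by auto
  then have "nz n (vec_index ?X)" using ij by (auto simp: nz_def)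
  moreover have "form4 n L (sel (perp V)) (unit_fun k) (sel U) (vec_index ?X) = 0" if "k < n" for k
    using adj_col_ker[OF bmat_carrier assms(3) ij(2)] that by (simp add: form4_bmat[OF X])
  ultimately show ?thesis using that ij by blast
qed

lemma form4_u_inf:
  assumes "snd U = 0" "fst U \<noteq> 0"
  shows "form4 n L W w (unit_fun 0) X = form4 n L W w (sel U) X / fst U"
proof -
  have "form4 n L W w (unit_fun 0) X = form4 n L W w (\<lambda>\<beta>. sel U \<beta> / fst U) X"
    by (rule form4_cong) (use assms in \<open>auto simp: sel_def unit_fun_def\<close>)
  then show ?thesis by (simp only: form4_scaleU)
qed

lemma form4_v_inf:
  assumes "snd V = 0" "fst V \<noteq> 0"
  shows "form4 n L (unit_fun 1) w U X = form4 n L (sel (perp V)) w U X / (- fst V)"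
proof -
  have "form4 n L (unit_fun 1) w U X = form4 n L (\<lambda>\<alpha>. sel (perp V) \<alpha> / (- fst V)) w U X"
    by (rule form4_cong) (use assms in \<open>auto simp: sel_def perp_def unit_fun_def\<close>)
  then show ?thesis by (simp only: form4_scaleW)
qed

text \<open>The polynomials are the last entries of the columns of the adjugate. A non-zero one at a
  point of the curve provides a kernel vector that can be normalised. Over infinity the third and
  fourth conditions of \<open>generic\<close> rule out a common zero on the curve.\<close>

lemma finite_bad_X: "finite bad_X"
proof -
  let ?g = "\<lambda>j z. adj_mat (bmat n L (fst z) (snd z)) $$ (n - 1, j)"
  have "finite {p \<in> \<Gamma>. \<forall>g\<in>?g ` {..<n}. g (hom (fst p), hom (snd p)) = 0}"
  proof (rule finite_common_zeros[OF L smooth n])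
    show "poly4 g" if "g \<in> ?g ` {..<n}" for g using that n by (auto intro!: poly4_adj_bmat)
    show "scale_inv g" if "g \<in> ?g ` {..<n}" for g using that n by (auto intro!: scale_inv_adj)
    fix U V :: "complex \<times> complex"
    assume UV: "U \<noteq> (0, 0)" "V \<noteq> (0, 0)" "snd U = 0 \<or> snd V = 0" "det (bmat n L U V) = 0"
    obtain j where j: "j < n" "nz n (vec_index (col (adj_mat (bmat n L U V)) j))" (is "nz n ?X")
      "\<And>k. k < n \<Longrightarrow> form4 n L (sel (perp V)) (unit_fun k) (sel U) (vec_index (col (adj_mat (bmat n L U V)) j)) = 0"
      using kernel_col[OF UV(1,2,4)] by blast
    have "?X (n - 1) = adj_mat (bmat n L U V) $$ (n - 1, j)"
      using adj_mat(1)[OF bmat_carrier, of n L U V] j(1) n by auto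
    moreover have "?X (n - 1) \<noteq> 0"
    proof
      assume z: "?X (n - 1) = 0"
      from UV(3) show False
      proof
        assume u: "snd U = 0"
        then have u': "fst U \<noteq> 0" using UV(1) by (auto simp: prod_eq_iff)
        have "\<forall>k<n. form4 n L (sel (perp V)) (unit_fun k) (unit_fun 0) ?X = 0"
          using j(3) by (simp add: form4_u_inf[OF u u'])
        then show False using generic j(2) z nz_sel[OF perp_nonzero[OF UV(2)]] unfolding generic_def by metis
      next
        assume v: "snd V = 0"
        then have v': "fst V \<noteq> 0" using UV(2) by (auto simp: prod_eq_iff)
        have "\<forall>k<n. form4 n L (unit_fun 1) (unit_fun k) (sel U) ?X = 0"
          unfolding form4_v_inf[OF v v'] using j(3) by simp
        then show False using generic j(2) z nz_sel[OF UV(1)] unfolding generic_def by metis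
      qed
    qed
    ultimately show "\<exists>g\<in>?g ` {..<n}. g (U, V) \<noteq> 0" using j(1) by auto
  qed simp
  moreover have "bad_X \<subseteq> {p \<in> \<Gamma>. \<forall>g\<in>?g ` {..<n}. g (hom (fst p), hom (snd p)) = 0}"
  proof (rule subsetI, rule ccontr)
    fix p assume p: "p \<in> bad_X" and "p \<notin> {p \<in> \<Gamma>. \<forall>g\<in>?g ` {..<n}. g (hom (fst p), hom (snd p)) = 0}"
    then obtain j where j: "j < n" "adj_mat (M p) $$ (n - 1, j) \<noteq> 0" by (auto simp: bad_X_def)
    have det: "det (M p) = 0" using p in_curve by (simp add: bad_X_def)
    let ?X = "col (adj_mat (M p)) j"
    have X: "?X \<in> carrier_vec n" "?X $ (n - 1) \<noteq> 0"
      using adj_mat(1)[OF bmat_carrier, of n L "hom (fst p)" "hom (snd p)"] j n by auto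
    then have "?X \<noteq> 0\<^sub>v n" using n by auto
    then have "is_vacuum n L p ?X" using X adj_col_ker[OF bmat_carrier det j(1)] by (simp add: vacuum_iff)
    then have "is_vacuum n L p ((1 / ?X $ (n - 1)) \<cdot>\<^sub>v ?X)" using X by (intro vacuum_smult) auto
    moreover have "((1 / ?X $ (n - 1)) \<cdot>\<^sub>v ?X) $ (n - 1) = 1"
      by (rule normalized_index[OF X(1) _ X(2)]) (use n in simp)
    ultimately show False using p unfolding bad_X_def by blast
  qed
  ultimately show ?thesis by (rule finite_subset[rotated])
qed

text \<open>Here the polynomials are the last entries of both blocks of
  \<open>L (U \<otimes> X)\<close>, for \<open>X\<close> a column of the adjugate. Both blocks are
  taken since either coordinate of \<open>V\<close> may vanish; the last two conditions of
  \<open>generic\<close> settle the points over infinity.\<close>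

lemma finite_bad_Y: "finite bad_Y"
proof -
  let ?g = "\<lambda>(j, \<alpha>) z. tens_row n L (fst z) (col (adj_mat (bmat n L (fst z) (snd z))) j) (\<alpha> * n + (n - 1))"
  let ?I = "{..<n} \<times> {..<2::nat}"
  have "finite {p \<in> \<Gamma>. \<forall>g\<in>?g ` ?I. g (hom (fst p), hom (snd p)) = 0}"
  proof (rule finite_common_zeros[OF L smooth n])
    show "poly4 g" if "g \<in> ?g ` ?I" for g using that by (auto intro!: poly4_tens_row_adj)
    show "scale_inv g" if "g \<in> ?g ` ?I" for g using that by (auto intro!: scale_inv_tens_row_adj)
    fix U V :: "complex \<times> complex"
    assume UV: "U \<noteq> (0, 0)" "V \<noteq> (0, 0)" "snd U = 0 \<or> snd V = 0" "det (bmat n L U V) = 0"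
    obtain j where j: "j < n" "nz n (vec_index (col (adj_mat (bmat n L U V)) j))" (is "nz n (vec_index ?X)")
      "\<And>k. k < n \<Longrightarrow> form4 n L (sel (perp V)) (unit_fun k) (sel U) (vec_index (col (adj_mat (bmat n L U V)) j)) = 0"
      using kernel_col[OF UV(1,2,4)] by blast
    have X: "?X \<in> carrier_vec n" by (rule col_adj_carrier[OF bmat_carrier])
    show "\<exists>g\<in>?g ` ?I. g (U, V) \<noteq> 0"
    proof (rule ccontr)
      assume "\<not> ?thesis"
      then have "tens_row n L U ?X (\<alpha> * n + (n - 1)) = 0" if "\<alpha> < 2" for \<alpha> using j(1) that by fastforce
      then have z: "form4 n L (unit_fun \<alpha>) (unit_fun (n - 1)) (sel U) (vec_index ?X) = 0" if "\<alpha> < 2" for \<alpha>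
        using form4_unit_left[OF that _ X, of "n - 1"] n that by simp
      from UV(3) show False
      proof
        assume u: "snd U = 0"
        then have u': "fst U \<noteq> 0" using UV(1) by (auto simp: prod_eq_iff)
        have "\<forall>k<n. form4 n L (sel (perp V)) (unit_fun k) (unit_fun 0) (vec_index ?X) = 0"
          "\<forall>\<alpha><2. form4 n L (unit_fun \<alpha>) (unit_fun (n - 1)) (unit_fun 0) (vec_index ?X) = 0"
          using j(3) z by (simp_all add: form4_u_inf[OF u u'])
        then show False using generic j(2) nz_sel[OF perp_nonzero[OF UV(2)]] unfolding generic_def by metis
      next
        assume v: "snd V = 0"
        then have v': "fst V \<noteq> 0" using UV(2) by (auto simp: prod_eq_iff)
        have "\<forall>k<n. form4 n L (unit_fun 1) (unit_fun k) (sel U) (vec_index ?X) = 0"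
          "form4 n L (unit_fun 0) (unit_fun (n - 1)) (sel U) (vec_index ?X) = 0"
          unfolding form4_v_inf[OF v v'] using j(3) z[of 0] by simp_all
        then show False using generic j(2) nz_sel[OF UV(1)] unfolding generic_def by metis
      qed
    qed
  qed simp
  moreover have "bad_Y \<subseteq> {p \<in> \<Gamma>. \<forall>g\<in>?g ` ?I. g (hom (fst p), hom (snd p)) = 0}"
  proof (rule subsetI, rule ccontr)
    fix p assume p: "p \<in> bad_Y" and "p \<notin> {p \<in> \<Gamma>. \<forall>g\<in>?g ` ?I. g (hom (fst p), hom (snd p)) = 0}"
    then obtain j \<alpha> where j: "j < n" "\<alpha> < (2::nat)"
      "tens_row n L (hom (fst p)) (col (adj_mat (M p)) j) (\<alpha> * n + (n - 1)) \<noteq> 0" by (auto simp: bad_Y_def)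
    have det: "det (M p) = 0" using p in_curve by (simp add: bad_Y_def)
    let ?X = "col (adj_mat (M p)) j"
    have X: "?X \<in> carrier_vec n" by (rule col_adj_carrier[OF bmat_carrier])
    then obtain Y where Y: "Y \<in> carrier_vec n" "L *\<^sub>v tensor2 (hom (fst p)) ?X = tensor2 (hom (snd p)) Y"
      using bmat_ker_iff[OF L X hom_nonzero] adj_col_ker[OF bmat_carrier det j(1)] by blast
    have "?X \<noteq> 0\<^sub>v n" using j(3) by (auto simp: tens_row_def)
    then have "vacuum_pair n L p ?X Y" using X Y by (simp add: pair_iff)
    then have cv: "is_covacuum n L p Y" by (auto simp: is_covacuum_def)
    have "Y $ (n - 1) \<noteq> 0"
    proof
      assume "Y $ (n - 1) = 0"
      then have "tens_row n L (hom (fst p)) ?X (n - 1) = 0" "tens_row n L (hom (fst p)) ?X (n + (n - 1)) = 0"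
        using tensor_eq_iff[OF L X Y(1), THEN iffD1, OF Y(2), rule_format, of "n - 1"] n by simp_all
      then show False using j(2,3) by (auto simp: less_2_cases_iff)
    qed
    then have "is_covacuum n L p ((1 / Y $ (n - 1)) \<cdot>\<^sub>v Y)" "((1 / Y $ (n - 1)) \<cdot>\<^sub>v Y) $ (n - 1) = 1"
      using cv Y n by (auto intro: covacuum_smult)
    then show False using p unfolding bad_Y_def by blast
  qed
  ultimately show ?thesis by (rule finite_subset[rotated])
qed

definition "inf_pts = {p \<in> \<Gamma>. fst p = Inf_pt \<or> snd p = Inf_pt}"

text \<open>On u = infinity the curve is cut out by a polynomial in v whose value at v = 0 is the
  determinant in \<open>u_inf\<close>, hence non-zero. The line v = infinity is symmetric.\<close>

lemma finite_inf_pts: "finite inf_pts"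
proof -
  have pol: "\<exists>q. (\<lambda>v. det (bmat n L (1, 0) (v, 1))) = poly q" "\<exists>q. (\<lambda>u. det (bmat n L (u, 1) (1, 0))) = poly q"
  proof -
    have Q: "\<exists>q. (\<lambda>_. c) = poly q" "(\<exists>q. f = poly q) \<Longrightarrow> (\<exists>q. g = poly q) \<Longrightarrow> \<exists>q. (\<lambda>x. f x + g x) = poly q"
      "(\<exists>q. f = poly q) \<Longrightarrow> (\<exists>q. g = poly q) \<Longrightarrow> \<exists>q. (\<lambda>x. f x * g x) = poly q" for c :: complex and f g :: "complex \<Rightarrow> complex"
    proof -
      show "\<exists>q. (\<lambda>_. c) = poly q" by (intro exI[of _ "[:c:]"]) auto
      show "(\<exists>q. f = poly q) \<Longrightarrow> (\<exists>q. g = poly q) \<Longrightarrow> \<exists>q. (\<lambda>x. f x + g x) = poly q"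
        by (elim exE, rule_tac x = "q + qa" in exI) (auto simp: fun_eq_iff)
      show "(\<exists>q. f = poly q) \<Longrightarrow> (\<exists>q. g = poly q) \<Longrightarrow> \<exists>q. (\<lambda>x. f x * g x) = poly q"
        by (elim exE, rule_tac x = "q * qa" in exI) (auto simp: fun_eq_iff)
    qed
    show "\<exists>q. (\<lambda>v. det (bmat n L (1, 0) (v, 1))) = poly q"
    proof (rule det_closed[where Q = "\<lambda>f. \<exists>q. f = poly q" and k = n, OF Q])
      fix i j assume "i < n" "j < n"
      then show "\<exists>q. (\<lambda>v. bmat n L (1, 0) (v, 1) $$ (i, j)) = poly q"
        by (intro exI[of _ "[:L $$ (i, j), - L $$ (n + i, j):]"]) (auto simp: bmat_index fun_eq_iff algebra_simps)
    qed (assumption | rule bmat_carrier)+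
    show "\<exists>q. (\<lambda>u. det (bmat n L (u, 1) (1, 0))) = poly q"
    proof (rule det_closed[where Q = "\<lambda>f. \<exists>q. f = poly q" and k = n, OF Q])
      fix i j assume "i < n" "j < n"
      then show "\<exists>q. (\<lambda>u. bmat n L (u, 1) (1, 0) $$ (i, j)) = poly q"
        by (intro exI[of _ "[:- L $$ (n + i, n + j), - L $$ (n + i, j):]"]) (auto simp: bmat_index fun_eq_iff algebra_simps)
    qed (assumption | rule bmat_carrier)+
  qed
  have f: "finite {v. det (bmat n L (1, 0) (v, 1)) = 0}" "finite {u. det (bmat n L (u, 1) (1, 0)) = 0}"
  proof -
    obtain q1 where q1: "(\<lambda>v. det (bmat n L (1, 0) (v, 1))) = poly q1" using pol(1) by blast
    show "finite {v. det (bmat n L (1, 0) (v, 1)) = 0}" by (rule finite_roots_if_poly[OF q1 u_inf])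
    obtain q2 where q2: "(\<lambda>u. det (bmat n L (u, 1) (1, 0))) = poly q2" using pol(2) by blast
    show "finite {u. det (bmat n L (u, 1) (1, 0)) = 0}" by (rule finite_roots_if_poly[OF q2 v_inf])
  qed
  have "inf_pts \<subseteq> {(Inf_pt, Inf_pt)} \<union> (\<lambda>v. (Inf_pt, Aff v)) ` {v. det (bmat n L (1, 0) (v, 1)) = 0} \<union>
      (\<lambda>u. (Aff u, Inf_pt)) ` {u. det (bmat n L (u, 1) (1, 0)) = 0}" (is "_ \<subseteq> ?S")
  proof
    fix p assume p: "p \<in> inf_pts"
    obtain r r' where r: "p = (r, r')" by (cases p)
    show "p \<in> ?S"
      using p by (cases r; cases r') (auto simp: inf_pts_def in_curve r)
  qed
  then show ?thesis using f by (auto intro: finite_subset)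
qed

end

context generic_operator
begin

text \<open>Chart coordinates differ from \<open>hom\<close> by factors; these are absorbed by
  rescaling \<open>y\<close>, and being a covacuum vector is insensitive to that.\<close>

lemma is_vacuum_of_hom:
  assumes U: "U \<noteq> (0, 0)" "V \<noteq> (0, 0)" and x: "x \<in> carrier_vec n" "x \<noteq> 0\<^sub>v n" and y: "y \<in> carrier_vec n"
    and eq: "L *\<^sub>v tensor2 U x = tensor2 V y"
  shows "is_vacuum n L (of_hom U, of_hom V) x" "is_covacuum n L (of_hom U, of_hom V) y"
proof -
  obtain c where c: "c \<noteq> 0" "hom (of_hom U) = scal c U" using hom_of_hom[OF U(1)] by blast
  obtain d where d: "d \<noteq> 0" "hom (of_hom V) = scal d V" using hom_of_hom[OF U(2)] by blast
  let ?y = "(c / d) \<cdot>\<^sub>v y"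
  have "L *\<^sub>v tensor2 (scal c U) x = tensor2 (scal d V) ?y"
  proof (rule tensor_eq_iff[OF L x(1), THEN iffD2])
    show "?y \<in> carrier_vec n" using y by simp
    show "\<forall>k<n. tens_row n L (scal c U) x k = fst (scal d V) * ?y $ k \<and>
        tens_row n L (scal c U) x (n + k) = snd (scal d V) * ?y $ k"
      using eq[unfolded tensor_eq_iff[OF L x(1) y]] y d(1) by (auto simp: tens_row_scal) (auto simp: scal_def)
  qed
  then have pair: "vacuum_pair n L (of_hom U, of_hom V) x ?y"
    using x y by (simp add: pair_iff c d)
  then show "is_vacuum n L (of_hom U, of_hom V) x" by (auto simp: is_vacuum_def)
  have "is_covacuum n L (of_hom U, of_hom V) ?y" using pair by (auto simp: is_covacuum_def)
  then have "is_covacuum n L (of_hom U, of_hom V) ((d / c) \<cdot>\<^sub>v ?y)"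
    by (rule covacuum_smult) (use c d in auto)
  then show "is_covacuum n L (of_hom U, of_hom V) y" using c(1) d(1) by (simp add: smult_smult_assoc)
qed

text \<open>All vacuum vectors at a point are multiples of one vector, so if one of them has last
  coordinate 1, none has last coordinate 0; likewise for covacuum vectors.\<close>

lemma last_nonzero:
  assumes p: "p \<in> \<Gamma>"
  shows "p \<notin> bad_X \<Longrightarrow> is_vacuum n L p X \<Longrightarrow> X $ (n - 1) \<noteq> 0"
    and "p \<notin> bad_Y \<Longrightarrow> is_covacuum n L p Y \<Longrightarrow> Y $ (n - 1) \<noteq> 0"
proof -
  obtain X0 Y0 where u: "\<And>X' Y'. vacuum_pair n L p X' Y' \<Longrightarrow> (\<exists>c. X' = c \<cdot>\<^sub>v X0) \<and> (\<exists>c. Y' = c \<cdot>\<^sub>v Y0)"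
    by (rule unique_pair[OF p]) blast
  have *: "Z $ (n - 1) \<noteq> 0" if Z: "Z = c \<cdot>\<^sub>v Z0" "Z \<in> carrier_vec n" "Z \<noteq> 0\<^sub>v n"
    and Z': "Z' = d \<cdot>\<^sub>v Z0" "Z' $ (n - 1) = 1" for Z Z' Z0 :: "complex vec" and c d
  proof -
    have Z0: "Z0 \<in> carrier_vec n" using Z(1,2) by auto
    then have l: "n - 1 < dim_vec Z0" using n by auto
    have "c \<noteq> 0"
    proof
      assume "c = 0"
      then have "Z = 0\<^sub>v n" using Z(1) Z0 by (auto intro!: eq_vecI)
      then show False using Z(3) by simp
    qed
    moreover have "Z0 $ (n - 1) \<noteq> 0" using Z' l by auto
    ultimately show ?thesis using l by (simp add: Z(1))
  qed
  show "X $ (n - 1) \<noteq> 0" if "p \<notin> bad_X" and X: "is_vacuum n L p X"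
  proof -
    obtain X' where X': "is_vacuum n L p X'" "X' $ (n - 1) = 1" 
      using \<open>p \<notin> bad_X\<close> p unfolding bad_X_def by blast
    obtain c d where "X = c \<cdot>\<^sub>v X0" "X' = d \<cdot>\<^sub>v X0" using u X X'(1) unfolding is_vacuum_def by blast
    moreover have "X \<in> carrier_vec n" "X \<noteq> 0\<^sub>v n" using X by (auto simp: vacuum_iff)
    ultimately show ?thesis using * X'(2) by blast
  qed
  show "Y $ (n - 1) \<noteq> 0" if "p \<notin> bad_Y" and Y: "is_covacuum n L p Y"
  proof -
    obtain Y' where Y': "is_covacuum n L p Y'" "Y' $ (n - 1) = 1" 
      using \<open>p \<notin> bad_Y\<close> p unfolding bad_Y_def by blast
    obtain c d where "Y = c \<cdot>\<^sub>v Y0" "Y' = d \<cdot>\<^sub>v Y0" using u Y Y'(1) unfolding is_covacuum_def by blast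
    moreover have "Y \<in> carrier_vec n" "Y \<noteq> 0\<^sub>v n" using Y by (auto simp: is_covacuum_def vacuum_pair_def)
    ultimately show ?thesis using * Y'(2) by blast
  qed
qed

section \<open>Analytic vectors along a local parameter\<close>

lemma chart_hom_analytic:
  assumes "a analytic_on S"
  shows "(\<lambda>t. fst (chart_hom q (a t))) analytic_on S" "(\<lambda>t. snd (chart_hom q (a t))) analytic_on S"
  using assms by (cases q; auto intro!: analytic_intros)+

text \<open>A column of the adjugate that is non-zero at \<open>p\<close> stays non-zero nearby and
  lies in the kernel at each point of the curve, so one fixed column gives vacuum vectors depending
  analytically on the parameter.\<close>

lemma local_vectors:
  assumes p: "p \<in> \<Gamma>" and \<phi>: "local_param \<Gamma> p \<phi>"
  obtains U V x y where
    "(\<lambda>t. fst (U t)) analytic_on {0}" "(\<lambda>t. snd (U t)) analytic_on {0}"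
    "(\<lambda>t. fst (V t)) analytic_on {0}" "(\<lambda>t. snd (V t)) analytic_on {0}"
    "U 0 = hom (fst p)" "V 0 = hom (snd p)"
    "\<And>i. i < n \<Longrightarrow> (\<lambda>t. x t $ i) analytic_on {0}" "\<And>i. i < n \<Longrightarrow> (\<lambda>t. y t $ i) analytic_on {0}"
    "\<And>t. x t \<in> carrier_vec n" "\<And>t. y t \<in> carrier_vec n"
    "is_vacuum n L p (x 0)" "is_covacuum n L p (y 0)"
    "\<forall>\<^sub>F t in nhds 0. U t \<noteq> (0, 0) \<and> V t \<noteq> (0, 0) \<and> \<phi> t = (of_hom (U t), of_hom (V t)) \<and> \<phi> t \<in> \<Gamma> \<and>
       x t \<noteq> 0\<^sub>v n \<and> L *\<^sub>v tensor2 (U t) (x t) = tensor2 (V t) (y t)"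
proof -
  obtain a b where ab: "a analytic_on {0}" "b analytic_on {0}" "a 0 = 0" "b 0 = 0"
    "\<phi> = (\<lambda>t. (chart (fst p) (a t), chart (snd p) (b t)))" "\<forall>\<^sub>F t in nhds 0. \<phi> t \<in> \<Gamma>"
    using \<phi> unfolding local_param_def by blast
  define U where "U t = chart_hom (fst p) (a t)" for t
  define V where "V t = chart_hom (snd p) (b t)" for t
  have UV: "(\<lambda>t. fst (U t)) analytic_on {0}" "(\<lambda>t. snd (U t)) analytic_on {0}"
    "(\<lambda>t. fst (V t)) analytic_on {0}" "(\<lambda>t. snd (V t)) analytic_on {0}"
    unfolding U_def V_def using chart_hom_analytic ab(1,2) by blast+
  have UV0: "U 0 = hom (fst p)" "V 0 = hom (snd p)" using ab(3,4) by (simp_all add: U_def V_def)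
  obtain i j where ij: "i < n" "j < n" "adj_mat (M p) $$ (i, j) \<noteq> 0" using adj_nonzero[OF p] by blast
  define x where "x t = col (adj_mat (bmat n L (U t) (V t))) j" for t
  have xc: "x t \<in> carrier_vec n" for t unfolding x_def by (rule col_adj_carrier[OF bmat_carrier])
  have xi: "x t $ k = adj_mat (bmat n L (U t) (V t)) $$ (k, j)" if "k < n" for t k
    using that ij(2) adj_mat(1)[OF bmat_carrier, of n L "U t" "V t"] by (auto simp: x_def)
  have xa: "(\<lambda>t. x t $ k) analytic_on {0}" if "k < n" for k
    unfolding xi[OF that]
    using poly4_analytic[OF poly4_adj_bmat[OF that ij(2)] UV(1,2) UV(3,4)] by simp
  \<comment> \<open>In the chart one homogeneous coordinate of \<open>V\<close> is constantly 1: the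
    first at infinity, the second elsewhere. The corresponding block of
    \<open>L (U \<otimes> X)\<close> is \<open>Y\<close> without any division.\<close>
  define y where "y t = vec n (\<lambda>k. tens_row n L (U t) (x t) (if snd p = Inf_pt then k else n + k))" for t
  have ya: "(\<lambda>t. y t $ k) analytic_on {0}" if "k < n" for k
    using that xa UV by (auto simp: y_def tens_row_def intro!: analytic_intros)
  have "x 0 $ i \<noteq> 0" using xi[OF ij(1)] ij(3) UV0 by simp
  then have "\<forall>\<^sub>F t in nhds 0. x t $ i \<noteq> 0" by (rule analytic_nonzero_eventually[OF xa[OF ij(1)]])
  with ab(6) have ev: "\<forall>\<^sub>F t in nhds 0. U t \<noteq> (0, 0) \<and> V t \<noteq> (0, 0) \<and> \<phi> t = (of_hom (U t), of_hom (V t)) \<and> \<phi> t \<in> \<Gamma> \<and>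
       x t \<noteq> 0\<^sub>v n \<and> L *\<^sub>v tensor2 (U t) (x t) = tensor2 (V t) (y t)"
  proof eventually_elim
    case (elim t)
    have nz: "U t \<noteq> (0, 0)" "V t \<noteq> (0, 0)" unfolding U_def V_def by simp_all
    have e: "\<phi> t = (of_hom (U t), of_hom (V t))" by (simp add: ab(5) chart_def U_def V_def)
    have "det (bmat n L (U t) (V t)) = 0"
      using elim(1) det_bmat_of_hom[OF nz] by (simp add: in_curve e)
    then have "bmat n L (U t) (V t) *\<^sub>v x t = 0\<^sub>v n"
      unfolding x_def by (rule adj_col_ker[OF bmat_carrier _ ij(2)])
    then obtain Y where Y: "Y \<in> carrier_vec n" "L *\<^sub>v tensor2 (U t) (x t) = tensor2 (V t) Y"
      using bmat_ker_iff[OF L xc nz(2)] by blast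
    have "y t = Y"
    proof (rule eq_vecI)
      fix k assume "k < dim_vec Y"
      then have k: "k < n" using Y by simp
      have "tens_row n L (U t) (x t) k = fst (V t) * Y $ k" "tens_row n L (U t) (x t) (n + k) = snd (V t) * Y $ k"
        using Y(2)[unfolded tensor_eq_iff[OF L xc Y(1)]] k by auto
      then show "y t $ k = Y $ k" using k by (cases "snd p") (auto simp: y_def V_def)
    qed (use Y in \<open>auto simp: y_def\<close>)
    moreover have "x t \<noteq> 0\<^sub>v n" using elim(2) ij(1) by auto
    ultimately show ?case using nz e elim(1) Y(2) by simp
  qed
  have yc: "y t \<in> carrier_vec n" for t by (simp add: y_def)
  have "\<phi> 0 = p" using ab(3,4) by (simp add: ab(5))
  then have "is_vacuum n L p (x 0)" "is_covacuum n L p (y 0)"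
    using eventually_nhds_x_imp_x[OF ev] is_vacuum_of_hom[of "U 0" "V 0" "x 0" "y 0"] xc yc by auto
  then show ?thesis using that[OF UV UV0 xa ya xc yc _ _ ev] by blast
qed

text \<open>The scalar \<open>\<lambda>\<close> in \<open>L (U \<otimes> X) = \<lambda> (V \<otimes> Y)\<close> for the normalised vectors: the last entry
  of \<open>V \<otimes> Y\<close> is \<open>1\<close>.\<close>
definition ratio :: "cp1_sq \<Rightarrow> complex" where
  "ratio q = tens_row n L (aff (fst q), 1) (vacuum_vec n L q) (n + (n - 1))"

lemma aff_of_hom: "snd U \<noteq> 0 \<Longrightarrow> aff (of_hom U) = fst U / snd U"
  by (simp add: of_hom_def)

text \<open>Along a local parameter, \<open>xn\<close> and \<open>yn\<close> are the last coordinates of nowhere vanishing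
  vacuum and covacuum vectors, and \<open>u1\<close> and \<open>v1\<close> the last homogeneous coordinates of the
  point.\<close>
definition local_data :: "cp1_sq \<Rightarrow> (complex \<Rightarrow> cp1_sq) \<Rightarrow> (complex \<Rightarrow> complex) \<Rightarrow> (complex \<Rightarrow> complex) \<Rightarrow>
    (complex \<Rightarrow> complex) \<Rightarrow> (complex \<Rightarrow> complex) \<Rightarrow> (complex \<Rightarrow> complex) \<Rightarrow> (complex \<Rightarrow> complex) \<Rightarrow>
    (complex \<Rightarrow> complex vec) \<Rightarrow> (complex \<Rightarrow> complex vec) \<Rightarrow> bool" where
  "local_data p \<phi> u0 u1 v0 v1 xn yn x y \<longleftrightarrow>
    (u0 analytic_on {0}) \<and>
    (u1 analytic_on {0}) \<and>
    (v0 analytic_on {0}) \<and>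
    (v1 analytic_on {0}) \<and>
    (xn analytic_on {0}) \<and>
    (yn analytic_on {0}) \<and>
    (\<forall>\<^sub>F t in at 0. u1 t \<noteq> 0 \<and> v1 t \<noteq> 0 \<and> xn t \<noteq> 0 \<and> yn t \<noteq> 0) \<and>
    (\<forall>i<n. (\<lambda>t. x t $ i) analytic_on {0}) \<and>
    (\<forall>i<n. (\<lambda>t. y t $ i) analytic_on {0}) \<and>
    (\<exists>i<n. x 0 $ i \<noteq> 0) \<and>
    (\<exists>i<n. y 0 $ i \<noteq> 0) \<and>
    (u1 0 = 0 \<longrightarrow> u0 0 \<noteq> 0) \<and>
    (v1 0 = 0 \<longrightarrow> v0 0 \<noteq> 0) \<and>
    (fst p \<noteq> Inf_pt \<longrightarrow> u1 0 \<noteq> 0) \<and>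
    (snd p \<noteq> Inf_pt \<longrightarrow> v1 0 \<noteq> 0) \<and>
    (p \<notin> bad_X \<longrightarrow> xn 0 \<noteq> 0) \<and>
    (p \<notin> bad_Y \<longrightarrow> yn 0 \<noteq> 0) \<and>
    (\<forall>\<^sub>F t in at 0. aff (fst (\<phi> t)) = u0 t / u1 t) \<and>
    (\<forall>\<^sub>F t in at 0. aff (snd (\<phi> t)) = v0 t / v1 t) \<and>
    (\<forall>i<n. \<forall>\<^sub>F t in at 0. vacuum_vec n L (\<phi> t) $ i = x t $ i / xn t) \<and>
    (\<forall>i<n. \<forall>\<^sub>F t in at 0. covacuum_vec n L (\<phi> t) $ i = y t $ i / yn t) \<and>
    (\<forall>\<^sub>F t in at 0. ratio (\<phi> t) = (v1 t * yn t) / (u1 t * xn t))"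

text \<open>The normalised vectors and the affine coordinates have their intended values off
  \<open>bad_X\<close>, \<open>bad_Y\<close> and \<open>inf_pts\<close>. These sets are finite, so
  the parametrisation avoids them for small non-zero parameters, and all identities hold
  there.\<close>

lemma local_orders:
  assumes p: "p \<in> \<Gamma>" and \<phi>: "local_param \<Gamma> p \<phi>"
  obtains u0 u1 v0 v1 xn yn x y where "local_data p \<phi> u0 u1 v0 v1 xn yn x y"
proof -
  obtain U V x y where UV: "(\<lambda>t. fst (U t)) analytic_on {0}" "(\<lambda>t. snd (U t)) analytic_on {0}"
    "(\<lambda>t. fst (V t)) analytic_on {0}" "(\<lambda>t. snd (V t)) analytic_on {0}"
    and UV0: "U 0 = hom (fst p)" "V 0 = hom (snd p)"
    and xy: "\<And>i. i < n \<Longrightarrow> (\<lambda>t. x t $ i) analytic_on {0}" "\<And>i. i < n \<Longrightarrow> (\<lambda>t. y t $ i) analytic_on {0}"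
    and c: "\<And>t. x t \<in> carrier_vec n" "\<And>t. y t \<in> carrier_vec n"
    and xy0: "is_vacuum n L p (x 0)" "is_covacuum n L p (y 0)"
    and ev: "\<forall>\<^sub>F t in nhds 0. U t \<noteq> (0, 0) \<and> V t \<noteq> (0, 0) \<and> \<phi> t = (of_hom (U t), of_hom (V t)) \<and> \<phi> t \<in> \<Gamma> \<and>
       x t \<noteq> 0\<^sub>v n \<and> L *\<^sub>v tensor2 (U t) (x t) = tensor2 (V t) (y t)"
    by (rule local_vectors[OF p \<phi>]) blast
  have n1: "n - 1 < n" using n by simp
  have "\<forall>\<^sub>F t in at 0. \<phi> t \<notin> bad_X \<union> bad_Y \<union> inf_pts"
    by (rule local_param_avoids[OF \<phi>]) (simp add: finite_bad_X finite_bad_Y finite_inf_pts)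
  moreover have "\<forall>\<^sub>F t in at 0. U t \<noteq> (0, 0) \<and> V t \<noteq> (0, 0) \<and> \<phi> t = (of_hom (U t), of_hom (V t)) \<and> \<phi> t \<in> \<Gamma> \<and>
       x t \<noteq> 0\<^sub>v n \<and> L *\<^sub>v tensor2 (U t) (x t) = tensor2 (V t) (y t)"
    using ev by (simp add: eventually_nhds_conv_at)
  ultimately have main: "\<forall>\<^sub>F t in at 0. snd (U t) \<noteq> 0 \<and> snd (V t) \<noteq> 0 \<and> x t $ (n - 1) \<noteq> 0 \<and> y t $ (n - 1) \<noteq> 0 \<and>
      aff (fst (\<phi> t)) = fst (U t) / snd (U t) \<and> aff (snd (\<phi> t)) = fst (V t) / snd (V t) \<and>
      vacuum_vec n L (\<phi> t) = (1 / x t $ (n - 1)) \<cdot>\<^sub>v x t \<and>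
      covacuum_vec n L (\<phi> t) = (1 / y t $ (n - 1)) \<cdot>\<^sub>v y t \<and>
      ratio (\<phi> t) = (snd (V t) * y t $ (n - 1)) / (snd (U t) * x t $ (n - 1))"
  proof eventually_elim
    case (elim t)
    then have \<phi>t: "\<phi> t = (of_hom (U t), of_hom (V t))" "\<phi> t \<in> \<Gamma>"
      "L *\<^sub>v tensor2 (U t) (x t) = tensor2 (V t) (y t)" by auto
    have "fst (\<phi> t) \<noteq> Inf_pt" "snd (\<phi> t) \<noteq> Inf_pt" using elim by (auto simp: inf_pts_def)
    then have s: "snd (U t) \<noteq> 0" "snd (V t) \<noteq> 0" by (auto simp: \<phi>t(1) of_hom_def split: if_splits)
    have v: "is_vacuum n L (\<phi> t) (x t)" "is_covacuum n L (\<phi> t) (y t)"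
      using is_vacuum_of_hom[of "U t" "V t" "x t" "y t"] elim c by auto
    have l: "x t $ (n - 1) \<noteq> 0" "y t $ (n - 1) \<noteq> 0"
      using last_nonzero[OF \<phi>t(2)] v elim by auto
    note vv = vacuum_vec_eq[OF v(1) l(1) \<phi>t(2)] covacuum_vec_eq[OF v(2) l(2) \<phi>t(2)]
    have a: "aff (fst (\<phi> t)) = fst (U t) / snd (U t)" "aff (snd (\<phi> t)) = fst (V t) / snd (V t)"
      using s by (simp_all add: \<phi>t(1) aff_of_hom)
    have "(fst (U t) / snd (U t), 1) = scal (1 / snd (U t)) (U t)" using s by (simp add: scal_def)
    then have "ratio (\<phi> t) = 1 / snd (U t) * (1 / x t $ (n - 1) * tens_row n L (U t) (x t) (n + (n - 1)))"
      unfolding ratio_def a vv by (simp only: tens_row_scal tens_row_smult[OF c(1)])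
    also have "tens_row n L (U t) (x t) (n + (n - 1)) = snd (V t) * y t $ (n - 1)"
      using \<phi>t(3)[unfolded tensor_eq_iff[OF L c]] n1 by blast
    finally show ?case using s l a vv by simp
  qed
  have d: "\<exists>i<n. v $ i \<noteq> 0" if "v \<in> carrier_vec n" "v \<noteq> 0\<^sub>v n" for v :: "complex vec"
    using nz_vec[OF that] by (simp add: nz_def)
  have x0: "\<exists>i<n. x 0 $ i \<noteq> 0" by (rule d[OF c(1)]) (use xy0 in \<open>auto simp: vacuum_iff\<close>)
  have y0: "\<exists>i<n. y 0 $ i \<noteq> 0" by (rule d[OF c(2)]) (use xy0 in \<open>auto simp: is_covacuum_def vacuum_pair_def\<close>)
  show ?thesis
  proof (rule that[of "\<lambda>t. fst (U t)" "\<lambda>t. snd (U t)" "\<lambda>t. fst (V t)" "\<lambda>t. snd (V t)"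
        "\<lambda>t. x t $ (n - 1)" "\<lambda>t. y t $ (n - 1)" x y], unfold local_data_def, intro conjI)
    show "snd (U 0) = 0 \<longrightarrow> fst (U 0) \<noteq> 0" "snd (V 0) = 0 \<longrightarrow> fst (V 0) \<noteq> 0"
      using hom_nonzero[of "fst p"] hom_nonzero[of "snd p"] unfolding UV0 by (auto simp: prod_eq_iff)
    show "fst p \<noteq> Inf_pt \<longrightarrow> snd (U 0) \<noteq> 0" "snd p \<noteq> Inf_pt \<longrightarrow> snd (V 0) \<noteq> 0"
      unfolding UV0 by (cases "fst p"; simp) (cases "snd p"; simp)
    show "p \<notin> bad_X \<longrightarrow> x 0 $ (n - 1) \<noteq> 0" "p \<notin> bad_Y \<longrightarrow> y 0 $ (n - 1) \<noteq> 0"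
      using last_nonzero[OF p] xy0 by blast+
    show "\<forall>\<^sub>F t in at 0. snd (U t) \<noteq> 0 \<and> snd (V t) \<noteq> 0 \<and> x t $ (n - 1) \<noteq> 0 \<and> y t $ (n - 1) \<noteq> 0"
      using main by eventually_elim simp
    show "\<forall>\<^sub>F t in at 0. aff (fst (\<phi> t)) = fst (U t) / snd (U t)"
      using main by eventually_elim simp
    show "\<forall>\<^sub>F t in at 0. aff (snd (\<phi> t)) = fst (V t) / snd (V t)"
      using main by eventually_elim simp
    show "\<forall>i<n. \<forall>\<^sub>F t in at 0. vacuum_vec n L (\<phi> t) $ i = x t $ i / x t $ (n - 1)"
    proof (intro allI impI)
      fix i assume i: "i < n"
      show "\<forall>\<^sub>F t in at 0. vacuum_vec n L (\<phi> t) $ i = x t $ i / x t $ (n - 1)"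
        using main by eventually_elim (use i carrier_vecD[OF c(1)] in simp)
    qed
    show "\<forall>i<n. \<forall>\<^sub>F t in at 0. covacuum_vec n L (\<phi> t) $ i = y t $ i / y t $ (n - 1)"
    proof (intro allI impI)
      fix i assume i: "i < n"
      show "\<forall>\<^sub>F t in at 0. covacuum_vec n L (\<phi> t) $ i = y t $ i / y t $ (n - 1)"
        using main by eventually_elim (use i carrier_vecD[OF c(2)] in simp)
    qed
    show "\<forall>\<^sub>F t in at 0. ratio (\<phi> t) = snd (V t) * y t $ (n - 1) / (snd (U t) * x t $ (n - 1))"
      using main by eventually_elim simp
  qed (use UV xy x0 y0 n1 in auto)
qed

lemma meromorphic_quotient:
  assumes "f analytic_on {0}" "g analytic_on {0}" "\<forall>\<^sub>F t in at 0. h t = f t / g t"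
  shows "h meromorphic_on {0}"
proof -
  have "(\<lambda>t. f t / g t) meromorphic_on {0}"
    using assms(1,2) by (intro meromorphic_on_divide analytic_on_imp_meromorphic_on)
  then show ?thesis using meromorphic_on_cong[of "{0}" h "\<lambda>t. f t / g t" "{0}"] assms(3) by simp
qed

lemma curve_meromorphic_vecs:
  "curve_meromorphic_vec n \<Gamma> (vacuum_vec n L)" "curve_meromorphic_vec n \<Gamma> (covacuum_vec n L)"
  "curve_meromorphic \<Gamma> ratio"
proof -
  have "(\<lambda>t. vacuum_vec n L (\<phi> t) $ i) meromorphic_on {0} \<and> (\<lambda>t. covacuum_vec n L (\<phi> t) $ i) meromorphic_on {0} \<and>
      (\<lambda>t. ratio (\<phi> t)) meromorphic_on {0}"
    if p: "p \<in> \<Gamma>" "local_param \<Gamma> p \<phi>" "i < n" for p \<phi> i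
  proof -
    obtain u0 u1 v0 v1 xn yn x y where data: "local_data p \<phi> u0 u1 v0 v1 xn yn x y"
      by (rule local_orders[OF p(1,2)])
    have an: "u1 analytic_on {0}" "v1 analytic_on {0}" "xn analytic_on {0}" "yn analytic_on {0}"
      and xy: "(\<lambda>t. x t $ i) analytic_on {0}" "(\<lambda>t. y t $ i) analytic_on {0}"
      and e: "\<forall>\<^sub>F t in at 0. vacuum_vec n L (\<phi> t) $ i = x t $ i / xn t"
        "\<forall>\<^sub>F t in at 0. covacuum_vec n L (\<phi> t) $ i = y t $ i / yn t"
        "\<forall>\<^sub>F t in at 0. ratio (\<phi> t) = (v1 t * yn t) / (u1 t * xn t)"
      using data p(3) unfolding local_data_def by blast+
    have "(\<lambda>t. v1 t * yn t) analytic_on {0}" "(\<lambda>t. u1 t * xn t) analytic_on {0}"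
      using an by (auto intro!: analytic_intros)
    then show ?thesis
      using meromorphic_quotient[OF xy(1) an(3) e(1)] meromorphic_quotient[OF xy(2) an(4) e(2)]
        meromorphic_quotient[OF _ _ e(3)] by blast
  qed
  note m = this
  show "curve_meromorphic_vec n \<Gamma> (vacuum_vec n L)" "curve_meromorphic_vec n \<Gamma> (covacuum_vec n L)"
    using m by (auto simp: curve_meromorphic_vec_def curve_meromorphic_def o_def)
  show "curve_meromorphic \<Gamma> ratio" using m[of _ _ 0] n by (auto simp: curve_meromorphic_def o_def)
qed

lemma well_posed: "well_posed n L"
  using smooth unique_pairs finite_bad_X finite_bad_Y curve_meromorphic_vecs
  by (simp add: well_posed_def bad_X_def bad_Y_def)

abbreviation "D_X \<equiv> pole_div_vec n \<Gamma> (vacuum_vec n L)"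
abbreviation "D_Y \<equiv> pole_div_vec n \<Gamma> (covacuum_vec n L)"
abbreviation "D_U \<equiv> pole_div \<Gamma> (\<lambda>q. aff (fst q))"
abbreviation "D_V \<equiv> pole_div \<Gamma> (\<lambda>q. aff (snd q))"

lemma divisor_orders:
  assumes p: "p \<in> \<Gamma>"
  shows "\<forall>\<^sub>F t in at 0. ratio (loc \<Gamma> p t) \<noteq> 0"
    and "zorder (ratio \<circ> loc \<Gamma> p) 0 = D_Y p - (D_X p + D_U p - D_V p)"
    and "p \<notin> bad_X \<Longrightarrow> D_X p = 0" "p \<notin> bad_Y \<Longrightarrow> D_Y p = 0"
    and "p \<notin> inf_pts \<Longrightarrow> D_U p = 0" "p \<notin> inf_pts \<Longrightarrow> D_V p = 0"
proof -
  obtain u0 u1 v0 v1 xn yn x y where data: "local_data p (loc \<Gamma> p) u0 u1 v0 v1 xn yn x y"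
    by (rule local_orders[OF p local_param_loc[OF L smooth p]])
  have an: "u0 analytic_on {0}" "u1 analytic_on {0}" "v0 analytic_on {0}" "v1 analytic_on {0}"
    "xn analytic_on {0}" "yn analytic_on {0}"
    and nz: "\<forall>\<^sub>F t in at 0. u1 t \<noteq> 0 \<and> v1 t \<noteq> 0 \<and> xn t \<noteq> 0 \<and> yn t \<noteq> 0"
    and xy: "\<forall>i<n. (\<lambda>t. x t $ i) analytic_on {0}" "\<forall>i<n. (\<lambda>t. y t $ i) analytic_on {0}"
    "\<exists>i<n. x 0 $ i \<noteq> 0" "\<exists>i<n. y 0 $ i \<noteq> 0"
    and uv0: "u1 0 = 0 \<longrightarrow> u0 0 \<noteq> 0" "v1 0 = 0 \<longrightarrow> v0 0 \<noteq> 0"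
    and fin: "fst p \<noteq> Inf_pt \<longrightarrow> u1 0 \<noteq> 0" "snd p \<noteq> Inf_pt \<longrightarrow> v1 0 \<noteq> 0"
    "p \<notin> bad_X \<longrightarrow> xn 0 \<noteq> 0" "p \<notin> bad_Y \<longrightarrow> yn 0 \<noteq> 0"
    and e: "\<forall>\<^sub>F t in at 0. aff (fst (loc \<Gamma> p t)) = u0 t / u1 t" "\<forall>\<^sub>F t in at 0. aff (snd (loc \<Gamma> p t)) = v0 t / v1 t"
    "\<forall>i<n. \<forall>\<^sub>F t in at 0. vacuum_vec n L (loc \<Gamma> p t) $ i = x t $ i / xn t"
    "\<forall>i<n. \<forall>\<^sub>F t in at 0. covacuum_vec n L (loc \<Gamma> p t) $ i = y t $ i / yn t"
    "\<forall>\<^sub>F t in at 0. ratio (loc \<Gamma> p t) = (v1 t * yn t) / (u1 t * xn t)"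
    using data unfolding local_data_def by blast+
  note xy = xy(1,2)[rule_format] xy(3,4) and uv0 = uv0[rule_format] and fin = fin[rule_format]
    and e = e(1,2) e(3,4)[rule_format] e(5)
  have nz': "\<forall>\<^sub>F t in at 0. u1 t \<noteq> 0" "\<forall>\<^sub>F t in at 0. v1 t \<noteq> 0" "\<forall>\<^sub>F t in at 0. xn t \<noteq> 0" "\<forall>\<^sub>F t in at 0. yn t \<noteq> 0"
    using nz by (auto elim: eventually_mono)
  have DX: "D_X p = zorder xn 0" by (rule pole_div_vec_quotient[OF n xy(1,3) an(5) nz'(3) e(3)])
  have DY: "D_Y p = zorder yn 0" by (rule pole_div_vec_quotient[OF n xy(2,4) an(6) nz'(4) e(4)])
  have z0: "zorder f 0 = 0" if "f analytic_on {0}" "f 0 \<noteq> 0" for f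
    using zorder_eq_0_iff[OF that(1)] that(2) analytic_nonzero_eventually[OF that]
      eventually_frequently[OF at_neq_bot, of "\<lambda>t. f t \<noteq> 0" 0] by (simp add: eventually_nhds_conv_at)
  \<comment> \<open>Numerator and denominator are homogeneous coordinates without a common zero, so
    nothing cancels and the pole order is the order of the denominator.\<close>
  have po: "pole_div \<Gamma> g p = zorder f1 0"
    if "f0 analytic_on {0}" "f1 analytic_on {0}" "\<forall>\<^sub>F t in at 0. f1 t \<noteq> 0"
      "\<forall>\<^sub>F t in at 0. g (loc \<Gamma> p t) = f0 t / f1 t" "f1 0 = 0 \<Longrightarrow> f0 0 \<noteq> 0" for f0 f1 g
  proof -
    note pq = pole_ord_quotient[OF that(1,2,3,4)]
    have "pole_ord (\<lambda>t. g (loc \<Gamma> p t)) = zorder f1 0"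
    proof (cases "f1 0 = 0")
      case True
      then show ?thesis using pq(3) that(5) by simp
    next
      case False
      then show ?thesis using pq(1,2) z0[OF that(2)] by simp
    qed
    then show ?thesis unfolding pole_div_def pole_ord_def o_def .
  qed
  have DU: "D_U p = zorder u1 0" by (rule po[OF an(1,2) nz'(1) e(1) uv0(1)])
  have DV: "D_V p = zorder v1 0" by (rule po[OF an(3,4) nz'(2) e(2) uv0(2)])
  have an2: "(\<lambda>t. v1 t * yn t) analytic_on {0}" "(\<lambda>t. u1 t * xn t) analytic_on {0}"
    using an by (auto intro!: analytic_intros)
  have nz2: "\<forall>\<^sub>F t in at 0. v1 t * yn t \<noteq> 0" "\<forall>\<^sub>F t in at 0. u1 t * xn t \<noteq> 0"
    using nz by (eventually_elim, simp)+
  have "zorder (ratio \<circ> loc \<Gamma> p) 0 = zorder (\<lambda>t. (v1 t * yn t) / (u1 t * xn t)) 0"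
    by (rule zorder_cong) (use e(5) in \<open>simp_all add: o_def\<close>)
  also have "\<dots> = zorder (\<lambda>t. v1 t * yn t) 0 - zorder (\<lambda>t. u1 t * xn t) 0"
    by (rule zorder_divide) (use an2 nz2 eventually_frequently[OF at_neq_bot] in \<open>auto intro: analytic_on_imp_meromorphic_on\<close>)
  also have "zorder (\<lambda>t. v1 t * yn t) 0 = zorder v1 0 + zorder yn 0"
    by (rule zorder_times_analytic[OF an(4,6) nz2(1)])
  also have "zorder (\<lambda>t. u1 t * xn t) 0 = zorder u1 0 + zorder xn 0"
    by (rule zorder_times_analytic[OF an(2,5) nz2(2)])
  finally show "zorder (ratio \<circ> loc \<Gamma> p) 0 = D_Y p - (D_X p + D_U p - D_V p)"
    unfolding DX DY DU DV by linarith
  show "\<forall>\<^sub>F t in at 0. ratio (loc \<Gamma> p t) \<noteq> 0" using e(5) nz by eventually_elim simp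
  show "p \<notin> bad_X \<Longrightarrow> D_X p = 0" "p \<notin> bad_Y \<Longrightarrow> D_Y p = 0"
    using DX DY z0 an fin by simp_all
  have "p \<notin> inf_pts \<Longrightarrow> fst p \<noteq> Inf_pt \<and> snd p \<noteq> Inf_pt" using p by (auto simp: inf_pts_def)
  then show "p \<notin> inf_pts \<Longrightarrow> D_U p = 0" "p \<notin> inf_pts \<Longrightarrow> D_V p = 0"
    using DU DV z0 an fin by simp_all
qed

lemma divisors: "divisor \<Gamma> D_Y" "divisor \<Gamma> (\<lambda>p. D_X p + D_U p - D_V p)"
proof -
  have f: "finite (bad_X \<union> bad_Y \<union> inf_pts)" by (simp add: finite_bad_X finite_bad_Y finite_inf_pts)
  have "p \<in> bad_X \<union> bad_Y \<union> inf_pts" if "p \<in> \<Gamma>" "D_Y p \<noteq> 0 \<or> D_X p + D_U p - D_V p \<noteq> 0" for p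
    using divisor_orders(3-6)[OF that(1)] that(2) by fastforce
  then show "divisor \<Gamma> D_Y" "divisor \<Gamma> (\<lambda>p. D_X p + D_U p - D_V p)"
    unfolding divisor_def by (auto intro!: finite_subset[OF _ f])
qed

lemma lin_equiv_D_Y: "lin_equiv \<Gamma> D_Y (\<lambda>p. D_X p + D_U p - D_V p)"
  unfolding lin_equiv_def
  by (intro conjI divisors exI[of _ ratio] curve_meromorphic_vecs ballI divisor_orders(1))
     (simp_all add: divisor_orders(2))

section \<open>Transfer from \<open>L\<close> to \<open>f L\<close>\<close>

abbreviation "L' \<equiv> f_map n L"
abbreviation "\<Gamma>' \<equiv> vacuum_curve n L'"

lemma f_map_props: "L' \<in> carrier_mat (n + n) (n + n)" "det L' \<noteq> 0" "smooth_vacuum_curve n L'"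
  "\<Gamma>' = {p. neg_inv2 p \<in> \<Gamma>}"
proof -
  show c: "L' \<in> carrier_mat (n + n) (n + n)" by (rule f_map_carrier[OF L det_L])
  show "det L' \<noteq> 0" by (rule det_f_map[OF L det_L det_adj])
  show "smooth_vacuum_curve n L'"
    by (rule form_smooth_curve[OF form_smooth_f_map[OF L det_L generic_form_smooth[OF generic]] c])
  show "\<Gamma>' = {p. neg_inv2 p \<in> \<Gamma>}" by (rule vacuum_curve_f_map[OF L det_L])
qed

text \<open>The defining predicates of the two descriptions are equivalent, so the descriptions
  agree at every \<open>p\<close>, including points where no normalised vector exists.\<close>

lemma vacuum_vec_f_map: "vacuum_vec n L' (neg_inv2 p) = covacuum_vec n L p"
  unfolding vacuum_vec_def covacuum_vec_def is_vacuum_f_map[OF L det_L f_map_props(2)] ..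

lemma local_param_f_map:
  assumes "local_param \<Gamma>' (neg_inv2 p) \<phi>"
  obtains \<phi>' where "local_param \<Gamma> p \<phi>'" "\<forall>\<^sub>F t in at 0. vacuum_vec n L' (\<phi> t) = covacuum_vec n L (\<phi>' t)"
proof -
  obtain \<phi>' where \<phi>': "local_param {q. neg_inv2 q \<in> \<Gamma>'} (neg_inv2 (neg_inv2 p)) \<phi>'"
    "\<forall>\<^sub>F t in nhds 0. neg_inv2 (\<phi> t) = \<phi>' t" using local_param_neg_inv2[OF assms] by blast
  have "\<forall>\<^sub>F t in at 0. neg_inv2 (\<phi> t) = \<phi>' t" using \<phi>'(2) by (simp add: eventually_nhds_conv_at)
  then have "\<forall>\<^sub>F t in at 0. vacuum_vec n L' (\<phi> t) = covacuum_vec n L (\<phi>' t)"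
    by eventually_elim (metis neg_inv2_neg_inv2 vacuum_vec_f_map)
  moreover have "{q. neg_inv2 q \<in> \<Gamma>'} = \<Gamma>" by (simp add: f_map_props(4))
  ultimately show ?thesis using that \<phi>'(1) by simp
qed

lemma curve_meromorphic_f_map: "curve_meromorphic_vec n \<Gamma>' (vacuum_vec n L')"
  unfolding curve_meromorphic_vec_def curve_meromorphic_def
proof (intro allI impI ballI)
  fix i p \<phi> assume i: "i < n" and p: "p \<in> \<Gamma>'" and \<phi>: "local_param \<Gamma>' p \<phi>"
  obtain \<phi>' where \<phi>': "local_param \<Gamma> (neg_inv2 p) \<phi>'"
    "\<forall>\<^sub>F t in at 0. vacuum_vec n L' (\<phi> t) = covacuum_vec n L (\<phi>' t)"
    using local_param_f_map[of "neg_inv2 p" \<phi>] \<phi> by auto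
  have "neg_inv2 p \<in> \<Gamma>" using p by (simp add: f_map_props(4))
  then have "((\<lambda>q. covacuum_vec n L q $ i) \<circ> \<phi>') meromorphic_on {0}"
    using curve_meromorphic_vecs(2) i \<phi>'(1) unfolding curve_meromorphic_vec_def curve_meromorphic_def by blast
  moreover have "\<forall>\<^sub>F t in at 0. ((\<lambda>q. vacuum_vec n L' q $ i) \<circ> \<phi>) t = ((\<lambda>q. covacuum_vec n L q $ i) \<circ> \<phi>') t"
    using \<phi>'(2) by eventually_elim simp
  ultimately show "((\<lambda>q. vacuum_vec n L' q $ i) \<circ> \<phi>) meromorphic_on {0}"
    using meromorphic_on_cong[of "{0}" "(\<lambda>q. vacuum_vec n L' q $ i) \<circ> \<phi>" "(\<lambda>q. covacuum_vec n L q $ i) \<circ> \<phi>'" "{0}"] by simp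
qed

text \<open>The parameters chosen by \<open>loc\<close> on the two curves are unrelated. The one on
  \<open>\<Gamma>'\<close> is transported to \<open>\<Gamma>\<close>, where the pole order is the
  same for every local parameter.\<close>

lemma pole_div_vec_f_map:
  assumes p: "p \<in> \<Gamma>"
  shows "pole_div_vec n \<Gamma>' (vacuum_vec n L') (neg_inv2 p) = D_Y p"
proof -
  have p': "neg_inv2 p \<in> \<Gamma>'" using p by (simp add: f_map_props(4))
  obtain \<phi>' where \<phi>': "local_param \<Gamma> p \<phi>'"
    "\<forall>\<^sub>F t in at 0. vacuum_vec n L' (loc \<Gamma>' (neg_inv2 p) t) = covacuum_vec n L (\<phi>' t)"
    using local_param_f_map[OF local_param_loc[OF f_map_props(1,3) p']] by blast
  have "pole_div \<Gamma>' (\<lambda>q. vacuum_vec n L' q $ i) (neg_inv2 p) = pole_div \<Gamma> (\<lambda>q. covacuum_vec n L q $ i) p"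
    if i: "i < n" for i
  proof -
    have "pole_div \<Gamma>' (\<lambda>q. vacuum_vec n L' q $ i) (neg_inv2 p) =
        pole_ord ((\<lambda>q. vacuum_vec n L' q $ i) \<circ> loc \<Gamma>' (neg_inv2 p))"
      by (simp add: pole_div_def pole_ord_def)
    also have "\<dots> = pole_ord ((\<lambda>q. covacuum_vec n L q $ i) \<circ> \<phi>')"
    proof (rule pole_ord_cong)
      show "\<forall>\<^sub>F t in at 0. ((\<lambda>q. vacuum_vec n L' q $ i) \<circ> loc \<Gamma>' (neg_inv2 p)) t = ((\<lambda>q. covacuum_vec n L q $ i) \<circ> \<phi>') t"
        using \<phi>'(2) by eventually_elim simp
    qed
    also have "\<dots> = pole_div \<Gamma> (\<lambda>q. covacuum_vec n L q $ i) p"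
      using curve_meromorphic_vecs(2) i
      by (intro pole_ord_local_param[OF L smooth p _ \<phi>'(1)]) (simp add: curve_meromorphic_vec_def)
    finally show ?thesis .
  qed
  then show ?thesis unfolding pole_div_vec_def by (intro arg_cong[where f = Max] image_cong) auto
qed

text \<open>The two divisors are equal on the curve, so the constant function 1 witnesses the
  equivalence.\<close>

lemma lin_equiv_f_map: "lin_equiv \<Gamma> (\<lambda>p. pole_div_vec n \<Gamma>' (vacuum_vec n L') (neg_inv2 p)) D_Y"
proof -
  have "divisor \<Gamma> (\<lambda>p. pole_div_vec n \<Gamma>' (vacuum_vec n L') (neg_inv2 p))"
    using divisors(1) unfolding divisor_def by (simp add: pole_div_vec_f_map cong: conj_cong)
  moreover have "curve_meromorphic \<Gamma> (\<lambda>_. 1)" by (auto simp: curve_meromorphic_def o_def)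
  moreover have "zorder ((\<lambda>_. 1) \<circ> \<phi>) 0 = 0" for \<phi> :: "complex \<Rightarrow> cp1_sq" by (simp add: o_def)
  ultimately show ?thesis
    unfolding lin_equiv_def using divisors(1)
    by (intro conjI exI[of _ "\<lambda>_. 1"]) (auto simp: pole_div_vec_f_map)
qed

lemma conclusion:
  "det L \<noteq> 0 \<and> det L' \<noteq> 0 \<and> well_posed n L \<and>
   smooth_vacuum_curve n L' \<and> curve_meromorphic_vec n \<Gamma>' (vacuum_vec n L') \<and>
   ((\<exists>c. c \<noteq> 0 \<and> (\<forall>u v. u \<noteq> 0 \<longrightarrow> v \<noteq> 0 \<longrightarrow>
       vacuum_poly n L' u v = c * (u ^ n * v ^ n * vacuum_poly n L (- inverse u) (- inverse v)))) \<and>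
    \<Gamma>' = {p. neg_inv2 p \<in> \<Gamma>}) \<and>
   (\<forall>p\<in>\<Gamma>. neg_inv2 p \<in> \<Gamma>' \<and>
      (\<forall>x. is_vacuum n L' (neg_inv2 p) x \<longleftrightarrow> is_covacuum n L p x) \<and>
      vacuum_vec n L' (neg_inv2 p) = covacuum_vec n L p) \<and>
   (bij_betw neg_inv2 \<Gamma> \<Gamma>' \<and>
    lin_equiv \<Gamma> (\<lambda>p. pole_div_vec n \<Gamma>' (vacuum_vec n L') (neg_inv2 p)) D_Y \<and>
    lin_equiv \<Gamma> D_Y (\<lambda>p. D_X p + D_U p - D_V p)) \<and>
   vacuum_curve n (f_map n L') = \<Gamma>"
proof (intro conjI)
  show "\<exists>c. c \<noteq> 0 \<and> (\<forall>u v. u \<noteq> 0 \<longrightarrow> v \<noteq> 0 \<longrightarrow>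
       vacuum_poly n L' u v = c * (u ^ n * v ^ n * vacuum_poly n L (- inverse u) (- inverse v)))"
    using vacuum_poly_f_map[OF L det_L] det_L by (intro exI[of _ "inverse (det L)"]) simp
  show "\<forall>p\<in>\<Gamma>. neg_inv2 p \<in> \<Gamma>' \<and>
      (\<forall>x. is_vacuum n L' (neg_inv2 p) x \<longleftrightarrow> is_covacuum n L p x) \<and>
      vacuum_vec n L' (neg_inv2 p) = covacuum_vec n L p"
    using is_vacuum_f_map[OF L det_L f_map_props(2)] by (simp add: f_map_props(4) vacuum_vec_f_map)
  show "bij_betw neg_inv2 \<Gamma> \<Gamma>'"
    by (rule bij_betw_byWitness[where f' = neg_inv2]) (auto simp: f_map_props(4))
  show "vacuum_curve n (f_map n L') = \<Gamma>"
    using vacuum_curve_f_map[OF f_map_props(1,2)] by (simp add: f_map_props(4))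
qed (use det_L f_map_props well_posed curve_meromorphic_f_map lin_equiv_f_map lin_equiv_D_Y in blast)+

end

theorem mainTheorem3:
  fixes n :: nat
  assumes "n \<ge> 1"
  shows "\<exists>Z. zariski_closed (n + n) Z \<and> Z \<noteq> carrier_mat (n + n) (n + n) \<and>
    (\<forall>L \<in> carrier_mat (n + n) (n + n) - Z.
      let L' = f_map n L;
          \<Gamma> = vacuum_curve n L; \<Gamma>' = vacuum_curve n L';
          X = vacuum_vec n L; Y = covacuum_vec n L; X' = vacuum_vec n L'
      in
        det L \<noteq> 0 \<and> det L' \<noteq> 0 \<and> well_posed n L \<and>
        smooth_vacuum_curve n L' \<and> curve_meromorphic_vec n \<Gamma>' X' \<and>
        ((\<exists>c. c \<noteq> 0 \<and> (\<forall>u v. u \<noteq> 0 \<longrightarrow> v \<noteq> 0 \<longrightarrow>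
            vacuum_poly n L' u v = c * (u ^ n * v ^ n * vacuum_poly n L (- inverse u) (- inverse v)))) \<and>
         \<Gamma>' = {p. neg_inv2 p \<in> \<Gamma>}) \<and>
        (\<forall>p\<in>\<Gamma>. neg_inv2 p \<in> \<Gamma>' \<and>
           (\<forall>x. is_vacuum n L' (neg_inv2 p) x \<longleftrightarrow> is_covacuum n L p x) \<and>
           X' (neg_inv2 p) = Y p) \<and>
        (bij_betw neg_inv2 \<Gamma> \<Gamma>' \<and>
         lin_equiv \<Gamma> (\<lambda>p. pole_div_vec n \<Gamma>' X' (neg_inv2 p)) (pole_div_vec n \<Gamma> Y) \<and>
         lin_equiv \<Gamma> (pole_div_vec n \<Gamma> Y)
           (\<lambda>p. pole_div_vec n \<Gamma> X p + pole_div \<Gamma> (\<lambda>q. aff (fst q)) p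
                 - pole_div \<Gamma> (\<lambda>q. aff (snd q)) p)) \<and>
        vacuum_curve n (f_map n L') = \<Gamma>)"
proof -
  let ?m = "n + n"
  have "thin ?m ({L. \<not> generic n L} \<union> {L. det L = 0} \<union> {L. det (bmat n L (1, 0) (0, 1)) = 0} \<union>
      {L. det (bmat n L (0, 1) (1, 0)) = 0} \<union> {L. det (block_transpose n (adj_mat L)) = 0})"
    by (intro thin_Un thin_not_generic thin_det thin_det_bmat thin_det_block_transpose_adj) (use assms in auto)
  then obtain g M0 where g: "poly_fun ?m g" "M0 \<in> carrier_mat ?m ?m" "g M0 \<noteq> 0"
    and bad: "\<And>L. L \<in> carrier_mat ?m ?m \<Longrightarrow> g L \<noteq> 0 \<Longrightarrow> L \<notin> {L. \<not> generic n L} \<union> {L. det L = 0} \<union>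
      {L. det (bmat n L (1, 0) (0, 1)) = 0} \<union> {L. det (bmat n L (0, 1) (1, 0)) = 0} \<union>
      {L. det (block_transpose n (adj_mat L)) = 0}"
    unfolding thin_def by blast
  \<comment> \<open>The zero set of the one polynomial supplied by thinness; it is proper because
    \<open>g M0\<close> is non-zero.\<close>
  define Z where "Z = {M \<in> carrier_mat ?m ?m. \<forall>h\<in>{g}. h M = 0}"
  have Z: "zariski_closed ?m Z" unfolding zariski_closed_def Z_def using g(1) by blast
  have Z': "Z \<noteq> carrier_mat ?m ?m" using g(2,3) unfolding Z_def by blast
  have op: "generic_operator n L" if "L \<in> carrier_mat ?m ?m - Z" for L
  proof -
    have "L \<in> carrier_mat ?m ?m" "g L \<noteq> 0" using that by (auto simp: Z_def)
    with bad[OF this] assms show ?thesis by unfold_locales auto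
  qed
  show ?thesis
    unfolding Let_def
    by (rule exI[of _ Z], rule conjI[OF Z conjI[OF Z']], rule ballI, rule generic_operator.conclusion[OF op])
qed

end
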